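(* Let $n$ be the dimension, $0<s<1$, and let $\Omega\subset\mathbb{R}^n$ be a locally $C^{1,1}$ domain. For $r>0$ let $B_r$ denote the ball of radius $r$ centered at any fixed point of the boundary $\partial\Omega$ (the same center for all $r$). Suppose $g\in L^\infty(\Omega\cap B_4)$ and $u$ is a nonnegative classical solution of $$ \begin{cases} (-\Delta)^s u = g, & \text{in } \Omega\cap B_4,\\ u=0, & \text{in } B_4\setminus\Omega. \end{cases} $$ Then $u\in C^{s}(\Omega\cap B_{1/2})$ and $$ \|u\|_{C^s(\Omega\cap B_{1/2})}\le C\left(\|g\|_{L^\infty(\Omega\cap B_4)}+\|u\|_{L^\infty(\Omega\cap B_4)}\right), $$ where $C$ depends on $n$, $s$ and the $C^{1,1}_{loc}$ norm of $\partial\Omega$.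
   Context: The fractional Laplacian is $$(-\Delta)^s u(x)=C_{n,s}\,\mathrm{P.V.}\int_{\mathbb{R}^n}\frac{u(x)-u(y)}{|x-y|^{n+2s}}\,dy=C_{n,s}\lim_{\varepsilon\to0}\int_{\{y\in\mathbb{R}^n:\,|y-x|\ge\varepsilon\}}\frac{u(x)-u(y)}{|x-y|^{n+2s}}\,dy,$$ where P.V. stands for the Cauchy principal value and $C_{n,s}$ is a dimensional constant. Set $$\mathcal{L}_{2s}=\left\{u\in L^1_{loc}(\mathbb{R}^n)\;:\;\int_{\mathbb{R}^n}\frac{|u(x)|}{1+|x|^{n+2s}}\,dx<\infty\right\}.$$ A classical solution of the equation in an open set $U$ (here $U=\Omega\cap B_4$) is a function $u:\mathbb{R}^n\to\mathbb{R}$ with $u\in C^{1,1}_{loc}(U)\cap\mathcal{L}_{2s}$ satisfying the equation pointwise in $U$; nonnegative means $u\ge0$ in all of $\mathbb{R}^n$. $\|\cdot\|_{C^s}$ is the usual Hölder norm (sup norm plus Hölder seminorm of exponent $s$).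
   Formalization: It is additionally assumed that u ∈ L^∞(Ω∩B_4), i.e. the right-hand side is finite; otherwise u ∈ C^s fails, e.g. for n=1, Ω=(0,∞), g=0 and u(x)=x_+^{s-1} (set to 0 for x≤0). *)

theory Defs
  imports "HOL-Analysis.Analysis" "HOL-Probability.Essential_Supremum"
begin

section \<open>Norms and function spaces\<close>

text \<open>All norms take values in \<^typ>\<open>ennreal\<close>, so that a norm is meaningful (and equal to
  \<open>\<infinity>\<close>) for functions outside the corresponding space.\<close>

definition sup_norm :: "'a set \<Rightarrow> ('a \<Rightarrow> 'b::real_normed_vector) \<Rightarrow> ennreal" where
  "sup_norm A f = (SUP x\<in>A. ennreal (norm (f x)))"

definition holder_seminorm ::
  "real \<Rightarrow> 'a::metric_space set \<Rightarrow> ('a \<Rightarrow> 'b::real_normed_vector) \<Rightarrow> ennreal" where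
  "holder_seminorm \<alpha> A f =
     (SUP (x, y)\<in>{(x, y). x \<in> A \<and> y \<in> A \<and> x \<noteq> y}. ennreal (norm (f x - f y) / dist x y powr \<alpha>))"

definition holder_norm ::
  "real \<Rightarrow> 'a::metric_space set \<Rightarrow> ('a \<Rightarrow> 'b::real_normed_vector) \<Rightarrow> ennreal" where
  "holder_norm \<alpha> A f = sup_norm A f + holder_seminorm \<alpha> A f"

definition holder_space ::
  "real \<Rightarrow> 'a::metric_space set \<Rightarrow> ('a \<Rightarrow> 'b::real_normed_vector) set" where
  "holder_space \<alpha> A = {f. holder_norm \<alpha> A f < \<infinity>}"

definition Linf_norm :: "'a::euclidean_space set \<Rightarrow> ('a \<Rightarrow> real) \<Rightarrow> ennreal" where
  "Linf_norm A f = esssup (lebesgue_on A) (\<lambda>x. ennreal \<bar>f x\<bar>)"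

definition Linf :: "'a::euclidean_space set \<Rightarrow> ('a \<Rightarrow> real) set" where
  "Linf A = {f. f \<in> borel_measurable (lebesgue_on A) \<and> Linf_norm A f < \<infinity>}"

text \<open>Only meaningful at points of differentiability.\<close>
definition gradient :: "('a::real_inner \<Rightarrow> real) \<Rightarrow> 'a \<Rightarrow> 'a" where
  "gradient f x = (THE D. GDERIV f x :> D)"

definition C11_norm :: "'a::euclidean_space set \<Rightarrow> ('a \<Rightarrow> real) \<Rightarrow> ennreal" where
  "C11_norm U f = sup_norm U f + holder_norm 1 U (gradient f)"

definition C11_loc :: "'a::euclidean_space set \<Rightarrow> ('a \<Rightarrow> real) set" where
  "C11_loc U = {f. (\<forall>x\<in>U. f differentiable (at x)) \<and>
                   (\<forall>K. compact K \<and> K \<subseteq> U \<longrightarrow> C11_norm K f < \<infinity>)}"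


section \<open>Locally \<open>C\<^sup>1\<^sup>,\<^sup>1\<close> domains\<close>

text \<open>Within the ball of radius \<open>r\<close> about \<open>p\<close>, the set is the strict epigraph, in the direction of
  the unit vector \<open>\<nu>\<close>, of a function of \<open>C\<^sup>1\<^sup>,\<^sup>1\<close> norm at most \<open>M\<close>. A function on the hyperplane
  orthogonal to \<open>\<nu>\<close> is encoded as a function on the whole space that is constant along \<open>\<nu>\<close>; this
  changes neither its differentiability nor its norm.\<close>
definition C11_graph_near ::
  "'a::euclidean_space set \<Rightarrow> 'a \<Rightarrow> real \<Rightarrow> real \<Rightarrow> bool" where
  "C11_graph_near \<Omega> p r M \<longleftrightarrow>
     (\<exists>\<nu> \<phi>. norm \<nu> = 1 \<and>
        (\<forall>y t. \<phi> (y + t *\<^sub>R \<nu>) = \<phi> y) \<and>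
        (\<forall>y\<in>ball 0 r. \<phi> differentiable (at y)) \<and>
        C11_norm (ball 0 r) \<phi> \<le> ennreal M \<and>
        \<Omega> \<inter> ball p r = {x \<in> ball p r. \<phi> (x - p) < (x - p) \<bullet> \<nu>})"

definition locally_C11_domain :: "'a::euclidean_space set \<Rightarrow> bool" where
  "locally_C11_domain \<Omega> \<longleftrightarrow>
     open \<Omega> \<and> connected \<Omega> \<and> (\<forall>p\<in>frontier \<Omega>. \<exists>r>0. \<exists>M. C11_graph_near \<Omega> p r M)"

text \<open>The size of the boundary of \<open>\<Omega>\<close> inside \<open>B\<close>: the best \<open>M\<close> such that every
  boundary point in \<open>B\<close> has a graph representation of norm at most \<open>M\<close> on a ball of radius
  \<open>1 / M\<close>. The radius has to enter, since the norm of the representing functions alone does not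
  control the geometry (two almost touching parallel hyperplanes are graphs of norm \<open>0\<close>). For a
  locally \<open>C\<^sup>1\<^sup>,\<^sup>1\<close> domain and a bounded \<open>B\<close> this is finite by compactness.\<close>
definition C11_boundary_norm :: "'a::euclidean_space set \<Rightarrow> 'a set \<Rightarrow> ennreal" where
  "C11_boundary_norm \<Omega> B =
     Inf (ennreal ` {M. 0 < M \<and> (\<forall>p\<in>frontier \<Omega> \<inter> B. C11_graph_near \<Omega> p (1 / M) M)})"


section \<open>The fractional Laplacian\<close>

text \<open>The standard normalisation, for which the Fourier symbol of \<open>(-\<Delta>)\<^sup>s\<close> is \<open>\<bar>\<xi>\<bar>\<close> to the power \<open>2s\<close>;
  note \<open>Gamma (1 - s) / s = \<bar>Gamma (- s)\<bar>\<close>.\<close>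
definition frac_laplacian_const :: "nat \<Rightarrow> real \<Rightarrow> real" where
  "frac_laplacian_const n s =
     4 powr s * s * Gamma (real n / 2 + s) / (pi powr (real n / 2) * Gamma (1 - s))"

definition has_frac_laplacian ::
  "real \<Rightarrow> (real ^ 'n \<Rightarrow> real) \<Rightarrow> real ^ 'n \<Rightarrow> real \<Rightarrow> bool" where
  "has_frac_laplacian s u x l \<longleftrightarrow>
     (let k = (\<lambda>y. (u x - u y) / norm (x - y) powr (real CARD('n) + 2 * s)) in
      (\<forall>\<epsilon>>0. set_integrable lebesgue {y. norm (y - x) \<ge> \<epsilon>} k) \<and>
      ((\<lambda>\<epsilon>. frac_laplacian_const CARD('n) s *
             (LINT y:{y. norm (y - x) \<ge> \<epsilon>}|lebesgue. k y)) \<longlongrightarrow> l) (at_right 0))"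

definition L2s_space :: "real \<Rightarrow> (real ^ 'n \<Rightarrow> real) set" where
  "L2s_space s =
     {u. (\<forall>K. compact K \<longrightarrow> set_integrable lebesgue K u) \<and>
         integrable lebesgue (\<lambda>x. \<bar>u x\<bar> / (1 + norm x powr (real CARD('n) + 2 * s)))}"

definition classical_solution ::
  "real \<Rightarrow> (real ^ 'n) set \<Rightarrow> (real ^ 'n \<Rightarrow> real) \<Rightarrow> (real ^ 'n \<Rightarrow> real) \<Rightarrow> bool" where
  "classical_solution s U g u \<longleftrightarrow>
     u \<in> C11_loc U \<and> u \<in> L2s_space s \<and> (\<forall>x\<in>U. has_frac_laplacian s u x (g x))"

end

theory Submission
  imports Defs
begin

text \<open>
  Tangent balls of uniform radius exist on both sides of the boundary, and nonnegativity bounds the mass of \<open>u\<close>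
  far away: a downward paraboloid over an interior ball touches \<open>u\<close> from below, and the equation at
  the touching point controls the nonlocal contribution of \<open>u\<close> outside. So \<open>u\<close> can be truncated and normalised.
  In the exterior of a ball with defining function \<open>Q\<close> (positive outside), \<open>Q\<^sub>+\<^sup>s - Q\<^sub>+ powr (3 s / 2) / 2\<close>
  is a strict supersolution near the ball: the first term is \<open>s\<close>-harmonic up to a curvature error of order
  \<open>Q powr (- \<kappa>)\<close> with \<open>\<kappa>\<close> small, because \<open>x\<^sub>+\<^sup>s\<close> is \<open>s\<close>-harmonic on the half-line, and the second one gains
  \<open>Q powr (- s / 2)\<close>. Comparison gives \<open>u \<le> C d\<^sup>s\<close>, where \<open>d\<close> is the distance to the boundary. Finally, doubling of
  variables with a reflection coupling of the jumps yields the full \<open>C\<^sup>s\<close> estimate at once; the boundary growth only serves to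
  exclude that the maximum of the doubled function lies on the boundary. All equations are evaluated pointwise
  at touching points.
\<close>

section \<open>Lebesgue measure and radial integrals\<close>

text \<open>The constant may contain neither an integral of \<open>u\<close> over the whole space
  nor a modulus of continuity of \<open>u\<close> at the boundary, and this shapes the proof: the
  tail is controlled by the equation itself at one point of an interior tangent ball, and the
  comparison with the barrier has to cope with a supremum that may not be attained. The exponent
  \<open>3 s / 2\<close> lies above \<open>s\<close>, so the correction is of lower order near the
  ball, and below \<open>2 s\<close>, so that its gain still blows up at the boundary and beats the
  curvature error and any bounded right-hand side. In the doubling argument equal jumps leave
  \<open>x - y\<close> unchanged and gain nothing; jumps that are mirror images in the hyperplane
  orthogonal to \<open>x - y\<close> change its length by twice the normal component of the jump,
  and there concavity of \<open>t powr s\<close> acts. Since \<open>|x - y|\<close> is small at the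
  maximum, the gain is at least of order \<open>L\<close>, and a large \<open>L\<close> outweighs
  all bounded terms. A \<open>Linf\<close> bound on the right-hand side holds only almost
  everywhere, hence the detour through continuity of the fractional Laplacian.\<close>

definition lebesgue_preserving :: "('a::euclidean_space \<Rightarrow> 'a) \<Rightarrow> bool" where
  "lebesgue_preserving T \<longleftrightarrow> T \<in> lebesgue \<rightarrow>\<^sub>M lebesgue \<and> distr lebesgue lebesgue T = lebesgue"

text \<open>Completion commutes with push-forward, so the Borel statement suffices. The Lebesgue
  version is the one required, since the fractional Laplacian integrates over
  \<open>lebesgue\<close> functions that need not be Borel.\<close>

lemma lebesgue_preservingI:
  assumes [measurable]: "T \<in> borel \<rightarrow>\<^sub>M borel" and eq: "distr lborel borel T = lborel"
  shows "lebesgue_preserving T"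
proof -
  have d: "distr lebesgue lborel T = lborel"
  proof -
    have "distr lebesgue lborel T = distr lborel lborel T"
      by (rule distr_completion) simp
    also have "\<dots> = distr lborel borel T" by (rule distr_cong) auto
    finally show ?thesis using eq by simp
  qed
  have m: "T \<in> lebesgue \<rightarrow>\<^sub>M lebesgue"
    by (rule completion.measurable_completion2) (auto simp: d measurable_completion)
  have "completion (distr lebesgue lborel T) = distr lebesgue lebesgue T"
    by (rule completion.completion_distr_eq) (auto simp: d measurable_completion)
  then have "distr lebesgue lebesgue T = lebesgue"
    by (simp add: d)
  with m show ?thesis by (simp add: lebesgue_preserving_def)
qed

lemma lebesgue_preserving_measurable:
  assumes "lebesgue_preserving T" "f \<in> borel_measurable lebesgue"
  shows "(\<lambda>x. f (T x)) \<in> borel_measurable lebesgue"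
  using assms measurable_compose unfolding lebesgue_preserving_def by blast

lemma lebesgue_preserving_integral:
  fixes f :: "'a::euclidean_space \<Rightarrow> real"
  assumes "lebesgue_preserving T" "f \<in> borel_measurable lebesgue"
  shows "integrable lebesgue (\<lambda>x. f (T x)) \<longleftrightarrow> integrable lebesgue f"
    and "(\<integral>x. f (T x) \<partial>lebesgue) = (\<integral>x. f x \<partial>lebesgue)"
proof -
  have T: "T \<in> lebesgue \<rightarrow>\<^sub>M lebesgue" and D: "distr lebesgue lebesgue T = lebesgue"
    using assms by (auto simp: lebesgue_preserving_def)
  show "integrable lebesgue (\<lambda>x. f (T x)) \<longleftrightarrow> integrable lebesgue f"
    using integrable_distr_eq[OF T, of f] D assms(2) by simp
  show "(\<integral>x. f (T x) \<partial>lebesgue) = (\<integral>x. f x \<partial>lebesgue)"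
    using integral_distr[OF T, of f] D assms(2) by simp
qed

lemma lborel_distr_uminus_euclidean:
  "distr lborel borel uminus = (lborel :: 'a::euclidean_space measure)"
proof -
  show ?thesis
    using lborel_affine[of "-1" "0::'a"] by (simp add: density_1)
qed

lemma lebesgue_preserving_uminus: "lebesgue_preserving (uminus :: 'a::euclidean_space \<Rightarrow> 'a)"
  by (rule lebesgue_preservingI) (auto simp: lborel_distr_uminus_euclidean)

lemma lebesgue_preserving_plus: "lebesgue_preserving ((+) (a::'a::euclidean_space))"
  by (rule lebesgue_preservingI) (auto simp: lborel_distr_plus)

text \<open>Uniqueness of translation-invariant measures, by Fubini: the push-forward of the Lebesgue
  measure under a linear map is translation invariant, and the unit ball fixes the constant.\<close>
lemma lborel_distr_isometric_involution:
  fixes T :: "'a::euclidean_space \<Rightarrow> 'a"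
  assumes lin: "linear T" and nrm: "\<And>x. norm (T x) = norm x" and inv: "\<And>x. T (T x) = x"
  shows "distr lborel borel T = lborel"
proof (rule measure_eqI)
  show "sets (distr lborel borel T) = sets lborel" by simp
  have Tm[measurable]: "T \<in> borel \<rightarrow>\<^sub>M borel"
    using linear_continuous_on[OF lin[unfolded linear_conv_bounded_linear]]
    by (rule borel_measurable_continuous_onI)
  fix A assume "A \<in> sets (distr lborel borel T)"
  then have A[measurable]: "A \<in> sets borel" by simp
  define f :: "'a \<Rightarrow> ennreal" where "f = indicator (ball 0 1)"
  define g :: "'a \<Rightarrow> ennreal" where "g = indicator A"
  have [measurable]: "f \<in> borel_measurable borel" "g \<in> borel_measurable borel"
    unfolding f_def g_def by (auto intro!: borel_measurable_indicator)
  have fT: "f (T x) = f x" for x by (simp add: f_def indicator_def nrm)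
  have tr: "(\<integral>\<^sup>+y. h (c + y) \<partial>lborel) = (\<integral>\<^sup>+y. h y \<partial>lborel)"
    if [measurable]: "h \<in> borel_measurable borel" for h :: "'a \<Rightarrow> ennreal" and c
  proof -
    have "(\<integral>\<^sup>+y. h y \<partial>lborel) = (\<integral>\<^sup>+y. h y \<partial>distr lborel borel ((+) c))"
      by (simp add: lborel_distr_plus)
    also have "\<dots> = (\<integral>\<^sup>+y. h (c + y) \<partial>lborel)"
      by (subst nn_integral_distr) auto
    finally show ?thesis by simp
  qed
  have fm: "(\<integral>\<^sup>+y. f (c - y) \<partial>lborel) = (\<integral>\<^sup>+y. f y \<partial>lborel)" for c
  proof -
    have "(\<integral>\<^sup>+y. f (c - y) \<partial>lborel) = (\<integral>\<^sup>+y. f (- c + y) \<partial>lborel)"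
      by (rule nn_integral_cong) (simp add: f_def indicator_def norm_minus_commute)
    also have "\<dots> = (\<integral>\<^sup>+y. f y \<partial>lborel)" by (rule tr) simp
    finally show ?thesis .
  qed
  have I: "(\<integral>\<^sup>+y. f y \<partial>lborel) = ennreal (unit_ball_vol (DIM('a)))"
    unfolding f_def using emeasure_ball[of 1 "0::'a"] by simp
  have vol: "0 < unit_ball_vol (real DIM('a))" by (rule unit_ball_vol_pos) simp
  have "(\<integral>\<^sup>+x. f x \<partial>lborel) * (\<integral>\<^sup>+y. g y \<partial>lborel) = (\<integral>\<^sup>+x. (\<integral>\<^sup>+y. f (T x) * g y \<partial>lborel) \<partial>lborel)"
    by (simp add: nn_integral_cmult nn_integral_multc fT)
  also have "\<dots> = (\<integral>\<^sup>+x. (\<integral>\<^sup>+y. f (T x) * g (T x + y) \<partial>lborel) \<partial>lborel)"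
    by (rule nn_integral_cong, rule tr[symmetric]) simp
  also have "\<dots> = (\<integral>\<^sup>+y. (\<integral>\<^sup>+x. f (T x) * g (T x + y) \<partial>lborel) \<partial>lborel)"
    by (rule lborel_pair.Fubini') measurable
  also have "\<dots> = (\<integral>\<^sup>+y. (\<integral>\<^sup>+x. f (T x - y) * g (T x) \<partial>lborel) \<partial>lborel)"
  proof (rule nn_integral_cong)
    fix y
    \<comment> \<open>Translating \<open>x\<close> by \<open>- T y\<close> moves the shift from
      \<open>g\<close> to \<open>f\<close>: linearity and \<open>T (T y) = y\<close> turn
      \<open>T (- T y + x)\<close> into \<open>T x - y\<close>.\<close>
    have "(\<integral>\<^sup>+x. f (T x) * g (T x + y) \<partial>lborel)
       = (\<integral>\<^sup>+x. f (T (- T y + x)) * g (T (- T y + x) + y) \<partial>lborel)"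
      by (rule tr[where h="\<lambda>x. f (T x) * g (T x + y)" and c="- T y", symmetric]) simp
    also have "\<dots> = (\<integral>\<^sup>+x. f (T x - y) * g (T x) \<partial>lborel)"
      by (intro nn_integral_cong) (simp add: linear_add[OF lin] linear_diff[OF lin] linear_neg[OF lin] inv)
    finally show "(\<integral>\<^sup>+x. f (T x) * g (T x + y) \<partial>lborel) = (\<integral>\<^sup>+x. f (T x - y) * g (T x) \<partial>lborel)" .
  qed
  also have "\<dots> = (\<integral>\<^sup>+x. (\<integral>\<^sup>+y. f (T x - y) * g (T x) \<partial>lborel) \<partial>lborel)"
    by (rule lborel_pair.Fubini') measurable
  also have "\<dots> = (\<integral>\<^sup>+y. f y \<partial>lborel) * (\<integral>\<^sup>+x. g (T x) \<partial>lborel)"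
    by (simp add: nn_integral_multc nn_integral_cmult fm)
  finally have "(\<integral>\<^sup>+y. g y \<partial>lborel) = (\<integral>\<^sup>+x. g (T x) \<partial>lborel)"
    unfolding I using vol by (subst (asm) ennreal_mult_cancel_left) auto
  moreover have "(\<integral>\<^sup>+x. g (T x) \<partial>lborel) = emeasure (distr lborel borel T) A"
  proof -
    have "emeasure (distr lborel borel T) A = (\<integral>\<^sup>+x. g x \<partial>distr lborel borel T)"
      unfolding g_def by (subst nn_integral_indicator) auto
    also have "\<dots> = (\<integral>\<^sup>+x. g (T x) \<partial>lborel)"
      by (rule nn_integral_distr) auto
    finally show ?thesis by simp
  qed
  moreover have "(\<integral>\<^sup>+y. g y \<partial>lborel) = emeasure lborel A"
    unfolding g_def by simp
  ultimately show "emeasure (distr lborel borel T) A = emeasure lborel A" by simp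
qed

lemma le_suminf_ennreal: fixes f :: "nat \<Rightarrow> ennreal" shows "f j \<le> suminf f"
  using sum_le_suminf[of f "{j}"] by simp

lemma power_powr: "0 < x \<Longrightarrow> ((x::real) ^ j) powr q = x powr (real j * q)"
  using powr_powr[of x "real j" q] by (simp only: powr_realpow)

section \<open>Reflections in hyperplanes\<close>

definition reflect :: "'a::real_inner \<Rightarrow> 'a \<Rightarrow> 'a" where
  "reflect e z = z - (2 * (z \<bullet> e)) *\<^sub>R e"

lemma linear_reflect: "linear (reflect e)"
  by (rule linearI) (auto simp: reflect_def inner_simps algebra_simps scaleR_add_left)

lemma norm_reflect: assumes "norm e = 1" shows "norm (reflect e z) = norm z"
proof -
  have "e \<bullet> e = 1" using assms by (simp add: dot_square_norm)
  then have "reflect e z \<bullet> reflect e z = z \<bullet> z"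
    by (simp add: reflect_def inner_simps inner_commute algebra_simps power2_eq_square)
  then show ?thesis by (simp add: norm_eq_sqrt_inner)
qed

lemma reflect_reflect: assumes "norm e = 1" shows "reflect e (reflect e z) = z"
proof -
  have "e \<bullet> e = 1" using assms by (simp add: dot_square_norm)
  then show ?thesis by (simp add: reflect_def inner_simps algebra_simps)
qed

lemma lebesgue_preserving_reflect:
  fixes e :: "'a::euclidean_space"
  assumes "norm e = 1" shows "lebesgue_preserving (reflect e)"
proof (rule lebesgue_preservingI)
  show "reflect e \<in> borel \<rightarrow>\<^sub>M borel"
    using linear_continuous_on[OF linear_reflect[of e, unfolded linear_conv_bounded_linear]]
    by (rule borel_measurable_continuous_onI)
  show "distr lborel borel (reflect e) = lborel"
    by (rule lborel_distr_isometric_involution)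
      (use assms in \<open>auto simp: linear_reflect norm_reflect reflect_reflect\<close>)
qed

section \<open>Integrals of powers of the norm by scaling and dyadic shells\<close>

lemma nn_integral_lborel_scale:
  fixes f :: "'a::euclidean_space \<Rightarrow> ennreal"
  assumes [measurable]: "f \<in> borel_measurable borel" and c: "0 < c"
  shows "(\<integral>\<^sup>+z. f z \<partial>lborel) = ennreal (c ^ DIM('a)) * (\<integral>\<^sup>+z. f (c *\<^sub>R z) \<partial>lborel)"
proof -
  have "(\<integral>\<^sup>+z. f z \<partial>lborel) =
     (\<integral>\<^sup>+z. f z \<partial>density (distr lborel borel (\<lambda>x. 0 + c *\<^sub>R x)) (\<lambda>_. \<bar>c\<bar>^DIM('a)))"
    using c by (subst lborel_affine[of c 0]) auto
  also have "\<dots> = ennreal (c ^ DIM('a)) * (\<integral>\<^sup>+z. f (c *\<^sub>R z) \<partial>lborel)"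
    using c by (simp add: nn_integral_density nn_integral_distr nn_integral_cmult)
  finally show ?thesis .
qed

text \<open>A function dominated, at each point of its support, by one member of a family of
  constants on balls is dominated by their sum; \<open>geom\<close> makes the masses of the members
  a geometric series, up to the volume of the unit ball.\<close>

lemma nn_integral_dyadic_finite:
  fixes f :: "'a::euclidean_space \<Rightarrow> ennreal" and c R :: "nat \<Rightarrow> real"
  assumes f: "\<And>z. f z \<noteq> 0 \<Longrightarrow> \<exists>j. norm z < R j \<and> f z \<le> ennreal (c j)"
    and pos: "\<And>j. 0 \<le> R j" "\<And>j. 0 \<le> c j"
    and geom: "\<And>j. c j * R j ^ DIM('a) = D * \<theta> ^ j" and D: "0 \<le> D" and \<theta>: "0 \<le> \<theta>" "\<theta> < 1"
  shows "(\<integral>\<^sup>+z. f z \<partial>lborel) < \<infinity>"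
proof -
  let ?g = "\<lambda>j z. ennreal (c j) * indicator (ball (0::'a) (R j)) z"
  let ?V = "unit_ball_vol (real DIM('a))"
  have le: "f z \<le> (\<Sum>j. ?g j z)" for z
  proof (cases "f z = 0")
    case False
    then obtain j where j: "norm z < R j" "f z \<le> ennreal (c j)" using f by blast
    then have "f z \<le> ?g j z" by simp
    also have "\<dots> \<le> (\<Sum>j. ?g j z)" by (rule le_suminf_ennreal[of "\<lambda>j. ?g j z"])
    finally show ?thesis .
  qed simp
  have "(\<integral>\<^sup>+z. f z \<partial>lborel) \<le> (\<integral>\<^sup>+z. (\<Sum>j. ?g j z) \<partial>lborel)"
    by (rule nn_integral_mono) (rule le)
  also have "\<dots> = (\<Sum>j. \<integral>\<^sup>+z. ?g j z \<partial>lborel)"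
    by (rule nn_integral_suminf) (intro borel_measurable_times_ennreal borel_measurable_indicator; simp)
  also have "\<dots> = (\<Sum>j. ennreal (?V * D * \<theta> ^ j))"
  proof (rule arg_cong[where f=suminf], rule ext)
    fix j
    have "(\<integral>\<^sup>+z. ?g j z \<partial>lborel) = ennreal (c j) * ennreal (?V * R j ^ DIM('a))"
      using pos by (subst nn_integral_cmult_indicator) (auto simp: emeasure_ball)
    also have "\<dots> = ennreal (?V * (c j * R j ^ DIM('a)))"
      using pos by (subst ennreal_mult'[symmetric]) (auto simp: mult_ac)
    finally show "(\<integral>\<^sup>+z. ?g j z \<partial>lborel) = ennreal (?V * D * \<theta> ^ j)" by (simp add: geom mult.assoc)
  qed
  also have "\<dots> = ennreal (\<Sum>j. ?V * D * \<theta> ^ j)"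
    by (rule suminf_ennreal2) (use \<theta> D in \<open>auto intro!: summable_mult summable_geometric\<close>)
  finally show ?thesis by (auto intro: le_less_trans)
qed

lemma nn_integral_norm_powr_ball_finite:
  assumes p: "- real DIM('a) < p"
  shows "(\<integral>\<^sup>+z. ennreal (indicator (ball 0 1) z * norm (z::'a::euclidean_space) powr p) \<partial>lborel) < \<infinity>"
proof -
  \<comment> \<open>Lowering the exponent to at most \<open>0\<close> only enlarges the integrand
    inside the unit ball and makes the power decreasing, so on a dyadic shell it is bounded by its
    value at the inner radius.\<close>
  define q where "q = min p 0"
  have q: "- real DIM('a) < q" "q \<le> 0" using p by (auto simp: q_def min_def)
  show ?thesis
  proof (rule nn_integral_dyadic_finite[where R="\<lambda>j. (1/2) ^ j" and c="\<lambda>j. ((1/2) ^ Suc j) powr q"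
        and D="(1/2) powr q" and \<theta>="(1/2) powr (q + real DIM('a))"])
    fix z :: 'a assume "ennreal (indicator (ball 0 1) z * norm z powr p) \<noteq> 0"
    then have z: "0 < norm z" "norm z < 1" by (auto simp: indicator_def split: if_splits)
    obtain k where k: "(1/2::real) ^ k \<le> norm z"
      using real_arch_pow_inv[of "norm z" "1/2"] z by (auto intro: less_imp_le)
    \<comment> \<open>The least admissible exponent locates the shell between
      \<open>(1/2) ^ Suc j\<close> and \<open>(1/2) ^ j\<close>.\<close>
    define m where "m = (LEAST k. (1/2::real) ^ k \<le> norm z)"
    have m: "(1/2::real) ^ m \<le> norm z" unfolding m_def using k by (rule LeastI)
    have "m \<noteq> 0" using m z by (metis not_le power_0)
    then obtain j where j: "m = Suc j" by (cases m) auto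
    have mj: "norm z < (1/2) ^ j"
      using not_less_Least[of j "\<lambda>k. (1/2::real) ^ k \<le> norm z"] j m_def by auto
    have "norm z powr p \<le> norm z powr q"
      using z by (intro powr_mono') (auto simp: q_def)
    also have "\<dots> \<le> ((1/2) ^ Suc j) powr q"
      using m j q by (intro powr_mono2') auto
    finally show "\<exists>j. norm z < (1/2) ^ j \<and>
        ennreal (indicator (ball 0 1) z * norm z powr p) \<le> ennreal (((1/2) ^ Suc j) powr q)"
      using z mj by (intro exI[of _ j]) (auto intro!: ennreal_leI)
  next
    fix j
    have "((1/2) ^ Suc j) powr q = (1/2) powr q * (1/2) powr (real j * q)"
      using power_powr[of "1/2" "Suc j" q] by (simp add: powr_add[symmetric] algebra_simps del: power_Suc)
    moreover have "((1/2::real) ^ j) ^ DIM('a) = (1/2) powr (real j * real DIM('a))"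
      using powr_realpow[of "1/2" "j * DIM('a)"] by (simp add: power_mult del: power_divide power_one_over)
    moreover have "((1/2) powr (q + real DIM('a))) ^ j = (1/2::real) powr (real j * q + real j * real DIM('a))"
      by (simp add: powr_power algebra_simps)
    ultimately show "((1/2) ^ Suc j) powr q * ((1/2) ^ j) ^ DIM('a) = (1/2) powr q * ((1/2) powr (q + real DIM('a))) ^ j"
      by (simp add: powr_add)
  qed (use q powr01_less_one[of "1/2" "q + real DIM('a)"] in auto)
qed

lemma nn_integral_norm_powr_compl_ball_finite:
  assumes p: "p < - real DIM('a)"
  shows "(\<integral>\<^sup>+z. ennreal (indicator (- ball 0 1) z * norm (z::'a::euclidean_space) powr p) \<partial>lborel) < \<infinity>"
proof (rule nn_integral_dyadic_finite[where R="\<lambda>j. 2 ^ Suc j" and c="\<lambda>j. (2 ^ j) powr p"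
      and D="2 ^ DIM('a)" and \<theta>="2 powr (p + real DIM('a))"])
  fix z :: 'a assume "ennreal (indicator (- ball 0 1) z * norm z powr p) \<noteq> 0"
  then have z: "1 \<le> norm z" by (auto simp: indicator_def split: if_splits)
  obtain k where k: "norm z < 2 ^ k" using real_arch_pow[of 2 "norm z"] by auto
  define m where "m = (LEAST k. norm z < 2 ^ k)"
  have m: "norm z < 2 ^ m" unfolding m_def using k by (rule LeastI)
  have "m \<noteq> 0" using m z by (metis not_le power_0)
  then obtain j where j: "m = Suc j" by (cases m) auto
  have "2 ^ j \<le> norm z"
    using not_less_Least[of j "\<lambda>k. norm z < 2 ^ k"] j m_def by auto
  then have "norm z powr p \<le> (2 ^ j) powr p" using p by (intro powr_mono2') auto
  then show "\<exists>j. norm z < 2 ^ Suc j \<and> ennreal (indicator (- ball 0 1) z * norm z powr p) \<le> ennreal ((2 ^ j) powr p)"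
    using z m j by (intro exI[of _ j]) (auto intro!: ennreal_leI)
next
  fix j
  have "(2 ^ j) powr p = 2 powr (real j * p)" using power_powr[of 2 j p] by simp
  moreover have "((2::real) ^ Suc j) ^ DIM('a) = 2 ^ DIM('a) * 2 powr (real j * real DIM('a))"
    using powr_realpow[of 2 "j * DIM('a)"] by (simp add: power_mult_distrib power_mult)
  moreover have "(2 powr (p + real DIM('a))) ^ j = (2::real) powr (real j * p + real j * real DIM('a))"
    by (simp add: powr_power algebra_simps)
  ultimately show "(2 ^ j) powr p * (2 ^ Suc j) ^ DIM('a) = 2 ^ DIM('a) * (2 powr (p + real DIM('a))) ^ j"
    by (simp add: powr_add)
qed (use p in \<open>auto simp: powr_less_one\<close>)

text \<open>Dilation by \<open>r\<close> for nonnegative integrals: finiteness at scale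
  \<open>1\<close> yields both integrability and the value at scale \<open>r\<close>. Balls and
  complements of balls are the two instances.\<close>

lemma integral_norm_powr_scale:
  fixes S :: "'a::euclidean_space set"
  assumes [measurable]: "S \<in> sets borel"
    and fin: "(\<integral>\<^sup>+z. ennreal (indicator S z * norm z powr p) \<partial>lborel) < \<infinity>"
    and r: "0 < r"
  shows "integrable lebesgue (\<lambda>z. indicator ((\<lambda>z. r *\<^sub>R z) ` S) z * norm z powr p)" (is ?i)
    and "(\<integral>z. indicator ((\<lambda>z. r *\<^sub>R z) ` S) z * norm z powr p \<partial>lebesgue)
       = r powr (p + real DIM('a)) * (\<integral>z. indicator S z * norm z powr p \<partial>lebesgue)" (is ?e)
proof -
  let ?S = "(\<lambda>z. r *\<^sub>R z) ` S"
  have S: "?S = (\<lambda>z. (1/r) *\<^sub>R z) -` S"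
    using r by (auto simp: image_iff intro!: bexI[of _ "(1/r) *\<^sub>R _"])
  have [measurable]: "?S \<in> sets borel"
    unfolding S using measurable_sets_borel[of "\<lambda>z. (1/r) *\<^sub>R z" borel S] by simp
  have ind: "indicator ?S (r *\<^sub>R z) = (indicator S z :: real)" for z
    using r by (auto simp: indicator_def)
  have nn: "(\<integral>\<^sup>+z. ennreal (indicator ?S z * norm z powr p) \<partial>lborel)
      = ennreal (r powr (p + real DIM('a))) * (\<integral>\<^sup>+z. ennreal (indicator S z * norm z powr p) \<partial>lborel)"
  proof -
    have "(\<integral>\<^sup>+z. ennreal (indicator ?S z * norm z powr p) \<partial>lborel) =
      ennreal (r ^ DIM('a)) * (\<integral>\<^sup>+z. ennreal (indicator ?S (r *\<^sub>R z) * norm (r *\<^sub>R z) powr p) \<partial>lborel)"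
      by (rule nn_integral_lborel_scale) (use r in auto)
    also have "(\<integral>\<^sup>+z. ennreal (indicator ?S (r *\<^sub>R z) * norm (r *\<^sub>R z) powr p) \<partial>lborel)
      = (\<integral>\<^sup>+z. ennreal (r powr p) * ennreal (indicator S z * norm z powr p) \<partial>lborel)"
      using r by (intro nn_integral_cong) (simp add: ind powr_mult ennreal_mult[symmetric] algebra_simps)
    also have "\<dots> = ennreal (r powr p) * (\<integral>\<^sup>+z. ennreal (indicator S z * norm z powr p) \<partial>lborel)"
      by (rule nn_integral_cmult) measurable
    also have "ennreal (r ^ DIM('a)) * \<dots> = ennreal (r powr (p + real DIM('a))) * (\<integral>\<^sup>+z. ennreal (indicator S z * norm z powr p) \<partial>lborel)"
      using r by (simp add: powr_add powr_realpow ennreal_mult' mult.assoc[symmetric] mult.commute)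
    finally show ?thesis .
  qed
  have "integrable lborel (\<lambda>z. indicator ?S z * norm z powr p)"
    unfolding integrable_iff_bounded using fin nn
    by (auto simp: ennreal_mult_less_top abs_mult)
  then show ?i by (subst integrable_completion) auto
  have "(\<integral>z. indicator ?S z * norm z powr p \<partial>lborel) = r powr (p + real DIM('a)) * (\<integral>z. indicator S z * norm z powr p \<partial>lborel)"
    by (simp add: integral_eq_nn_integral nn enn2real_mult)
  then show ?e by (simp add: integral_completion)
qed

lemma integrable_norm_powr_ball:
  assumes p: "- real DIM('a) < p" and r: "0 < r"
  shows "integrable lebesgue (\<lambda>z::'a::euclidean_space. indicator (ball 0 r) z * norm z powr p)"
    and "(\<integral>z. indicator (ball 0 r) (z::'a) * norm z powr p \<partial>lebesgue)
       = r powr (p + real DIM('a)) * (\<integral>z. indicator (ball 0 1) (z::'a) * norm z powr p \<partial>lebesgue)"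
proof -
  have b: "(\<lambda>z::'a. r *\<^sub>R z) ` ball 0 1 = ball 0 r"
    using ball_scale[of r "0::'a" 1] r by simp
  show "integrable lebesgue (\<lambda>z::'a::euclidean_space. indicator (ball 0 r) z * norm z powr p)"
    using integral_norm_powr_scale(1)[OF _ nn_integral_norm_powr_ball_finite[OF p] r] b by simp
  show "(\<integral>z. indicator (ball 0 r) (z::'a) * norm z powr p \<partial>lebesgue)
       = r powr (p + real DIM('a)) * (\<integral>z. indicator (ball 0 1) (z::'a) * norm z powr p \<partial>lebesgue)"
    using integral_norm_powr_scale(2)[OF _ nn_integral_norm_powr_ball_finite[OF p] r] b by simp
qed

lemma integrable_norm_powr_compl_ball:
  assumes p: "p < - real DIM('a)" and r: "0 < r"
  shows "integrable lebesgue (\<lambda>z::'a::euclidean_space. indicator (- ball 0 r) z * norm z powr p)"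
    and "(\<integral>z. indicator (- ball 0 r) (z::'a) * norm z powr p \<partial>lebesgue)
       = r powr (p + real DIM('a)) * (\<integral>z. indicator (- ball 0 1) (z::'a) * norm z powr p \<partial>lebesgue)"
proof -
  have b: "(\<lambda>z::'a. r *\<^sub>R z) ` (- ball 0 1) = - ball 0 r"
  proof -
    have "bij (\<lambda>z::'a. r *\<^sub>R z)" using r by (intro o_bij[of "\<lambda>z. (1/r) *\<^sub>R z"]) auto
    then have "(\<lambda>z::'a. r *\<^sub>R z) ` (- ball 0 1) = - ((\<lambda>z::'a. r *\<^sub>R z) ` ball 0 1)"
      by (rule bij_image_Compl_eq)
    also have "(\<lambda>z::'a. r *\<^sub>R z) ` ball 0 1 = ball 0 r"
      using ball_scale[of r "0::'a" 1] r by simp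
    finally show ?thesis .
  qed
  show "integrable lebesgue (\<lambda>z::'a::euclidean_space. indicator (- ball 0 r) z * norm z powr p)"
    using integral_norm_powr_scale(1)[OF _ nn_integral_norm_powr_compl_ball_finite[OF p] r] b by simp
  show "(\<integral>z. indicator (- ball 0 r) (z::'a) * norm z powr p \<partial>lebesgue)
       = r powr (p + real DIM('a)) * (\<integral>z. indicator (- ball 0 1) (z::'a) * norm z powr p \<partial>lebesgue)"
    using integral_norm_powr_scale(2)[OF _ nn_integral_norm_powr_compl_ball_finite[OF p] r] b by simp
qed

section \<open>Symmetrised principal values\<close>

text \<open>By the convention \<open>0 powr a = 0\<close> the kernel vanishes at the origin, so
  every integrand that contains it is \<open>0\<close> at the singular point.\<close>

definition riesz_kernel :: "real \<Rightarrow> real ^ 'n \<Rightarrow> real" where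
  "riesz_kernel s z = norm z powr - (real CARD('n) + 2 * s)"

abbreviation kernel_integrable :: "real \<Rightarrow> (real ^ 'n \<Rightarrow> real) \<Rightarrow> bool" where
  "kernel_integrable s h \<equiv> integrable lebesgue (\<lambda>z. h z * riesz_kernel s z)"

abbreviation kernel_integral :: "real \<Rightarrow> (real ^ 'n \<Rightarrow> real) \<Rightarrow> real" where
  "kernel_integral s h \<equiv> \<integral>z. h z * riesz_kernel s z \<partial>lebesgue"

abbreviation cutoff :: "nat \<Rightarrow> (real ^ 'n) set" where
  "cutoff i \<equiv> - ball 0 (1 / real (Suc i))"

text \<open>Signed like the negative Laplacian: at a global maximum of \<open>u\<close> it is
  nonnegative for every \<open>z\<close>.\<close>

definition second_diff :: "(real ^ 'n \<Rightarrow> real) \<Rightarrow> real ^ 'n \<Rightarrow> real ^ 'n \<Rightarrow> real" where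
  "second_diff u x z = 2 * u x - u (x + z) - u (x - z)"

text \<open>Averaging the truncated integrals over \<open>z\<close> and \<open>-z\<close> makes the principal value absolutely
  convergent for functions of class \<open>C\<^sup>1\<^sup>,\<^sup>1\<close>; it is enough to follow the cut-offs \<open>1 / (i + 1)\<close>.\<close>
definition pv_limit :: "real \<Rightarrow> (real ^ 'n \<Rightarrow> real) \<Rightarrow> real \<Rightarrow> bool" where
  "pv_limit s D l \<longleftrightarrow>
     (\<forall>i::nat. integrable lebesgue (\<lambda>z. indicator (cutoff i) z * (D z * riesz_kernel s z))) \<and>
     (\<lambda>i. frac_laplacian_const CARD('n) s / 2 *
        (\<integral>z. indicator (cutoff i) z * (D z * riesz_kernel s z) \<partial>lebesgue)) \<longlonglongrightarrow> l"

lemma frac_laplacian_const_pos: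
  assumes "0 < s" "s < 1" shows "0 < frac_laplacian_const n s"
  unfolding frac_laplacian_const_def using assms
  by (intro divide_pos_pos mult_pos_pos Gamma_real_pos) (auto intro: add_nonneg_pos)

lemma riesz_kernel_nonneg [simp]: "0 \<le> riesz_kernel s z"
  by (simp add: riesz_kernel_def)

lemma riesz_kernel_zero [simp]: "riesz_kernel s 0 = 0"
  by (simp add: riesz_kernel_def)

lemma riesz_kernel_minus [simp]: "riesz_kernel s (- z) = riesz_kernel s z"
  by (simp add: riesz_kernel_def)

lemma riesz_kernel_borel [measurable]: "riesz_kernel s \<in> borel_measurable borel"
  unfolding riesz_kernel_def by measurable

lemma riesz_kernel_measurable [measurable]: "riesz_kernel s \<in> borel_measurable lebesgue"
  by (rule measurable_completion) simp

text \<open>Translation puts the base point at the origin, where cut-offs and kernel are even and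
  invariant under reflections.\<close>

lemma has_frac_laplacian_integrable:
  fixes u :: "real ^ 'n \<Rightarrow> real"
  assumes "has_frac_laplacian s u x l" "0 < \<epsilon>"
  shows "integrable lebesgue (\<lambda>z. indicator (- ball 0 \<epsilon>) z * ((u x - u (x + z)) * riesz_kernel s z))"
    and "(\<integral>z. indicator (- ball 0 \<epsilon>) z * ((u x - u (x + z)) * riesz_kernel s z) \<partial>lebesgue) =
      (LINT y:{y. norm (y - x) \<ge> \<epsilon>}|lebesgue. (u x - u y) / norm (x - y) powr (real CARD('n) + 2 * s))"
proof -
  define F where "F = (\<lambda>y. indicator {y. norm (y - x) \<ge> \<epsilon>} y *\<^sub>R
     ((u x - u y) / norm (x - y) powr (real CARD('n) + 2 * s)))"
  have F: "integrable lebesgue F"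
    using assms unfolding has_frac_laplacian_def Let_def set_integrable_def F_def by auto
  have eq: "F (x + z) = indicator (- ball 0 \<epsilon>) z * ((u x - u (x + z)) * riesz_kernel s z)" for z
    by (auto simp: F_def indicator_def riesz_kernel_def powr_minus_divide simp del: minus_add_distrib)
  show "integrable lebesgue (\<lambda>z. indicator (- ball 0 \<epsilon>) z * ((u x - u (x + z)) * riesz_kernel s z))"
    using lebesgue_preserving_integral(1)[OF lebesgue_preserving_plus[of x], of F] F
    by (simp add: eq)
  show "(\<integral>z. indicator (- ball 0 \<epsilon>) z * ((u x - u (x + z)) * riesz_kernel s z) \<partial>lebesgue) =
      (LINT y:{y. norm (y - x) \<ge> \<epsilon>}|lebesgue. (u x - u y) / norm (x - y) powr (real CARD('n) + 2 * s))"
    (is "?l = ?r")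
  proof -
    have "?l = (\<integral>z. F (x + z) \<partial>lebesgue)" by (simp add: eq)
    also have "\<dots> = (\<integral>z. F z \<partial>lebesgue)"
      using lebesgue_preserving_integral(2)[OF lebesgue_preserving_plus[of x], of F] F by auto
    also have "\<dots> = ?r" by (simp add: set_lebesgue_integral_def F_def)
    finally show ?thesis .
  qed
qed

lemma has_frac_laplacian_imp_pv_limit:
  fixes u :: "real ^ 'n \<Rightarrow> real"
  assumes "has_frac_laplacian s u x l"
  shows "pv_limit s (second_diff u x) l"
proof -
  define F where "F \<epsilon> = (\<lambda>z. indicator (- ball 0 \<epsilon>) z * ((u x - u (x + z)) * riesz_kernel s z))" for \<epsilon>
  have F: "integrable lebesgue (F \<epsilon>)" if "0 < \<epsilon>" for \<epsilon>
    using has_frac_laplacian_integrable(1)[OF assms that] by (simp add: F_def)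
  have F': "integrable lebesgue (\<lambda>z. F \<epsilon> (- z))" if "0 < \<epsilon>" for \<epsilon>
    using lebesgue_preserving_integral(1)[OF lebesgue_preserving_uminus, of "F \<epsilon>"] F[OF that] by simp
  \<comment> \<open>The averaged integrand is \<open>F z + F (- z)\<close>, whose integral is twice
    that of \<open>F\<close>; hence the factor \<open>1 / 2\<close> in
    \<open>pv_limit\<close>.\<close>
  have eq: "indicator (- ball 0 \<epsilon>) z * (second_diff u x z * riesz_kernel s z) = F \<epsilon> z + F \<epsilon> (- z)" for z \<epsilon>
    by (auto simp: F_def second_diff_def indicator_def algebra_simps)
  have int: "integrable lebesgue (\<lambda>z. indicator (- ball 0 \<epsilon>) z * (second_diff u x z * riesz_kernel s z))"
    and val: "(\<integral>z. indicator (- ball 0 \<epsilon>) z * (second_diff u x z * riesz_kernel s z) \<partial>lebesgue)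
        = 2 * (\<integral>z. F \<epsilon> z \<partial>lebesgue)" if "0 < \<epsilon>" for \<epsilon>
    unfolding eq using F[OF that] F'[OF that]
      lebesgue_preserving_integral(2)[OF lebesgue_preserving_uminus, of "F \<epsilon>"]
    by auto
  have lim: "((\<lambda>\<epsilon>. frac_laplacian_const CARD('n) s * (LINT y:{y. norm (y - x) \<ge> \<epsilon>}|lebesgue.
      (u x - u y) / norm (x - y) powr (real CARD('n) + 2 * s))) \<longlongrightarrow> l) (at_right 0)"
    using assms by (simp add: has_frac_laplacian_def Let_def)
  have "filterlim (\<lambda>i::nat. 1 / real (Suc i)) (at_right 0) sequentially"
    unfolding filterlim_at using LIMSEQ_inverse_real_of_nat by (auto simp: inverse_eq_divide)
  from filterlim_compose[OF lim this]
  have "(\<lambda>i. frac_laplacian_const CARD('n) s / 2 * (\<integral>z. indicator (cutoff i) z * (second_diff u x z * riesz_kernel s z) \<partial>lebesgue)) \<longlonglongrightarrow> l"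
    by (subst val) (simp_all add: F_def has_frac_laplacian_integrable(2)[OF assms])
  with int show ?thesis by (simp add: pv_limit_def)
qed

text \<open>Dominated convergence. The cut-off regions exhaust everything except the origin, where
  \<open>H 0 = 0\<close>.\<close>

lemma integral_exhaust_punctured:
  fixes H :: "real ^ 'n \<Rightarrow> real"
  assumes "integrable lebesgue H" "H 0 = 0"
  shows "(\<lambda>i. \<integral>z. indicator (cutoff i) z * H z \<partial>lebesgue) \<longlonglongrightarrow> (\<integral>z. H z \<partial>lebesgue)"
proof (rule integral_dominated_convergence[where w="\<lambda>z. norm (H z)"])
  show "H \<in> borel_measurable lebesgue" using assms by simp
  show "(\<lambda>z. indicator (cutoff i) z * H z) \<in> borel_measurable lebesgue" for i
    using assms(1) by (intro borel_measurable_times borel_measurable_indicator) auto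
  show "integrable lebesgue (\<lambda>z. norm (H z))" using assms(1) by (rule integrable_norm)
  show "AE z in lebesgue. norm (indicator (cutoff i) z * H z) \<le> norm (H z)" for i
    by (auto simp: indicator_def)
  have "(\<lambda>i. indicator (cutoff i) z * H z) \<longlonglongrightarrow> H z" for z
  proof (cases "z = 0")
    case False
    have "(\<lambda>i. 1 / real (Suc i)) \<longlonglongrightarrow> 0"
      using LIMSEQ_inverse_real_of_nat by (simp add: inverse_eq_divide)
    then have "eventually (\<lambda>i. 1 / real (Suc i) < norm z) sequentially"
      using False by (intro order_tendstoD(2)) auto
    then have "eventually (\<lambda>i. indicator (cutoff i) z * H z = H z) sequentially"
      by eventually_elim (auto simp: indicator_def)
    then show ?thesis by (rule tendsto_eventually)
  qed (simp add: assms)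
  then show "AE z in lebesgue. (\<lambda>i. indicator (cutoff i) z * H z) \<longlonglongrightarrow> H z"
    by simp
qed

text \<open>This is how the equation is read off at a touching point: the second difference is
  bounded below by an absolutely integrable \<open>h\<close>, the bound is integrated over each
  cut-off region, and the limit is taken afterwards. \<open>D\<close> itself may be only
  conditionally integrable at the origin.\<close>

lemma pv_limit_lower:
  fixes D :: "real ^ 'n \<Rightarrow> real"
  assumes s: "0 < s" "s < 1" and u: "pv_limit s D l"
    and h: "kernel_integrable s h"
    and le: "\<And>z. z \<noteq> 0 \<Longrightarrow> h z \<le> D z"
  shows "frac_laplacian_const CARD('n) s / 2 * kernel_integral s h \<le> l"
proof (rule LIMSEQ_le)
  let ?c = "frac_laplacian_const CARD('n) s / 2"
  show "(\<lambda>i. ?c * (\<integral>z. indicator (cutoff i) z * (h z * riesz_kernel s z) \<partial>lebesgue))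
     \<longlonglongrightarrow> ?c * kernel_integral s h"
    by (intro tendsto_mult_left integral_exhaust_punctured h) simp
  show "(\<lambda>i. ?c * (\<integral>z. indicator (cutoff i) z * (D z * riesz_kernel s z) \<partial>lebesgue)) \<longlonglongrightarrow> l"
    using u by (simp add: pv_limit_def)
  have "(\<integral>z. indicator (cutoff i) z * (h z * riesz_kernel s z) \<partial>lebesgue)
     \<le> (\<integral>z. indicator (cutoff i) z * (D z * riesz_kernel s z) \<partial>lebesgue)" for i
  proof (rule integral_mono)
    show "integrable lebesgue (\<lambda>z. indicator (cutoff i) z * (h z * riesz_kernel s z))"
      using integrable_mult_indicator[OF _ h, of "cutoff i"] by simp
    show "integrable lebesgue (\<lambda>z. indicator (cutoff i) z * (D z * riesz_kernel s z))"
      using u by (simp add: pv_limit_def)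
    show "indicator (cutoff i) z * (h z * riesz_kernel s z)
        \<le> indicator (cutoff i) z * (D z * riesz_kernel s z)" for z
      using le[of z] by (cases "z = 0") (auto simp: indicator_def intro: mult_right_mono)
  qed
  then show "\<exists>N. \<forall>i\<ge>N. ?c * (\<integral>z. indicator (cutoff i) z * (h z * riesz_kernel s z) \<partial>lebesgue)
     \<le> ?c * (\<integral>z. indicator (cutoff i) z * (D z * riesz_kernel s z) \<partial>lebesgue)"
    using frac_laplacian_const_pos[OF s, of "CARD('n)"] by (auto intro: mult_left_mono)
qed

text \<open>The removed balls, the kernel and the ball of radius \<open>r\<close> are all invariant
  under the reflection, so replacing \<open>E z\<close> by \<open>E (reflect e z)\<close> inside
  \<open>ball 0 r\<close> leaves every truncated integral unchanged. This is the coupling of jumps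
  for the doubling argument.\<close>

lemma pv_limit_diff_reflect:
  fixes D :: "real ^ 'n \<Rightarrow> real"
  assumes u: "pv_limit s D l" and v: "pv_limit s E m"
    and e: "norm e = 1" 
  shows "pv_limit s (\<lambda>z. D z - (if norm z < r then E (reflect e z) else E z)) (l - m)"
proof -
  let ?c = "frac_laplacian_const CARD('n) s / 2"
  define U where "U i = (\<lambda>z. indicator (cutoff i) z * (D z * riesz_kernel s z))" for i
  define V where "V i = (\<lambda>z. indicator (cutoff i) z * (E z * riesz_kernel s z))" for i
  define W where "W i = (\<lambda>z. indicator (cutoff i) z * ((D z - (if norm z < r then E (reflect e z) else E z)) * riesz_kernel s z))" for i
  have iU: "integrable lebesgue (U i)" and iV: "integrable lebesgue (V i)" for i
    using u v by (auto simp: pv_limit_def U_def V_def)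
  have iA: "integrable lebesgue (\<lambda>z. indicator (ball 0 r) z * V i z)"
    and iB: "integrable lebesgue (\<lambda>z. indicator (- ball 0 r) z * V i z)" for i
    using integrable_mult_indicator[OF _ iV, of "ball 0 r"] integrable_mult_indicator[OF _ iV, of "- ball 0 r"]
    by simp_all
  note R = lebesgue_preserving_integral[OF lebesgue_preserving_reflect[OF e],
      of "\<lambda>z. indicator (ball 0 r) z * V i z" for i]
  have iR: "integrable lebesgue (\<lambda>z. indicator (ball 0 r) (reflect e z) * V i (reflect e z))" for i
    using R(1) iA by auto
  have W: "W i z = U i z - (indicator (ball 0 r) (reflect e z) * V i (reflect e z) + indicator (- ball 0 r) z * V i z)" for i z
    by (auto simp: W_def U_def V_def indicator_def norm_reflect[OF e] riesz_kernel_def algebra_simps)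
  have iW: "integrable lebesgue (W i)" for i
    unfolding W using iU iR iB by auto
  have "(\<integral>z. W i z \<partial>lebesgue) = (\<integral>z. U i z \<partial>lebesgue) - (\<integral>z. V i z \<partial>lebesgue)" for i
  proof -
    have "(\<integral>z. V i z \<partial>lebesgue) = (\<integral>z. indicator (ball 0 r) z * V i z + indicator (- ball 0 r) z * V i z \<partial>lebesgue)"
      by (rule Bochner_Integration.integral_cong) (auto simp: indicator_def)
    also have "\<dots> = (\<integral>z. indicator (ball 0 r) z * V i z \<partial>lebesgue) + (\<integral>z. indicator (- ball 0 r) z * V i z \<partial>lebesgue)"
      using iA iB by simp
    also have "(\<integral>z. indicator (ball 0 r) z * V i z \<partial>lebesgue)
        = (\<integral>z. indicator (ball 0 r) (reflect e z) * V i (reflect e z) \<partial>lebesgue)"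
      using R(2) iA by auto
    finally show ?thesis
      unfolding W using iU iR iB by simp
  qed
  moreover have "(\<lambda>i. ?c * (\<integral>z. U i z \<partial>lebesgue) - ?c * (\<integral>z. V i z \<partial>lebesgue)) \<longlonglongrightarrow> l - m"
    using u v by (intro tendsto_diff) (auto simp: pv_limit_def U_def V_def)
  ultimately have "(\<lambda>i. ?c * (\<integral>z. W i z \<partial>lebesgue)) \<longlonglongrightarrow> l - m"
    by (simp add: right_diff_distrib)
  with iW show ?thesis by (simp add: pv_limit_def W_def)
qed

text \<open>An absolutely integrable perturbation contributes its full integral. In use it is the
  part of the solution that is cut off far away.\<close>

lemma pv_limit_add:
  fixes D :: "real ^ 'n \<Rightarrow> real"
  assumes u: "pv_limit s D l" and G: "kernel_integrable s G"
  shows "pv_limit s (\<lambda>z. D z + G z) (l + frac_laplacian_const CARD('n) s / 2 * kernel_integral s G)"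
proof -
  let ?c = "frac_laplacian_const CARD('n) s / 2"
  define U where "U i = (\<lambda>z. indicator (cutoff i) z * (D z * riesz_kernel s z))" for i
  define H where "H i = (\<lambda>z. indicator (cutoff i) z * (G z * riesz_kernel s z))" for i
  have iU: "integrable lebesgue (U i)" for i
    using u by (auto simp: pv_limit_def U_def)
  have iH: "integrable lebesgue (H i)" for i
    using integrable_mult_indicator[OF _ G, of "cutoff i"] by (simp add: H_def)
  have V: "indicator (cutoff i) z * ((D z + G z) * riesz_kernel s z) = U i z + H i z" for i z
    by (simp add: U_def H_def algebra_simps)
  have "(\<lambda>i. ?c * (\<integral>z. U i z \<partial>lebesgue) + ?c * (\<integral>z. H i z \<partial>lebesgue)) \<longlonglongrightarrow> l + ?c * kernel_integral s G"
    using u integral_exhaust_punctured[OF G]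
    by (intro tendsto_add tendsto_mult_left) (auto simp: pv_limit_def U_def H_def)
  then show ?thesis
    unfolding pv_limit_def V using iU iH by (simp add: distrib_left)
qed

lemma pv_limit_uminus:
  assumes "pv_limit s D l"
  shows "pv_limit s (\<lambda>z. - D z) (- l)"
  using assms by (auto simp: pv_limit_def dest: tendsto_minus)

lemma pv_limit_upper:
  fixes D :: "real ^ 'n \<Rightarrow> real"
  assumes s: "0 < s" "s < 1" and u: "pv_limit s D l"
    and h: "kernel_integrable s h"
    and le: "\<And>z. z \<noteq> 0 \<Longrightarrow> D z \<le> h z"
  shows "l \<le> frac_laplacian_const CARD('n) s / 2 * kernel_integral s h"
  using pv_limit_lower[OF s pv_limit_uminus[OF u], of "\<lambda>z. - h z"] h le by simp

section \<open>Harmonicity on half-spaces\<close>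

lemma powr_bernoulli:
  fixes x s :: real
  assumes "- 1 \<le> x" "0 < s" "s < 1"
  shows "(1 + x) powr s \<le> 1 + s * x"
proof (cases "x = -1")
  case True then show ?thesis using assms by simp
next
  case False
  have "(1 + x) powr s \<le> 1 * (1 - s) + s * (1 + x)"
    using Youngs_inequality_0[of "1 - s" s 1 "1 + x"] assms False by (simp add: algebra_simps)
  then show ?thesis by (simp add: algebra_simps)
qed

text \<open>The lower bound adds the tangent inequalities at \<open>t\<close> and
  \<open>- t\<close>. The upper bound is the inequality between the means,
  \<open>?A + ?B \<ge> 2 * sqrt (?A * ?B)\<close>, because
  \<open>?A * ?B = (1 - t\<^sup>2) powr s\<close> and
  \<open>1 - t\<^sup>2 \<le> (1 - t\<^sup>2) powr (s / 2)\<close>.\<close>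

lemma second_diff_powr_bounds:
  fixes t s :: real
  assumes s: "0 < s" "s < 1" and t: "\<bar>t\<bar> \<le> 1"
  shows "0 \<le> 2 - (1 + t) powr s - (1 - t) powr s" and "2 - (1 + t) powr s - (1 - t) powr s \<le> 2 * t\<^sup>2"
proof -
  let ?A = "(1 + t) powr s" and ?B = "(1 - t) powr s"
  show "0 \<le> 2 - ?A - ?B"
  proof -
    have "?A \<le> 1 + s * t" "?B \<le> 1 - s * t" using powr_bernoulli[of t s] powr_bernoulli[of "- t" s] s t by auto
    then show ?thesis by linarith
  qed
  have t2: "0 \<le> 1 - t\<^sup>2" "1 - t\<^sup>2 \<le> 1" using t by (auto simp: abs_square_le_1)
  have "(1 - t\<^sup>2) powr 1 \<le> (1 - t\<^sup>2) powr (s / 2)"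
    using s t2 by (intro powr_mono') auto
  then have r: "1 - t\<^sup>2 \<le> (1 - t\<^sup>2) powr (s / 2)" using t2 by simp
  have "(1 - t\<^sup>2) powr s = ?A * ?B"
    using t by (subst powr_mult[symmetric]) (auto simp: algebra_simps power2_eq_square)
  moreover have "((1 - t\<^sup>2) powr (s / 2))\<^sup>2 = (1 - t\<^sup>2) powr s"
    by (simp add: power2_eq_square powr_add[symmetric])
  ultimately have "(2 * (1 - t\<^sup>2) powr (s / 2))\<^sup>2 \<le> (?A + ?B)\<^sup>2"
    using sum_squares_bound[of ?A ?B] by (simp add: power2_eq_square algebra_simps)
  then have "2 * (1 - t\<^sup>2) powr (s / 2) \<le> ?A + ?B"
    by (rule power2_le_imp_le) auto
  with r show "2 - ?A - ?B \<le> 2 * t\<^sup>2" by linarith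
qed

text \<open>The second difference of \<open>(max 0 x) powr s\<close> at the point \<open>1\<close>;
  every other point of the half-line reduces to it by homogeneity.\<close>

definition half_line_diff :: "real \<Rightarrow> real \<Rightarrow> real" where
  "half_line_diff s t = 2 - (max 0 (1 + t)) powr s - (max 0 (1 - t)) powr s"

lemma half_line_diff_minus [simp]: "half_line_diff s (- t) = half_line_diff s t"
  by (simp add: half_line_diff_def)

lemma half_line_diff_zero [simp]: "half_line_diff s 0 = 0"
  by (simp add: half_line_diff_def)

lemma half_line_diff_borel [measurable]: "half_line_diff s \<in> borel_measurable borel"
  unfolding half_line_diff_def by measurable

lemma half_line_diff_bounds:
  assumes s: "0 < s" "s < 1"
  shows "\<bar>t\<bar> \<le> 1 \<Longrightarrow> \<bar>half_line_diff s t\<bar> \<le> 2 * t\<^sup>2"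
    and "1 \<le> \<bar>t\<bar> \<Longrightarrow> \<bar>half_line_diff s t\<bar> \<le> 6 * \<bar>t\<bar> powr s"
proof -
  assume t: "\<bar>t\<bar> \<le> 1"
  then have "max 0 (1 + t) = 1 + t" "max 0 (1 - t) = 1 - t" by auto
  then show "\<bar>half_line_diff s t\<bar> \<le> 2 * t\<^sup>2"
    using second_diff_powr_bounds[OF s t] by (simp add: half_line_diff_def)
next
  assume t: "1 \<le> \<bar>t\<bar>"
  have a: "(max 0 (1 + r)) powr s \<le> 2 * \<bar>t\<bar> powr s" if "r = t \<or> r = - t" for r
  proof -
    have "(max 0 (1 + r)) powr s \<le> (2 * \<bar>t\<bar>) powr s"
      using s t that by (intro powr_mono2) auto
    also have "\<dots> = 2 powr s * \<bar>t\<bar> powr s" by (simp add: powr_mult)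
    also have "\<dots> \<le> 2 powr 1 * \<bar>t\<bar> powr s"
      using s by (intro mult_right_mono powr_mono) auto
    finally show ?thesis by simp
  qed
  have "1 \<le> \<bar>t\<bar> powr s" using s t by (intro ge_one_powr_ge_zero) auto
  moreover have "(max 0 (1 + t)) powr s \<le> 2 * \<bar>t\<bar> powr s" "(max 0 (1 - t)) powr s \<le> 2 * \<bar>t\<bar> powr s"
    using a[of t] a[of "-t"] by auto
  moreover have "0 \<le> (max 0 (1 + t)) powr s" "0 \<le> (max 0 (1 - t)) powr s" by auto
  ultimately show "\<bar>half_line_diff s t\<bar> \<le> 6 * \<bar>t\<bar> powr s"
    unfolding half_line_diff_def by linarith
qed

text \<open>In other words \<open>x\<^sub>+\<^sup>s\<close> is \<open>s\<close>-harmonic on the half-line, up to an error vanishing with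
  the cut-off \<open>a\<close>. The substitution \<open>\<tau> = t / (1 + t)\<close> turns the integral of \<open>(1 + t)\<^sup>s - 1\<close> into one
  over \<open>(0, 1)\<close>, and what remains has the explicit primitive \<open>((1 - (1 - \<tau>)\<^sup>s) / \<tau>\<^sup>s)\<^sup>2\<close>.\<close>
lemma half_line_integral_lower_finite:
  fixes a s T :: real
  assumes s: "0 < s" "s < 1" and a: "0 < a" "a \<le> 1/2" and T: "1 < T"
  shows "- (T powr (- 2 * s) / (2 * s)) - 8 * a powr (2 - 2 * s)
     \<le> integral {a..T} (\<lambda>t. half_line_diff s t * t powr (- 1 - 2 * s))"
proof -
  \<comment> \<open>\<open>P\<close> collects the jumps towards the boundary and \<open>R\<close>
    those away from it. \<open>B\<close> is \<open>R\<close> in the variable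
    \<open>t / (1 + t)\<close>, which maps \<open>[a, T]\<close> to \<open>[a', \<theta>]\<close>,
    and \<open>G\<close> is a primitive of \<open>- (2 * s) * (P t - B t)\<close> on
    \<open>(0, 1)\<close>.\<close>
  define P where "P t = (1 - (max 0 (1 - t)) powr s) * t powr (- 1 - 2 * s)" for t
  define R where "R t = ((1 + t) powr s - 1) * t powr (- 1 - 2 * s)" for t :: real
  define B where "B t = ((1 - t) powr (s - 1) - (1 - t) powr (2 * s - 1)) * t powr (- 1 - 2 * s)" for t :: real
  define G where "G t = ((1 - (1 - t) powr s) * t powr (- s))\<^sup>2" for t :: real
  define \<theta> where "\<theta> = T / (1 + T)"
  define a' where "a' = a / (1 + a)"
  have \<theta>: "1/2 < \<theta>" "\<theta> < 1" using T by (auto simp: \<theta>_def field_simps)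
  have a': "0 < a'" "a' < a" "a / 2 \<le> a'" "a - a' \<le> a\<^sup>2"
    using a by (auto simp: a'_def field_simps power2_eq_square)
  have contP: "continuous_on {x..y} P" if "0 < x" for x y
    unfolding P_def using s that by (intro continuous_intros continuous_on_powr') auto
  have contR: "continuous_on {x..y} R" if "0 < x" for x y
    unfolding R_def using s that by (intro continuous_intros continuous_on_powr') auto
  have contB: "continuous_on {x..y} B" if "0 < x" "y < 1" for x y
    unfolding B_def using s that by (intro continuous_intros continuous_on_powr') auto
  have P0: "0 \<le> P t" if "0 < t" for t
    unfolding P_def using s that by (intro mult_nonneg_nonneg) (auto intro!: powr_le1)
  have IR: "integral {a..T} R = integral {a'..\<theta>} B"
  proof -
    have "((\<lambda>t. (1 / (1 + t)\<^sup>2) *\<^sub>R B (t / (1 + t))) has_integral (integral {a / (1 + a)..T / (1 + T)} B)) {a..T}"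
    proof (rule has_integral_substitution[where c="a'" and d="\<theta>"])
      show "a \<le> T" "a / (1 + a) \<le> T / (1 + T)" using a T by (auto simp: field_simps)
      show "(\<lambda>t. t / (1 + t)) ` {a..T} \<subseteq> {a'..\<theta>}"
        using a T by (auto simp: a'_def \<theta>_def field_simps)
      show "continuous_on {a'..\<theta>} B" by (rule contB) (use a' \<theta> in auto)
      show "((\<lambda>t. t / (1 + t)) has_field_derivative 1 / (1 + t)\<^sup>2) (at t within {a..T})" if "t \<in> {a..T}" for t
        using that a by (auto intro!: derivative_eq_intros simp: power2_eq_square field_simps)
    qed
    moreover have "(1 / (1 + t)\<^sup>2) *\<^sub>R B (t / (1 + t)) = R t" if "t \<in> {a..T}" for t
    proof -
      have t: "0 < t" using that a by simp
      have e: "1 - t / (1 + t) = 1 / (1 + t)" using t by (simp add: field_simps)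
      have pw: "(1 / (1 + t)) powr q = (1 + t) powr (- q)" for q
        using t by (simp add: powr_divide powr_minus_divide)
      have f: "(t / (1 + t)) powr q = t powr q * (1 + t) powr (- q)" for q
        using t by (simp add: powr_divide powr_minus_divide)
      have "1 / (1 + t)\<^sup>2 = (1 + t) powr (- 2)"
        using t by (simp add: powr_minus_divide)
      then have "(1 / (1 + t)\<^sup>2) *\<^sub>R B (t / (1 + t)) =
        ((1 + t) powr (- 2) * (1 + t) powr (1 + 2 * s) * (1 + t) powr (1 - s)
          - (1 + t) powr (- 2) * (1 + t) powr (1 + 2 * s) * (1 + t) powr (1 - 2 * s)) * t powr (- 1 - 2 * s)"
        unfolding B_def e pw f by (simp add: algebra_simps)
      also have "(1 + t) powr (- 2) * (1 + t) powr (1 + 2 * s) * (1 + t) powr (1 - s) = (1 + t) powr s"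
        by (simp add: powr_add[symmetric])
      also have "(1 + t) powr (- 2) * (1 + t) powr (1 + 2 * s) * (1 + t) powr (1 - 2 * s) = 1"
        using t by (simp add: powr_add[symmetric])
      finally show ?thesis by (simp add: R_def)
    qed
    ultimately have "(R has_integral (integral {a'..\<theta>} B)) {a..T}"
      unfolding a'_def[symmetric] \<theta>_def[symmetric] by (subst (asm) has_integral_cong) auto
    then show ?thesis by (rule integral_unique)
  qed
  have IB: "integral {a'..\<theta>} B = integral {a'..a} B + integral {a..\<theta>} B"
    using a a' \<theta> by (intro Henstock_Kurzweil_Integration.integral_combine[symmetric] integrable_continuous_real contB) auto
  \<comment> \<open>The substitution moves the lower limit from \<open>a\<close> down to
    \<open>a'\<close>. The extra interval has length at most \<open>a\<^sup>2\<close> and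
    \<open>B\<close> is of order \<open>a powr (- 2 * s)\<close> there, so the cost vanishes with
    \<open>a\<close>.\<close>
  have Bsmall: "integral {a'..a} B \<le> 8 * a powr (2 - 2 * s)"
  proof -
    have "B t \<le> 2 * (a / 2) powr (- 2 * s)" if "t \<in> {a'..a}" for t
    proof -
      have t: "0 < t" "t \<le> 1/2" "a / 2 \<le> t" using that a a' by auto
      have "B t = (1 - t) powr (s - 1) * (1 - (1 - t) powr s) * t powr (- 1 - 2 * s)"
        unfolding B_def by (simp add: algebra_simps powr_add[symmetric])
      also have "\<dots> \<le> 2 * t * t powr (- 1 - 2 * s)"
      proof (intro mult_right_mono mult_mono)
        have "(1 - t) powr (s - 1) \<le> (1/2) powr (s - 1)"
          using t s by (intro powr_mono2') auto
        also have "\<dots> \<le> (1/2) powr (- 1)"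
          using s by (intro powr_mono') auto
        finally show "(1 - t) powr (s - 1) \<le> 2" by simp
        have "(1 - t) powr 1 \<le> (1 - t) powr s" using s t by (intro powr_mono') auto
        then show "1 - (1 - t) powr s \<le> t" using t by simp
        show "0 \<le> 1 - (1 - t) powr s" using t s by (auto intro!: powr_le1)
      qed auto
      also have "\<dots> = 2 * t powr (- 2 * s)"
        using t powr_add[of t 1 "- 1 - 2 * s"] by simp
      also have "t powr (- 2 * s) \<le> (a / 2) powr (- 2 * s)"
        using t a s by (intro powr_mono2') auto
      finally show ?thesis by simp
    qed
    then have "integral {a'..a} B \<le> integral {a'..a} (\<lambda>_. 2 * (a / 2) powr (- 2 * s))"
      using a a' by (intro integral_le integrable_continuous_real contB) auto
    also have "\<dots> = (a - a') * (2 * (a / 2) powr (- 2 * s))"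
      using a' by simp
    also have "\<dots> \<le> a\<^sup>2 * (2 * (a / 2) powr (- 2 * s))"
      using a' by (intro mult_right_mono) auto
    also have "(a / 2) powr (- 2 * s) = a powr (- 2 * s) * 2 powr (2 * s)"
      using a by (simp add: powr_divide powr_minus_divide)
    also have "a\<^sup>2 = a powr 2" using a by simp
    also have "a powr 2 * (2 * (a powr (- 2 * s) * 2 powr (2 * s))) = 2 * 2 powr (2 * s) * a powr (2 - 2 * s)"
      by (simp add: powr_add[symmetric] algebra_simps)
    also have "\<dots> \<le> 2 * 2 powr 2 * a powr (2 - 2 * s)"
      using s by (intro mult_right_mono mult_left_mono powr_mono) auto
    finally show ?thesis by simp
  qed
  \<comment> \<open>The primitive turns \<open>- (2 * s)\<close> times this difference into
    \<open>G \<theta> - G a\<close>, which is at most \<open>1\<close>.\<close>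
  have IPB: "integral {a..\<theta>} P - integral {a..\<theta>} B \<ge> - 1 / (2 * s)"
  proof -
    have "((\<lambda>t. - (2 * s) * (P t - B t)) has_integral (G \<theta> - G a)) {a..\<theta>}"
    proof (rule fundamental_theorem_of_calculus)
      show "a \<le> \<theta>" using a \<theta> by simp
      fix t assume "t \<in> {a..\<theta>}"
      then have t: "0 < t" "t < 1" using a \<theta> by auto
      let ?q = "(1 - t) powr s" and ?x = "t powr (- s)"
      have d: "(G has_real_derivative 2 * ((1 - ?q) * ?x) * ((s * (1 - t) powr (s - 1)) * ?x + (1 - ?q) * (- s * t powr (- s - 1)))) (at t)"
        unfolding G_def using t by (auto intro!: derivative_eq_intros simp: algebra_simps)
      have x1: "?x * ?x = t * t powr (- 1 - 2 * s)"
        using t powr_add[of t 1 "- 1 - 2 * s"] by (simp add: powr_add[symmetric])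
      have x2: "?x * t powr (- s - 1) = t powr (- 1 - 2 * s)"
        unfolding powr_add[symmetric] by (rule arg_cong[where f="\<lambda>q. t powr q"]) simp
      have q1: "?q = (1 - t) * (1 - t) powr (s - 1)"
        using t powr_add[of "1 - t" 1 "s - 1"] by simp
      have q2: "(1 - t) powr (2 * s - 1) = ?q * (1 - t) powr (s - 1)"
        unfolding powr_add[symmetric] by (rule arg_cong[where f="\<lambda>q. (1 - t) powr q"]) simp
      have "2 * ((1 - ?q) * ?x) * ((s * (1 - t) powr (s - 1)) * ?x + (1 - ?q) * (- s * t powr (- s - 1)))
         = 2 * s * (1 - ?q) * ((1 - t) powr (s - 1) * (?x * ?x) - (1 - ?q) * (?x * t powr (- s - 1)))"
        by (simp add: algebra_simps)
      also have "\<dots> = 2 * s * (1 - ?q) * t powr (- 1 - 2 * s) * (t * (1 - t) powr (s - 1) - 1 + ?q)"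
        unfolding x1 x2 by (simp add: algebra_simps)
      also have "t * (1 - t) powr (s - 1) - 1 + ?q = (1 - t) powr (s - 1) - 1"
        unfolding q1 by (simp add: left_diff_distrib)
      also have "2 * s * (1 - ?q) * t powr (- 1 - 2 * s) * ((1 - t) powr (s - 1) - 1) = - (2 * s) * (P t - B t)"
      proof -
        have "max 0 (1 - t) = 1 - t" using t by simp
        moreover have "2 * s * (1 - q) * X * (r - 1) = - (2 * s) * ((1 - q) * X - (r - q * r) * X)" for q X r
          by (simp add: algebra_simps)
        ultimately show ?thesis unfolding P_def B_def q2 by (simp only:)
      qed
      finally have eqd: "2 * ((1 - ?q) * ?x) * ((s * (1 - t) powr (s - 1)) * ?x + (1 - ?q) * (- s * t powr (- s - 1)))
          = - (2 * s) * (P t - B t)" .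
      show "(G has_vector_derivative - (2 * s) * (P t - B t)) (at t within {a..\<theta>})"
        using d unfolding eqd has_real_derivative_iff_has_vector_derivative
        by (rule has_vector_derivative_at_within)
    qed
    then have e: "integral {a..\<theta>} (\<lambda>t. - (2 * s) * (P t - B t)) = G \<theta> - G a"
      by (rule integral_unique)
    have "integral {a..\<theta>} (\<lambda>t. - (2 * s) * (P t - B t)) = - (2 * s) * (integral {a..\<theta>} P - integral {a..\<theta>} B)"
      using a \<theta> by (subst integral_mult_right, subst integral_diff) (auto intro!: integrable_continuous_real contP contB)
    moreover have "G \<theta> \<le> 1"
    proof -
      have "\<theta> powr s \<le> 1" "(1 - \<theta>) powr s \<le> 1" using \<theta> s by (auto intro!: powr_le1)
      have "1 - (1 - \<theta>) powr s \<le> \<theta> powr s"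
      proof -
        have "\<theta> powr 1 \<le> \<theta> powr s" "(1 - \<theta>) powr 1 \<le> (1 - \<theta>) powr s"
          using \<theta> s powr_mono'[of s 1 \<theta>] powr_mono'[of s 1 "1 - \<theta>"] by auto
        then show ?thesis using \<theta> by simp
      qed
      then have "(1 - (1 - \<theta>) powr s) * \<theta> powr (- s) \<le> \<theta> powr s * \<theta> powr (- s)"
        by (intro mult_right_mono) auto
      also have "\<dots> = 1" using \<theta> by (simp add: powr_add[symmetric])
      finally show ?thesis
        unfolding G_def using \<open>(1 - \<theta>) powr s \<le> 1\<close> by (auto intro!: power_le_one mult_nonneg_nonneg)
    qed
    moreover have "0 \<le> G a" by (simp add: G_def)
    ultimately have "- 1 \<le> (2 * s) * (integral {a..\<theta>} P - integral {a..\<theta>} B)"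
      using e by linarith
    then show ?thesis using s by (simp add: field_simps)
  qed
  \<comment> \<open>Beyond \<open>1\<close> only \<open>t powr (- 1 - 2 * s)\<close> is left of
    \<open>P\<close>; as \<open>T\<close> grows its integral tends to \<open>1 / (2 * s)\<close>,
    which cancels exactly the loss allowed by \<open>IPB\<close>.\<close>
  have IP: "integral {a..T} P \<ge> integral {a..\<theta>} P + (1 - T powr (- 2 * s)) / (2 * s)"
  proof -
    have "integral {a..T} P = integral {a..\<theta>} P + integral {\<theta>..T} P"
      using a \<theta> T by (intro Henstock_Kurzweil_Integration.integral_combine[symmetric] integrable_continuous_real contP) auto
    also have "integral {\<theta>..T} P = integral {\<theta>..1} P + integral {1..T} P"
      using a \<theta> T by (intro Henstock_Kurzweil_Integration.integral_combine[symmetric] integrable_continuous_real contP) auto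
    also have "integral {1..T} P = (1 - T powr (- 2 * s)) / (2 * s)"
    proof -
      have "((\<lambda>t. t powr (- 1 - 2 * s)) has_integral (- (T powr (- 2 * s)) / (2 * s) - (- (1 powr (- 2 * s)) / (2 * s)))) {1..T}"
      proof (rule fundamental_theorem_of_calculus)
        fix t assume "t \<in> {1..T}"
        then show "((\<lambda>t. - (t powr (- 2 * s)) / (2 * s)) has_vector_derivative t powr (- 1 - 2 * s)) (at t within {1..T})"
          unfolding has_real_derivative_iff_has_vector_derivative[symmetric] minus_diff_commute[of 1 "2 * s"]
          using s by (auto intro!: derivative_eq_intros simp: algebra_simps)
      qed (use T in auto)
      then have "(P has_integral (- (T powr (- 2 * s)) / (2 * s) - (- (1 powr (- 2 * s)) / (2 * s)))) {1..T}"
        by (rule has_integral_eq[rotated]) (auto simp: P_def max_def)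
      then show ?thesis by (auto dest!: integral_unique simp: diff_divide_distrib)
    qed
    finally have "integral {a..T} P = integral {a..\<theta>} P + (integral {\<theta>..1} P + (1 - T powr (- 2 * s)) / (2 * s))" .
    moreover have "0 \<le> integral {\<theta>..1} P"
      using \<theta> by (intro Henstock_Kurzweil_Integration.integral_nonneg integrable_continuous_real contP P0) auto
    ultimately show ?thesis by linarith
  qed
  have "integral {a..T} (\<lambda>t. half_line_diff s t * t powr (- 1 - 2 * s)) = integral {a..T} (\<lambda>t. P t - R t)"
    by (rule Henstock_Kurzweil_Integration.integral_cong)
      (use a in \<open>auto simp: half_line_diff_def P_def R_def algebra_simps max_def\<close>)
  also have "\<dots> = integral {a..T} P - integral {a..T} R"
    by (rule Henstock_Kurzweil_Integration.integral_diff) (use a in \<open>auto intro!: integrable_continuous_real contP contR\<close>)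
  finally show ?thesis
    using IP IPB Bsmall IR IB by (simp add: diff_divide_distrib)
qed

section \<open>The kernel seen along one direction\<close>

lemma nn_integral_riesz_kernel_half_space:
  fixes w :: "real ^ 'n"
  assumes s: "0 < s" and y: "0 < y"
  shows "(\<integral>\<^sup>+z. ennreal (riesz_kernel s z) * indicator {z. y < z \<bullet> w} z \<partial>lborel)
     = ennreal (y powr (- 2 * s)) * (\<integral>\<^sup>+z. ennreal (riesz_kernel s z) * indicator {z. 1 < z \<bullet> w} z \<partial>lborel)"
proof -
  have k: "riesz_kernel s (y *\<^sub>R z) = y powr (- real CARD('n) - 2 * s) * riesz_kernel s z" for z :: "real ^ 'n"
    using y by (simp add: riesz_kernel_def powr_mult)
  have "(\<integral>\<^sup>+z. ennreal (riesz_kernel s z) * indicator {z. y < z \<bullet> w} z \<partial>lborel)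
     = ennreal (y ^ DIM(real ^ 'n)) * (\<integral>\<^sup>+z. ennreal (riesz_kernel s (y *\<^sub>R z)) * indicator {z. y < z \<bullet> w} (y *\<^sub>R z) \<partial>lborel)"
    by (rule nn_integral_lborel_scale) (use y in auto)
  also have "(\<integral>\<^sup>+z. ennreal (riesz_kernel s (y *\<^sub>R z)) * indicator {z. y < z \<bullet> w} (y *\<^sub>R z) \<partial>lborel)
    = (\<integral>\<^sup>+z. ennreal (y powr (- real CARD('n) - 2 * s)) * (ennreal (riesz_kernel s z) * indicator {z. 1 < z \<bullet> w} z) \<partial>lborel)"
    using y by (intro nn_integral_cong) (auto simp: k indicator_def ennreal_mult)
  also have "\<dots> = ennreal (y powr (- real CARD('n) - 2 * s)) * (\<integral>\<^sup>+z. ennreal (riesz_kernel s z) * indicator {z. 1 < z \<bullet> w} z \<partial>lborel)"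
    by (rule nn_integral_cmult) measurable
  also have "ennreal (y ^ DIM(real ^ 'n)) * (ennreal (y powr (- real CARD('n) - 2 * s)) * (\<integral>\<^sup>+z. ennreal (riesz_kernel s z) * indicator {z. 1 < z \<bullet> w} z \<partial>lborel))
    = ennreal (y powr (- 2 * s)) * (\<integral>\<^sup>+z. ennreal (riesz_kernel s z) * indicator {z. 1 < z \<bullet> w} z \<partial>lborel)"
  proof -
    have "y ^ DIM(real ^ 'n) * y powr (- real CARD('n) - 2 * s) = y powr (real CARD('n)) * y powr (- real CARD('n) - 2 * s)"
      using y by (simp add: powr_realpow)
    also have "\<dots> = y powr (- 2 * s)" unfolding powr_add[symmetric] by simp
    finally have "ennreal (y ^ DIM(real ^ 'n)) * ennreal (y powr (- real CARD('n) - 2 * s)) = ennreal (y powr (- 2 * s))"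
      using y by (subst ennreal_mult[symmetric]) auto
    then show ?thesis by (simp only: mult.assoc[symmetric])
  qed
  finally show ?thesis .
qed

lemma nn_integral_riesz_kernel_half_space_finite:
  fixes w :: "real ^ 'n"
  assumes s: "0 < s"
  shows "(\<integral>\<^sup>+z. ennreal (riesz_kernel s z) * indicator {z. 1 < z \<bullet> w} z \<partial>lborel) < \<infinity>"
proof (cases "w = 0")
  case False
  define r where "r = 1 / norm w"
  have r: "0 < r" using False by (simp add: r_def)
  have "integrable lebesgue (\<lambda>z::real^'n. indicator (- ball 0 r) z * norm z powr (- (real CARD('n) + 2 * s)))"
    by (rule integrable_norm_powr_compl_ball) (use s r in auto)
  then have "integrable lborel (\<lambda>z::real^'n. indicator (- ball 0 r) z * norm z powr (- (real CARD('n) + 2 * s)))"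
    by (subst (asm) integrable_completion) auto
  then have fin: "(\<integral>\<^sup>+z. ennreal (norm (indicator (- ball 0 r) (z::real^'n) * norm z powr (- (real CARD('n) + 2 * s)))) \<partial>lborel) < \<infinity>"
    by (simp add: integrable_iff_bounded)
  have "(\<integral>\<^sup>+z. ennreal (riesz_kernel s z) * indicator {z. 1 < z \<bullet> w} z \<partial>lborel)
    \<le> (\<integral>\<^sup>+z. ennreal (norm (indicator (- ball 0 r) (z::real^'n) * norm z powr (- (real CARD('n) + 2 * s)))) \<partial>lborel)"
  proof (rule nn_integral_mono)
    fix z :: "real ^ 'n"
    have "r \<le> norm z" if "1 < z \<bullet> w"
    proof -
      have "1 < norm z * norm w" using that norm_cauchy_schwarz[of z w] by linarith
      then show ?thesis using False by (simp add: r_def field_simps)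
    qed
    then show "ennreal (riesz_kernel s z) * indicator {z. 1 < z \<bullet> w} z
      \<le> ennreal (norm (indicator (- ball 0 r) z * norm z powr (- (real CARD('n) + 2 * s))))"
      by (auto simp: indicator_def riesz_kernel_def)
  qed
  also note fin
  finally show ?thesis .
qed simp

text \<open>By homogeneity the kernel mass of \<open>{z. y < z \<bullet> w}\<close> is a multiple of
  \<open>y powr (- 2 * s)\<close>, and a measure on the line with finite values on the half-lines
  \<open>{x<..}\<close> is determined by them. So the push-forward has density
  \<open>c * t powr (- 1 - 2 * s)\<close>, without any integration over hyperplanes. For
  \<open>w = 0\<close> the constant is \<open>0\<close>, which accounts for the alternative
  \<open>c = 0\<close>.\<close>

lemma riesz_kernel_pushforward:
  fixes w :: "real ^ 'n"
  assumes s: "0 < s"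
  obtains c where "0 \<le> c"
    and "\<And>a \<phi>. 0 < a \<Longrightarrow> \<phi> \<in> borel_measurable borel \<Longrightarrow>
      integrable lborel (\<lambda>z. indicator {z. a < z \<bullet> w} z * (\<phi> (z \<bullet> w) * riesz_kernel s z)) \<Longrightarrow>
      integrable lborel (\<lambda>t. indicator {a<..} t * (\<phi> t * t powr (- 1 - 2 * s))) \<or> c = 0"
    and "\<And>a \<phi>. 0 < a \<Longrightarrow> \<phi> \<in> borel_measurable borel \<Longrightarrow>
      (\<integral>z. indicator {z. a < z \<bullet> w} z * (\<phi> (z \<bullet> w) * riesz_kernel s z) \<partial>lborel)
      = c * (\<integral>t. indicator {a<..} t * (\<phi> t * t powr (- 1 - 2 * s)) \<partial>lborel)"
proof -
  define \<Phi> where "\<Phi> = (\<integral>\<^sup>+z. ennreal (riesz_kernel s z) * indicator {z. 1 < z \<bullet> w} z \<partial>lborel)"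
  \<comment> \<open>The density integrates over \<open>t > y\<close> to
    \<open>c / (2 * s) * y powr (- 2 * s)\<close>; this choice matches the mass
    \<open>\<Phi>\<close> at \<open>y = 1\<close>.\<close>
  define c where "c = 2 * s * enn2real \<Phi>"
  have c: "0 \<le> c" using s by (simp add: c_def)
  have \<Phi>: "ennreal (c / (2 * s)) = \<Phi>"
    using nn_integral_riesz_kernel_half_space_finite[OF s, of w] s by (simp add: c_def \<Phi>_def)
  define A where "A a = distr (density lborel (\<lambda>z. ennreal (riesz_kernel s z) * indicator {z. a < z \<bullet> w} z)) borel (\<lambda>z. z \<bullet> w)" for a :: real
  define B where "B a = density lborel (\<lambda>t. ennreal (c * t powr (- 1 - 2 * s)) * indicator {a<..} t)" for a :: real
  have AB: "A a = B a" if a: "0 < a" for a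
  proof (rule measure_eqI_lessThan)
    show "sets (A a) = sets borel" "sets (B a) = sets borel" by (auto simp: A_def B_def)
    fix x :: real
    define y where "y = max a x"
    have y: "0 < y" using a by (simp add: y_def)
    have [measurable]: "(\<lambda>z. z \<bullet> w) -` {x<..} \<in> sets borel"
      using measurable_sets_borel[of "\<lambda>z. z \<bullet> w" borel "{x<..}"] by simp
    have "emeasure (A a) {x<..} = (\<integral>\<^sup>+z. ennreal (riesz_kernel s z) * indicator {z. a < z \<bullet> w} z * indicator ((\<lambda>z. z \<bullet> w) -` {x<..} \<inter> space lborel) z \<partial>lborel)"
      unfolding A_def by (subst emeasure_distr, simp, simp, subst emeasure_density) auto
    also have "\<dots> = (\<integral>\<^sup>+z. ennreal (riesz_kernel s z) * indicator {z. y < z \<bullet> w} z \<partial>lborel)"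
      by (intro nn_integral_cong) (auto simp: indicator_def y_def)
    also have "\<dots> = ennreal (y powr (- 2 * s)) * \<Phi>"
      unfolding \<Phi>_def by (rule nn_integral_riesz_kernel_half_space[OF s y])
    also have "\<dots> = ennreal (y powr (- 2 * s)) * ennreal (c / (2 * s))" by (simp add: \<Phi>)
    also have "\<dots> = ennreal (c / (2 * s) * y powr (- 2 * s))"
      using c s by (subst ennreal_mult[symmetric]) (auto simp: mult.commute)
    finally have EA: "emeasure (A a) {x<..} = ennreal (c / (2 * s) * y powr (- 2 * s))" .
    show "emeasure (A a) {x<..} < \<infinity>" unfolding EA by simp
    have "emeasure (B a) {x<..} = (\<integral>\<^sup>+t. ennreal (c * t powr (- 1 - 2 * s)) * indicator {a<..} t * indicator {x<..} t \<partial>lborel)"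
      unfolding B_def by (subst emeasure_density) auto
    also have "\<dots> = (\<integral>\<^sup>+t. ennreal (c * t powr (- 1 - 2 * s)) * indicator {y..} t \<partial>lborel)"
    proof (rule nn_integral_cong_AE)
      have "AE t in lborel. t \<noteq> y" by (rule AE_lborel_singleton)
      then show "AE t in lborel. ennreal (c * t powr (- 1 - 2 * s)) * indicator {a<..} t * indicator {x<..} t
        = ennreal (c * t powr (- 1 - 2 * s)) * indicator {y..} t"
        by eventually_elim (auto simp: indicator_def y_def)
    qed
    also have "\<dots> = ennreal (0 - (- (c / (2 * s)) * y powr (- 2 * s)))"
    proof (rule nn_integral_FTC_atLeast)
      fix t assume "y \<le> t"
      then have t: "0 < t" using y by simp
      show "((\<lambda>t. - (c / (2 * s)) * t powr (- 2 * s)) has_real_derivative c * t powr (- 1 - 2 * s)) (at t)"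
        unfolding minus_diff_commute[of 1 "2 * s"] using t s by (auto intro!: derivative_eq_intros simp: algebra_simps)
      show "0 \<le> c * t powr (- 1 - 2 * s)" using c by simp
    next
      have "((\<lambda>t::real. t powr (- 2 * s)) \<longlongrightarrow> 0) at_top"
        using s by (intro tendsto_neg_powr filterlim_ident) auto
      then show "((\<lambda>t. - (c / (2 * s)) * t powr (- 2 * s)) \<longlongrightarrow> 0) at_top"
        by (rule tendsto_mult_right_zero)
    qed measurable
    finally show "emeasure (A a) {x<..} = emeasure (B a) {x<..}" unfolding EA by simp
  qed
  show ?thesis
  proof
    show "0 \<le> c" by (rule c)
    fix a :: real and \<phi> :: "real \<Rightarrow> real"
    assume a: "0 < a" and [measurable]: "\<phi> \<in> borel_measurable borel"
    have dA: "density lborel (\<lambda>z. ennreal (riesz_kernel s z) * indicator {z. a < z \<bullet> w} z)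
       = density lborel (\<lambda>z. ennreal (indicator {z. a < z \<bullet> w} z * riesz_kernel s z))"
      by (rule arg_cong[where f="density lborel"]) (auto simp: indicator_def)
    have dB: "density lborel (\<lambda>t. ennreal (c * t powr (- 1 - 2 * s)) * indicator {a<..} t)
       = density lborel (\<lambda>t. ennreal (indicator {a<..} t * (c * t powr (- 1 - 2 * s))))"
      by (rule arg_cong[where f="density lborel"]) (auto simp: indicator_def)
    have A1: "integrable (A a) \<phi> \<longleftrightarrow> integrable lborel (\<lambda>z. indicator {z. a < z \<bullet> w} z * (\<phi> (z \<bullet> w) * riesz_kernel s z))"
      unfolding A_def dA by (subst integrable_distr_eq, simp, simp, subst integrable_density)
        (auto simp: algebra_simps)
    have B1: "integrable (B a) \<phi> \<longleftrightarrow> integrable lborel (\<lambda>t. c * (indicator {a<..} t * (\<phi> t * t powr (- 1 - 2 * s))))"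
      unfolding B_def dB using c by (subst integrable_density) (auto simp: algebra_simps)
    have A2: "(\<integral>t. \<phi> t \<partial>A a) = (\<integral>z. indicator {z. a < z \<bullet> w} z * (\<phi> (z \<bullet> w) * riesz_kernel s z) \<partial>lborel)"
      unfolding A_def dA by (subst integral_distr, simp, simp, subst integral_density)
        (auto simp: algebra_simps)
    have B2: "(\<integral>t. \<phi> t \<partial>B a) = (\<integral>t. c * (indicator {a<..} t * (\<phi> t * t powr (- 1 - 2 * s))) \<partial>lborel)"
      unfolding B_def dB using c by (subst integral_density) (auto simp: algebra_simps)
    show "integrable lborel (\<lambda>t. indicator {a<..} t * (\<phi> t * t powr (- 1 - 2 * s))) \<or> c = 0"
      if "integrable lborel (\<lambda>z. indicator {z. a < z \<bullet> w} z * (\<phi> (z \<bullet> w) * riesz_kernel s z))"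
      using that A1 B1 AB[OF a] by auto
    show "(\<integral>z. indicator {z. a < z \<bullet> w} z * (\<phi> (z \<bullet> w) * riesz_kernel s z) \<partial>lborel)
      = c * (\<integral>t. indicator {a<..} t * (\<phi> t * t powr (- 1 - 2 * s)) \<partial>lborel)"
      using A2 B2 AB[OF a] by simp
  qed
qed

section \<open>Integrability against the kernel\<close>

lemma norm_powr_mult_riesz_kernel:
  "norm z powr p * riesz_kernel s z = norm z powr (p - real CARD('n) - 2 * s)" for z :: "real ^ 'n"
  by (simp add: riesz_kernel_def powr_add[symmetric] algebra_simps)

lemma integrable_riesz_kernel_ball:
  assumes p: "2 * s < p" and r: "0 < r"
  shows "integrable lebesgue (\<lambda>z::real^'n. (indicator (ball 0 r) z * norm z powr p) * riesz_kernel s z)"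
    and "(\<integral>z. (indicator (ball 0 r) (z::real^'n) * norm z powr p) * riesz_kernel s z \<partial>lebesgue)
      = r powr (p - 2 * s) * (\<integral>z. (indicator (ball 0 1) (z::real^'n) * norm z powr p) * riesz_kernel s z \<partial>lebesgue)"
  using integrable_norm_powr_ball[where 'a="real^'n", of "p - real CARD('n) - 2 * s" r] p r
  by (simp_all add: mult.assoc norm_powr_mult_riesz_kernel)

lemma integrable_riesz_kernel_compl_ball:
  assumes p: "p < 2 * s" and r: "0 < r"
  shows "integrable lebesgue (\<lambda>z::real^'n. (indicator (- ball 0 r) z * norm z powr p) * riesz_kernel s z)"
    and "(\<integral>z. (indicator (- ball 0 r) (z::real^'n) * norm z powr p) * riesz_kernel s z \<partial>lebesgue)
      = r powr (p - 2 * s) * (\<integral>z. (indicator (- ball 0 1) (z::real^'n) * norm z powr p) * riesz_kernel s z \<partial>lebesgue)"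
  using integrable_norm_powr_compl_ball[where 'a="real^'n", of "p - real CARD('n) - 2 * s" r] p r
  by (simp_all add: mult.assoc norm_powr_mult_riesz_kernel)

text \<open>Powers above \<open>2 * s\<close> are integrable against the kernel near the origin,
  powers below \<open>2 * s\<close> at infinity.\<close>

lemma integrable_riesz_kernelI:
  fixes H :: "real ^ 'n \<Rightarrow> real"
  assumes r: "0 < r" and p: "2 * s < p" and q: "q < 2 * s"
    and [measurable]: "H \<in> borel_measurable lebesgue"
    and small: "\<And>z. z \<noteq> 0 \<Longrightarrow> norm z < r \<Longrightarrow> \<bar>H z\<bar> \<le> A * norm z powr p"
    and large: "\<And>z. r \<le> norm z \<Longrightarrow> \<bar>H z\<bar> \<le> B * norm z powr q"
  shows "kernel_integrable s H"
proof (rule Bochner_Integration.integrable_bound)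
  show "integrable lebesgue (\<lambda>z::real^'n. A * ((indicator (ball 0 r) z * norm z powr p) * riesz_kernel s z)
      + B * ((indicator (- ball 0 r) z * norm z powr q) * riesz_kernel s z))"
    using integrable_riesz_kernel_ball(1)[OF p r] integrable_riesz_kernel_compl_ball(1)[OF q r]
    by (intro Bochner_Integration.integrable_add integrable_mult_right) auto
  show "(\<lambda>z. H z * riesz_kernel s z) \<in> borel_measurable lebesgue" by measurable
  have "norm (H z * riesz_kernel s z) \<le> norm (A * ((indicator (ball 0 r) z * norm z powr p) * riesz_kernel s z)
      + B * ((indicator (- ball 0 r) z * norm z powr q) * riesz_kernel s z))" for z
  proof (cases "z = 0")
    case False
    have "\<bar>H z\<bar> * riesz_kernel s z \<le> (if norm z < r then A * norm z powr p else B * norm z powr q) * riesz_kernel s z"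
      using small[OF False] large[of z] by (intro mult_right_mono) auto
    also have "\<dots> = A * ((indicator (ball 0 r) z * norm z powr p) * riesz_kernel s z)
      + B * ((indicator (- ball 0 r) z * norm z powr q) * riesz_kernel s z)"
      by (auto simp: indicator_def)
    also have "\<dots> \<le> \<bar>\<dots>\<bar>" by (rule abs_ge_self)
    finally show ?thesis by (simp add: abs_mult)
  qed simp
  then show "AE z in lebesgue. norm (H z * riesz_kernel s z) \<le> norm (A * ((indicator (ball 0 r) z * norm z powr p) * riesz_kernel s z)
      + B * ((indicator (- ball 0 r) z * norm z powr q) * riesz_kernel s z))" by simp
qed

lemma half_space_diff_integrable:
  fixes w :: "real ^ 'n"
  assumes s: "0 < s" "s < 1"
  shows "integrable lebesgue (\<lambda>z. half_line_diff s (z \<bullet> w) * riesz_kernel s z)"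
proof (cases "w = 0")
  case False
  \<comment> \<open>Inside this radius \<open>\<bar>z \<bullet> w\<bar> \<le> 1\<close>, so the
    quadratic bound for \<open>half_line_diff\<close> applies.\<close>
  define r where "r = 1 / norm w"
  have r: "0 < r" using False by (simp add: r_def)
  show ?thesis
  proof (rule integrable_riesz_kernelI[OF r, where p=2 and q=s and A="2 * (norm w)\<^sup>2" and B="6 * norm w powr s"])
    have "(\<lambda>z::real^'n. half_line_diff s (z \<bullet> w)) \<in> borel_measurable lborel" by simp
    then show "(\<lambda>z::real^'n. half_line_diff s (z \<bullet> w)) \<in> borel_measurable lebesgue"
      by (rule measurable_completion)
    fix z :: "real ^ 'n"
    have cs: "\<bar>z \<bullet> w\<bar> \<le> norm z * norm w" by (rule Cauchy_Schwarz_ineq2)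
    show "\<bar>half_line_diff s (z \<bullet> w)\<bar> \<le> 2 * (norm w)\<^sup>2 * norm z powr 2" if "norm z < r" "z \<noteq> 0"
    proof -
      have "norm z * norm w \<le> 1" using that False by (simp add: r_def field_simps)
      then have "\<bar>half_line_diff s (z \<bullet> w)\<bar> \<le> 2 * (z \<bullet> w)\<^sup>2"
        using half_line_diff_bounds(1)[OF s] cs by simp
      also have "(z \<bullet> w)\<^sup>2 \<le> (norm z * norm w)\<^sup>2"
        using cs by (metis abs_ge_zero power2_abs power_mono)
      finally show ?thesis using that by (simp add: power_mult_distrib mult_ac)
    qed
    show "\<bar>half_line_diff s (z \<bullet> w)\<bar> \<le> 6 * norm w powr s * norm z powr s" if "r \<le> norm z"
    proof -
      have nz: "1 \<le> norm z * norm w" using that False by (simp add: r_def field_simps)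
      then have e: "1 \<le> (norm z * norm w) powr s" using s by (intro ge_one_powr_ge_zero) auto
      have "\<bar>half_line_diff s (z \<bullet> w)\<bar> \<le> 6 * (norm z * norm w) powr s"
      proof (cases "\<bar>z \<bullet> w\<bar> \<le> 1")
        case True
        then have "(z \<bullet> w)\<^sup>2 \<le> 1" by (simp add: abs_square_le_1)
        then show ?thesis using half_line_diff_bounds(1)[OF s True] e by linarith
      next
        case False
        then have "\<bar>half_line_diff s (z \<bullet> w)\<bar> \<le> 6 * \<bar>z \<bullet> w\<bar> powr s"
          using half_line_diff_bounds(2)[OF s] by simp
        also have "\<bar>z \<bullet> w\<bar> powr s \<le> (norm z * norm w) powr s"
          using cs s by (intro powr_mono2) auto
        finally show ?thesis by simp
      qed
      then show ?thesis by (simp add: powr_mult mult_ac)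
    qed
  qed (use s in auto)
qed simp

lemma half_line_integral_lower:
  fixes a s :: real
  assumes s: "0 < s" "s < 1" and a: "0 < a" "a \<le> 1/2"
    and int: "integrable lborel (\<lambda>t. indicator {a<..} t * (half_line_diff s t * t powr (- 1 - 2 * s)))"
  shows "- 8 * a powr (2 - 2 * s)
     \<le> (\<integral>t. indicator {a<..} t * (half_line_diff s t * t powr (- 1 - 2 * s)) \<partial>lborel)"
proof -
  define f where "f = (\<lambda>t. indicator {a<..} t * (half_line_diff s t * t powr (- 1 - 2 * s)))"
  have intf: "integrable lborel f" using int by (simp add: f_def)
  have lim: "((\<lambda>T. \<integral>t. indicator {..T} t *\<^sub>R f t \<partial>lborel) \<longlongrightarrow> (\<integral>t. f t \<partial>lborel)) at_top"
    by (rule tendsto_integral_at_top) (use intf in auto)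
  have lim2: "((\<lambda>T. - (T powr (- 2 * s) / (2 * s)) - 8 * a powr (2 - 2 * s)) \<longlongrightarrow> - (0 / (2 * s)) - 8 * a powr (2 - 2 * s)) at_top"
    using s by (intro tendsto_intros tendsto_neg_powr filterlim_ident) auto
  have ev: "eventually (\<lambda>T. - (T powr (- 2 * s) / (2 * s)) - 8 * a powr (2 - 2 * s) \<le> (\<integral>t. indicator {..T} t *\<^sub>R f t \<partial>lborel)) at_top"
    using eventually_gt_at_top[of 1]
  proof eventually_elim
    case (elim T)
    define h where "h t = half_line_diff s t * t powr (- 1 - 2 * s)" for t
    have [measurable]: "h \<in> borel_measurable borel" unfolding h_def by measurable
    have ch: "continuous_on {a..T} h"
      unfolding h_def half_line_diff_def using s a by (intro continuous_intros continuous_on_powr') auto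
    have "set_integrable lborel {a..T} h"
      by (rule borel_integrable_compact[OF compact_Icc ch, folded set_integrable_def, simplified])
    then have "(LINT t:{a..T}|lborel. h t) = integral {a..T} h"
      by (rule set_borel_integral_eq_integral)
    moreover have "(LINT t:{a..T}|lborel. h t) = (\<integral>t. indicator {..T} t *\<^sub>R f t \<partial>lborel)"
      unfolding set_lebesgue_integral_def
    proof (rule integral_cong_AE)
      have "AE t in lborel. t \<noteq> a" by (rule AE_lborel_singleton)
      then show "AE t in lborel. indicator {a..T} t *\<^sub>R h t = indicator {..T} t *\<^sub>R f t"
        by eventually_elim (auto simp: f_def h_def indicator_def)
    qed (auto simp: f_def)
    ultimately show ?case
      using half_line_integral_lower_finite[OF s a elim] by (simp add: h_def[abs_def])
  qed
  show ?thesis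
    using tendsto_le[OF _ lim lim2 ev] by (simp add: f_def)
qed

text \<open>Evenness reduces the integral to the half-space \<open>0 < z \<bullet> w\<close>, the
  push-forward reduces it further to the half-line, and the error \<open>a powr (2 - 2 * s)\<close>
  vanishes with the cut-off \<open>a\<close>. The hyperplane in between contributes nothing because
  \<open>half_line_diff s 0 = 0\<close>.\<close>

lemma half_space_diff_nonneg:
  fixes w :: "real ^ 'n"
  assumes s: "0 < s" "s < 1"
  shows "0 \<le> (\<integral>z. half_line_diff s (z \<bullet> w) * riesz_kernel s z \<partial>lebesgue)"
proof -
  define f where "f = (\<lambda>z. half_line_diff s (z \<bullet> w) * riesz_kernel s z)"
  have fm[measurable]: "f \<in> borel_measurable borel" unfolding f_def by measurable
  have intL: "integrable lebesgue f" using half_space_diff_integrable[OF s] by (simp add: f_def)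
  then have int: "integrable lborel f" by (subst (asm) integrable_completion) auto
  obtain c where c: "0 \<le> c"
    and pi: "\<And>a \<phi>. 0 < a \<Longrightarrow> \<phi> \<in> borel_measurable borel \<Longrightarrow>
      integrable lborel (\<lambda>z. indicator {z. a < z \<bullet> w} z * (\<phi> (z \<bullet> w) * riesz_kernel s z)) \<Longrightarrow>
      integrable lborel (\<lambda>t. indicator {a<..} t * (\<phi> t * t powr (- 1 - 2 * s))) \<or> c = 0"
    and pe: "\<And>a \<phi>. 0 < a \<Longrightarrow> \<phi> \<in> borel_measurable borel \<Longrightarrow>
      (\<integral>z. indicator {z. a < z \<bullet> w} z * (\<phi> (z \<bullet> w) * riesz_kernel s z) \<partial>lborel)
      = c * (\<integral>t. indicator {a<..} t * (\<phi> t * t powr (- 1 - 2 * s)) \<partial>lborel)"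
    using riesz_kernel_pushforward[OF s(1), of w] by blast
  \<comment> \<open>Starting at \<open>1/2\<close> keeps every cut-off in the admissible range
    \<open>a \<le> 1/2\<close>.\<close>
  define a where "a i = 1 / real (Suc (Suc i))" for i
  have a: "0 < a i" "a i \<le> 1/2" for i by (auto simp: a_def field_simps)
  have a0: "a \<longlonglongrightarrow> 0"
    unfolding a_def using LIMSEQ_Suc[OF LIMSEQ_inverse_real_of_nat] by (simp add: inverse_eq_divide)
  have lower: "- 8 * c * a i powr (2 - 2 * s) \<le> (\<integral>z. indicator {z. a i < z \<bullet> w} z * f z \<partial>lborel)" for i
  proof -
    have ii: "integrable lborel (\<lambda>z. indicator {z. a i < z \<bullet> w} z * f z)"
      using integrable_mult_indicator[OF _ int, of "{z. a i < z \<bullet> w}"] by simp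
    have "integrable lborel (\<lambda>t. indicator {a i<..} t * (half_line_diff s t * t powr (- 1 - 2 * s))) \<or> c = 0"
      by (rule pi[OF a(1)]) (use ii in \<open>auto simp: f_def\<close>)
    then have "c * (- 8 * a i powr (2 - 2 * s)) \<le> c * (\<integral>t. indicator {a i<..} t * (half_line_diff s t * t powr (- 1 - 2 * s)) \<partial>lborel)"
    proof
      assume "integrable lborel (\<lambda>t. indicator {a i<..} t * (half_line_diff s t * t powr (- 1 - 2 * s)))"
      then show ?thesis by (intro mult_left_mono half_line_integral_lower s a c)
    qed simp
    also have "\<dots> = (\<integral>z. indicator {z. a i < z \<bullet> w} z * f z \<partial>lborel)"
      unfolding f_def by (rule pe[symmetric]) (use a in auto)
    finally show ?thesis by (simp add: algebra_simps)
  qed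
  have lim: "(\<lambda>i. \<integral>z. indicator {z. a i < z \<bullet> w} z * f z \<partial>lborel) \<longlonglongrightarrow> (\<integral>z. indicator {z. 0 < z \<bullet> w} z * f z \<partial>lborel)"
  proof (rule integral_dominated_convergence[where w="\<lambda>z. norm (f z)"])
    have "(\<lambda>i. indicator {z. a i < z \<bullet> w} z * f z) \<longlonglongrightarrow> indicator {z. 0 < z \<bullet> w} z * f z" for z
    proof (rule tendsto_eventually)
      show "eventually (\<lambda>i. indicator {z. a i < z \<bullet> w} z * f z = indicator {z. 0 < z \<bullet> w} z * f z) sequentially"
      proof (cases "0 < z \<bullet> w")
        case True
        then have "eventually (\<lambda>i. a i < z \<bullet> w) sequentially" by (rule order_tendstoD(2)[OF a0])
        then show ?thesis by eventually_elim (use True in simp)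
      next
        case False
        then have "\<not> a i < z \<bullet> w" for i using a(1)[of i] by linarith
        then show ?thesis using False by simp
      qed
    qed
    then show "AE z in lborel. (\<lambda>i. indicator {z. a i < z \<bullet> w} z * f z) \<longlonglongrightarrow> indicator {z. 0 < z \<bullet> w} z * f z"
      by simp
    show "AE z in lborel. norm (indicator {z. a i < z \<bullet> w} z * f z) \<le> norm (f z)" for i
      by (auto simp: indicator_def)
  qed (use int in auto)
  have lim0: "(\<lambda>i. - 8 * c * a i powr (2 - 2 * s)) \<longlonglongrightarrow> - 8 * c * 0"
    using a0 a s by (intro tendsto_mult_left tendsto_zero_powrI[where b="2 - 2 * s"]) (auto intro: less_imp_le always_eventually)
  have pos: "0 \<le> (\<integral>z. indicator {z. 0 < z \<bullet> w} z * f z \<partial>lborel)"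
    using LIMSEQ_le[OF lim0 lim] lower by auto
  have i1: "integrable lborel (\<lambda>z. indicator {z. 0 < z \<bullet> w} z * f z)"
    using integrable_mult_indicator[OF _ int, of "{z. 0 < z \<bullet> w}"] by simp
  then have i1L: "integrable lebesgue (\<lambda>z. indicator {z. 0 < z \<bullet> w} z * f z)"
    by (subst integrable_completion) auto
  have fe: "f (- z) = f z" for z by (simp add: f_def)
  note m = lebesgue_preserving_integral[OF lebesgue_preserving_uminus, of "\<lambda>z. indicator {z. 0 < z \<bullet> w} z * f z"]
  have "(\<integral>z. f z \<partial>lebesgue) = (\<integral>z. indicator {z. 0 < z \<bullet> w} z * f z + indicator {z. 0 < z \<bullet> w} (- z) * f (- z) \<partial>lebesgue)"
  proof (rule Bochner_Integration.integral_cong)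
    show "f z = indicator {z. 0 < z \<bullet> w} z * f z + indicator {z. 0 < z \<bullet> w} (- z) * f (- z)" for z
      by (cases "z \<bullet> w = 0") (auto simp: fe indicator_def f_def)
  qed simp
  also have "\<dots> = 2 * (\<integral>z. indicator {z. 0 < z \<bullet> w} z * f z \<partial>lebesgue)"
    using m i1L by (subst Bochner_Integration.integral_add) auto
  also have "\<dots> = 2 * (\<integral>z. indicator {z. 0 < z \<bullet> w} z * f z \<partial>lborel)"
    by (subst integral_completion) auto
  finally show ?thesis using pos by (simp add: f_def)
qed

section \<open>A barrier in the exterior of a ball\<close>

lemma powr_subadditive:
  fixes a b s :: real
  assumes "0 \<le> a" "0 \<le> b" "0 < s" "s < 1"
  shows "(a + b) powr s \<le> a powr s + b powr s"
proof (cases "a = 0 \<or> b = 0")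
  case False
  then have ab: "0 < a" "0 < b" using assms by auto
  have "(a + b) powr s = a * (a + b) powr (s - 1) + b * (a + b) powr (s - 1)"
    using ab powr_add[of "a + b" 1 "s - 1"] by (simp add: algebra_simps)
  also have "\<dots> \<le> a * a powr (s - 1) + b * b powr (s - 1)"
    using ab assms by (intro add_mono mult_left_mono powr_mono2') auto
  also have "\<dots> = a powr s + b powr s"
    using ab powr_add[of a 1 "s - 1"] powr_add[of b 1 "s - 1"] by simp
  finally show ?thesis .
qed (use assms in auto)

text \<open>Two regimes for the error of dropping \<open>t\<^sup>2\<close>. For \<open>t\<close>
  above \<open>d / 2\<close> subadditivity costs \<open>t powr (2 * s)\<close>, and the factor
  \<open>(t / (d / 2)) powr \<kappa>\<close>, at least \<open>1\<close>, can be inserted. Below it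
  \<open>l > d / 2\<close>, concavity costs \<open>t\<^sup>2 * l powr (s - 1)\<close>, and
  \<open>\<kappa> \<le> 1 - s\<close> makes the surplus power of \<open>t\<close> nonnegative. The
  \<kappa> in the exponent of \<open>t\<close> makes the error integrable against the kernel near
  the origin.\<close>

lemma powr_curvature_error:
  fixes s \<kappa> d t l :: real
  assumes s: "0 < s" "s < 1" and \<kappa>: "0 < \<kappa>" "\<kappa> \<le> 1 - s" and d: "0 < d" "d \<le> 1" and t: "0 < t"
    and l: "d - t \<le> l"
  shows "(max 0 (l + t\<^sup>2)) powr s - (max 0 l) powr s \<le> (d / 2) powr (- \<kappa>) * t powr (2 * s + \<kappa>)"
proof (cases "d / 2 \<le> t")
  case True
  have "(max 0 (l + t\<^sup>2)) powr s \<le> (max 0 l + t\<^sup>2) powr s"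
    using s by (intro powr_mono2) auto
  also have "\<dots> \<le> (max 0 l) powr s + (t\<^sup>2) powr s"
    by (rule powr_subadditive) (use s in auto)
  also have "(t\<^sup>2) powr s = t powr (2 * s)"
    using power_powr[OF t, of 2 s] by simp
  also have "t powr (2 * s) \<le> (t / (d / 2)) powr \<kappa> * t powr (2 * s)"
    using mult_right_mono[of 1 "(t / (d / 2)) powr \<kappa>" "t powr (2 * s)"] ge_one_powr_ge_zero[of "t / (d / 2)" \<kappa>] True d \<kappa>
    by (auto simp: field_simps)
  also have "(t / (d / 2)) powr \<kappa> = (d / 2) powr (- \<kappa>) * t powr \<kappa>"
    using d t powr_divide[of t "d / 2" \<kappa>] by (simp add: powr_minus_divide)
  finally show ?thesis by (simp add: powr_add mult_ac)
next
  case False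
  then have lp: "d / 2 < l" "0 < l" using l d by auto
  have "l + t\<^sup>2 = l * (1 + t\<^sup>2 / l)" using lp by (simp add: field_simps)
  then have "(l + t\<^sup>2) powr s = l powr s * (1 + t\<^sup>2 / l) powr s"
    using lp powr_mult[of l "1 + t\<^sup>2 / l" s] by simp
  also have "\<dots> \<le> l powr s * (1 + s * (t\<^sup>2 / l))"
    using lp s order_trans[of "-1" 0 "t\<^sup>2 / l"] by (intro mult_left_mono powr_bernoulli) auto
  also have "\<dots> = l powr s + s * t\<^sup>2 * l powr (s - 1)"
    using lp by (simp add: powr_diff field_simps)
  finally have "(l + t\<^sup>2) powr s - l powr s \<le> s * (t\<^sup>2 * l powr (s - 1))" by simp
  also have "\<dots> \<le> 1 * (t\<^sup>2 * l powr (s - 1))"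
    using s by (intro mult_right_mono) auto
  also have "\<dots> \<le> 1 * (t\<^sup>2 * (d / 2) powr (s - 1))"
    using lp d s by (intro mult_left_mono powr_mono2') auto
  also have "t\<^sup>2 * (d / 2) powr (s - 1) = t powr (2 * s + \<kappa>) * t powr (2 - 2 * s - \<kappa>) * (d / 2) powr (s - 1)"
    using t by (simp add: powr_add[symmetric])
  also have "1 * (t powr (2 * s + \<kappa>) * t powr (2 - 2 * s - \<kappa>) * (d / 2) powr (s - 1))
    \<le> 1 * (t powr (2 * s + \<kappa>) * (d / 2) powr (2 - 2 * s - \<kappa>) * (d / 2) powr (s - 1))"
    using False t s \<kappa> by (intro mult_left_mono mult_right_mono powr_mono2) auto
  also have "\<dots> = t powr (2 * s + \<kappa>) * (d / 2) powr (1 - s - \<kappa>)"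
  proof -
    have "(d / 2) powr (2 - 2 * s - \<kappa>) * (d / 2) powr (s - 1) = (d / 2) powr (1 - s - \<kappa>)"
      unfolding powr_add[symmetric] by (rule arg_cong[where f="\<lambda>q. (d / 2) powr q"]) simp
    then show ?thesis by (simp add: mult.assoc)
  qed
  also have "\<dots> \<le> t powr (2 * s + \<kappa>) * (d / 2) powr (- \<kappa>)"
    using d s by (intro mult_left_mono powr_mono') auto
  finally have "(l + t\<^sup>2) powr s - l powr s \<le> (d / 2) powr (- \<kappa>) * t powr (2 * s + \<kappa>)"
    by (simp add: mult.commute)
  moreover have "max 0 (l + t\<^sup>2) = l + t\<^sup>2" "max 0 l = l" using lp by auto
  ultimately show ?thesis by simp
qed

lemma powr_small:
  fixes p \<epsilon> d :: real
  assumes "0 < p" "0 < \<epsilon>" "0 < d" "d < \<epsilon> powr (1 / p)"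
  shows "d powr p < \<epsilon>"
proof -
  have "d powr p < (\<epsilon> powr (1 / p)) powr p" using assms by (intro powr_less_mono2) auto
  then show ?thesis using assms by (simp add: powr_powr)
qed

text \<open>Only the ball is kept, and there the kernel is at least its value at the largest
  distance \<open>R\<close>.\<close>

lemma riesz_kernel_integral_ball_lower:
  fixes f :: "real ^ 'n \<Rightarrow> real"
  assumes s: "0 < s" and r: "0 < r" and m: "0 \<le> m"
    and int: "kernel_integrable s f"
    and nonneg: "\<And>z. 0 \<le> f z"
    and ball: "\<And>z. z \<in> ball c r \<Longrightarrow> m \<le> f z \<and> 0 < norm z \<and> norm z \<le> R"
  shows "m * R powr (- real CARD('n) - 2 * s) * (unit_ball_vol (real CARD('n)) * r ^ CARD('n))
    \<le> kernel_integral s f"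
proof -
  let ?M = "m * R powr (- real CARD('n) - 2 * s)"
  have "?M * measure lebesgue (ball c r) = (\<integral>z. ?M * indicator (ball c r) z \<partial>lebesgue)"
    by simp
  also have "\<dots> \<le> kernel_integral s f"
  proof (rule integral_mono[OF _ int])
    show "integrable lebesgue (\<lambda>z. ?M * indicator (ball c r) z)"
      by (intro integrable_mult_right integrable_real_indicator) (use r in \<open>auto simp: emeasure_ball\<close>)
    show "?M * indicator (ball c r) z \<le> f z * riesz_kernel s z" for z
    proof (cases "z \<in> ball c r")
      case True
      have "R powr (- real CARD('n) - 2 * s) \<le> norm z powr (- real CARD('n) - 2 * s)"
        using ball[OF True] s by (intro powr_mono2') auto
      then have "R powr (- real CARD('n) - 2 * s) \<le> riesz_kernel s z"
        by (simp add: riesz_kernel_def)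
      then show ?thesis using ball[OF True] m True by (simp add: mult_mono)
    next
      case False
      then show ?thesis using nonneg[of z] by simp
    qed
  qed
  finally show ?thesis using r by (simp add: content_ball)
qed

lemma riesz_kernel_outer_half_space:
  fixes w :: "real ^ 'n"
  assumes s: "0 < s" and w: "w \<noteq> 0"
  shows "integrable lebesgue (\<lambda>z. indicator {z. 1 \<le> z \<bullet> w} z * riesz_kernel s z)"
    and "3 powr (- real CARD('n) - 2 * s) * unit_ball_vol (real CARD('n)) * norm w powr (2 * s)
      \<le> (\<integral>z. indicator {z. 1 \<le> z \<bullet> w} z * riesz_kernel s z \<partial>lebesgue)"
proof -
  have nw: "0 < norm w" using w by simp
  have r: "1 / norm w \<le> norm z" if "1 \<le> z \<bullet> w" for z
  proof -
    have "1 \<le> norm z * norm w" using that norm_cauchy_schwarz[of z w] by linarith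
    then show ?thesis using nw by (simp add: field_simps)
  qed
  have "(indicator {z. 1 \<le> z \<bullet> w} :: real ^ 'n \<Rightarrow> real) \<in> borel_measurable lborel" by simp
  then have [measurable]: "(indicator {z. 1 \<le> z \<bullet> w} :: real ^ 'n \<Rightarrow> real) \<in> borel_measurable lebesgue"
    by (rule measurable_completion)
  show int: "integrable lebesgue (\<lambda>z. indicator {z. 1 \<le> z \<bullet> w} z * riesz_kernel s z)"
  proof (rule integrable_riesz_kernelI[where r="1 / norm w" and p="2 * s + 1" and q=0 and A=0 and B=1])
    show "\<bar>indicator {z. 1 \<le> z \<bullet> w} z\<bar> \<le> 0 * norm z powr (2 * s + 1)" if "norm z < 1 / norm w" for z
      using r[of z] that by (auto simp: indicator_def)
    show "\<bar>indicator {z. 1 \<le> z \<bullet> w} z\<bar> \<le> 1 * norm z powr 0" if "1 / norm w \<le> norm z" for z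
      using that nw by (auto simp: indicator_def)
  qed (use s nw in auto)
  \<comment> \<open>The ball of radius \<open>1 / norm w\<close> about the multiple of
    \<open>w\<close> at which the linear form equals \<open>2\<close> lies in the half-space and
    within distance \<open>3 / norm w\<close> of the origin.\<close>
  have "1 * (3 / norm w) powr (- real CARD('n) - 2 * s) * (unit_ball_vol (real CARD('n)) * (1 / norm w) ^ CARD('n))
    \<le> (\<integral>z. indicator {z. 1 \<le> z \<bullet> w} z * riesz_kernel s z \<partial>lebesgue)"
  proof (rule riesz_kernel_integral_ball_lower[OF s _ _ int])
    fix z assume "z \<in> ball ((2 / (norm w)\<^sup>2) *\<^sub>R w) (1 / norm w)"
    then have z: "norm (z - (2 / (norm w)\<^sup>2) *\<^sub>R w) < 1 / norm w" by (simp add: dist_norm norm_minus_commute)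
    let ?c = "(2 / (norm w)\<^sup>2) *\<^sub>R w"
    have cw: "?c \<bullet> w = 2" using nw by (simp add: power2_norm_eq_inner)
    have nc: "norm ?c = 2 / norm w" using nw by (simp add: power2_eq_square)
    have "\<bar>(z - ?c) \<bullet> w\<bar> \<le> norm (z - ?c) * norm w" by (rule Cauchy_Schwarz_ineq2)
    also have "\<dots> \<le> 1 / norm w * norm w" using z by (intro mult_right_mono) auto
    finally have "\<bar>(z - ?c) \<bullet> w\<bar> \<le> 1" using nw by simp
    then have zw: "1 \<le> z \<bullet> w" using cw by (simp add: inner_diff_left)
    have "norm z \<le> norm (z - ?c) + norm ?c" using norm_triangle_ineq[of "z - ?c" ?c] by simp
    also have "\<dots> \<le> 3 / norm w" using z nc by (simp add: field_simps)
    finally show "1 \<le> indicat_real {z. 1 \<le> z \<bullet> w} z \<and> 0 < norm z \<and> norm z \<le> 3 / norm w"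
      using zw by auto
  qed (use nw in auto)
  moreover have "(3 / norm w) powr (- real CARD('n) - 2 * s) * (1 / norm w) ^ CARD('n)
     = 3 powr (- real CARD('n) - 2 * s) * norm w powr (2 * s)"
  proof -
    have "(3 / norm w) powr (- real CARD('n) - 2 * s) = 3 powr (- real CARD('n) - 2 * s) * norm w powr (real CARD('n) + 2 * s)"
      using nw powr_minus_divide[of "norm w" "real CARD('n) + 2 * s"] by (simp add: powr_divide)
    moreover have "(1 / norm w) ^ CARD('n) = norm w powr (- real CARD('n))"
      using nw by (simp add: powr_minus_divide powr_realpow power_one_over)
    ultimately show ?thesis by (simp add: mult.assoc powr_add[symmetric])
  qed
  ultimately show "3 powr (- real CARD('n) - 2 * s) * unit_ball_vol (real CARD('n)) * norm w powr (2 * s)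
      \<le> (\<integral>z. indicator {z. 1 \<le> z \<bullet> w} z * riesz_kernel s z \<partial>lebesgue)"
    by (simp add: mult_ac)
qed

text \<open>Beyond \<open>q = 1\<close> the profile is frozen at the value \<open>1 / 2\<close>
  reached there, which keeps the barrier continuous and bounded.\<close>

definition barrier_profile :: "real \<Rightarrow> real \<Rightarrow> real" where
  "barrier_profile s q = (if q \<le> 0 then 0 else if q \<le> 1 then q powr s - q powr (3 * s / 2) / 2 else 1 / 2)"

text \<open>The square of the norm makes the defining function a quadratic polynomial: its tangent
  plane misses it by exactly \<open>(norm z)\<^sup>2\<close>.\<close>

definition barrier :: "real \<Rightarrow> real \<Rightarrow> real ^ 'n \<Rightarrow> real" where
  "barrier s \<rho> y = barrier_profile s ((norm y)\<^sup>2 - \<rho>\<^sup>2)"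

lemma barrier_profile_bounds:
  assumes s: "0 < s"
  shows "0 \<le> barrier_profile s q" "barrier_profile s q \<le> 1" "barrier_profile s q \<le> (max 0 q) powr s"
    and "0 < q0 \<Longrightarrow> q0 \<le> 1 \<Longrightarrow> q0 \<le> q \<Longrightarrow> q0 powr s / 2 \<le> barrier_profile s q"
proof -
  have le: "q powr (3 * s / 2) \<le> q powr s" if "0 < q" "q \<le> 1" for q
    using that s by (intro powr_mono') auto
  have le2: "q powr (3 * s / 2) \<le> q powr s * 2" if "0 < q" "q \<le> 1" for q
    using le[OF that] powr_ge_zero[of q s] by linarith
  have one: "q powr s \<le> 1" if "0 < q" "q \<le> 1" for q
    using that s by (auto intro!: powr_le1)
  have one': "1 \<le> q powr s" if "1 < q" for q
    using that s by (intro ge_one_powr_ge_zero) auto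
  have ge0: "0 \<le> q powr (3 * s / 2)" "0 \<le> q powr s" for q by auto
  show "0 \<le> barrier_profile s q"
    using le2[of q] unfolding barrier_profile_def by auto
  show "barrier_profile s q \<le> 1"
    using one[of q] ge0[of q] unfolding barrier_profile_def by (auto simp: not_le intro: order_trans[of _ "q powr s"])
  show "barrier_profile s q \<le> (max 0 q) powr s"
    using one'[of q] ge0[of q] unfolding barrier_profile_def by (auto simp: max_def)
  assume q: "0 < q0" "q0 \<le> 1" "q0 \<le> q"
  show "q0 powr s / 2 \<le> barrier_profile s q"
  proof (cases "q \<le> 1")
    case True
    have "q0 powr s \<le> q powr s" using q s by (intro powr_mono2) auto
    then show ?thesis using le[of q] q True by (auto simp: barrier_profile_def)
  next
    case False
    then show ?thesis using one[of q0] q by (auto simp: barrier_profile_def)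
  qed
qed

text \<open>The tangent plane is \<open>y \<mapsto> d (1 + w \<bullet> z)\<close> with \<open>w = (2 / d) x\<close>. Convexity of \<open>X \<mapsto> X powr (3/2)\<close>
  reduces the lower order term \<open>q powr (3 s / 2)\<close> to \<open>q powr s\<close>, with a gain on the half-space where the
  tangent plane is negative.\<close>
lemma barrier_one_sided:
  fixes x z :: "real ^ 'n"
  assumes s: "0 < s" "s < 1" and \<kappa>: "0 < \<kappa>" "\<kappa> \<le> 1 - s"
    and d: "(norm x)\<^sup>2 - \<rho>\<^sup>2 = d" "0 < d" "d \<le> 1"
    and x: "norm x \<le> 1 / 2" and z: "z \<noteq> 0" "norm z \<le> 1 / 4"
  defines "w \<equiv> (2 / d) *\<^sub>R x"
  shows "(1 - 3/4 * d powr (s / 2)) * d powr s * (1 - (max 0 (1 + z \<bullet> w)) powr s)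
     + d powr (3 * s / 2) / 4 * indicator {z. z \<bullet> w \<le> - 1} z
     - (d / 2) powr (- \<kappa>) * norm z powr (2 * s + \<kappa>) \<le> barrier s \<rho> x - barrier s \<rho> (x + z)"
proof -
  define l where "l = d * (1 + z \<bullet> w)"
  define q where "q = l + (norm z)\<^sup>2"
  define P where "P = (max 0 (1 + z \<bullet> w)) powr s"
  have P0: "0 \<le> P" by (simp add: P_def)
  have lx: "l = d + 2 * (x \<bullet> z)" using d by (simp add: l_def w_def algebra_simps inner_commute)
  have q: "(norm (x + z))\<^sup>2 - \<rho>\<^sup>2 = q"
    using d by (simp add: q_def lx power2_norm_eq_inner inner_add inner_commute algebra_simps)
  have "norm (x + z) \<le> 3 / 4" using norm_triangle_ineq[of x z] x z by linarith
  then have "(norm (x + z))\<^sup>2 \<le> (3 / 4)\<^sup>2" by (intro power_mono) auto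
  also have "\<dots> \<le> 1 + \<rho>\<^sup>2" by (simp add: power2_eq_square)
  finally have q1: "q \<le> 1" using q by simp
  have "\<bar>x \<bullet> z\<bar> \<le> norm x * norm z" by (rule Cauchy_Schwarz_ineq2)
  also have "\<dots> \<le> 1 / 2 * norm z" using x by (intro mult_right_mono) auto
  finally have lz: "d - norm z \<le> l" unfolding lx by linarith
  have E: "(max 0 q) powr s - (max 0 l) powr s \<le> (d / 2) powr (- \<kappa>) * norm z powr (2 * s + \<kappa>)"
    unfolding q_def by (rule powr_curvature_error[OF s \<kappa>]) (use d z lz in auto)
  have ml: "max 0 l = d * max 0 (1 + z \<bullet> w)" using d by (simp add: l_def max_mult_distrib_left)
  have ls: "(max 0 l) powr s = d powr s * P"
    unfolding ml P_def using d by (simp add: powr_mult)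
  have lb: "(max 0 l) powr (3 * s / 2) = d powr (3 * s / 2) * (max 0 (1 + z \<bullet> w)) powr (3 * s / 2)"
    unfolding ml using d by (simp add: powr_mult)
  have ds: "d powr (3 * s / 2) = d powr s * d powr (s / 2)"
    by (simp add: powr_add[symmetric])
  \<comment> \<open>The convexity bound is Bernoulli's inequality with exponent
    \<open>2 / 3\<close>, since \<open>P\<close> is the \<open>2 / 3\<close> power of
    \<open>Y\<close>. Where the tangent plane is not positive both powers vanish and a surplus of
    \<open>1 / 2\<close> remains.\<close>
  have cvx: "3 / 2 * P - 3 / 2 + 1 / 2 * indicator {z. z \<bullet> w \<le> - 1} z \<le> (max 0 (1 + z \<bullet> w)) powr (3 * s / 2) - 1"
  proof (cases "z \<bullet> w \<le> - 1")
    case True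
    then have "max 0 (1 + z \<bullet> w) = 0" by auto
    then show ?thesis using True by (simp add: P_def)
  next
    case False
    define Y where "Y = (max 0 (1 + z \<bullet> w)) powr (3 * s / 2)"
    have "P = (1 + (Y - 1)) powr (2 / 3)" by (simp add: Y_def P_def powr_powr)
    also have "\<dots> \<le> 1 + 2 / 3 * (Y - 1)" by (rule powr_bernoulli) (auto simp: Y_def)
    finally have "P \<le> 1 + 2 / 3 * (Y - 1)" .
    then have "3 / 2 * P - 3 / 2 \<le> Y - 1" by argo
    moreover have "indicat_real {z. z \<bullet> w \<le> - 1} z = 0" using False by simp
    ultimately show ?thesis unfolding Y_def[symmetric] by simp
  qed
  have bx: "barrier s \<rho> x = d powr s - d powr (3 * s / 2) / 2"
    unfolding barrier_def d(1) using d by (simp add: barrier_profile_def)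
  have bz: "barrier s \<rho> (x + z) = (max 0 q) powr s - (max 0 q) powr (3 * s / 2) / 2"
    unfolding barrier_def q using q1 by (auto simp: barrier_profile_def)
  have "(max 0 l) powr (3 * s / 2) \<le> (max 0 q) powr (3 * s / 2)"
    using s by (intro powr_mono2 max.mono) (auto simp: q_def)
  then have "d powr s * (1 - P) - (d / 2) powr (- \<kappa>) * norm z powr (2 * s + \<kappa>)
     + d powr (3 * s / 2) / 2 * ((max 0 (1 + z \<bullet> w)) powr (3 * s / 2) - 1)
     \<le> barrier s \<rho> x - barrier s \<rho> (x + z)"
    unfolding bx bz using E ls lb by (simp add: algebra_simps)
  moreover have "d powr (3 * s / 2) / 2 * (3 / 2 * P - 3 / 2 + 1 / 2 * indicator {z. z \<bullet> w \<le> - 1} z)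
    \<le> d powr (3 * s / 2) / 2 * ((max 0 (1 + z \<bullet> w)) powr (3 * s / 2) - 1)"
    by (rule mult_left_mono[OF cvx]) simp
  \<comment> \<open>The multiples of \<open>1 - P\<close> add up to the coefficient
    \<open>d powr s - 3/4 * d powr (3 * s / 2)\<close>, which is positive for
    \<open>d \<le> 1\<close>; harmonicity of the first term can thus be used with this reduced
    coefficient.\<close>
  moreover have "(1 - 3/4 * d powr (s / 2)) * d powr s * (1 - P) + d powr (3 * s / 2) / 4 * indicator {z. z \<bullet> w \<le> - 1} z
    = d powr s * (1 - P) + d powr (3 * s / 2) / 2 * (3 / 2 * P - 3 / 2 + 1 / 2 * indicator {z. z \<bullet> w \<le> - 1} z)"
    unfolding ds by (simp add: field_simps)
  ultimately show ?thesis unfolding P_def[symmetric] by linarith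
qed

text \<open>Four contributions to the integral of \<open>h\<close>: the harmonic part is
  nonnegative, the half-space where the tangent plane is negative gives at least
  \<open>A * d powr (- (s / 2))\<close>, curvature costs \<open>B * d powr (- \<kappa>)\<close>, and
  jumps beyond \<open>1/4\<close> cost a constant. As \<open>\<kappa> < s / 2\<close>, the gain wins
  for small \<open>d\<close> and exceeds any prescribed \<Lambda>. An integrable minorant of the
  second difference is the form that \<open>pv_limit_lower\<close> accepts.\<close>

lemma barrier_supersolution:
  fixes \<rho> \<Lambda> s :: real
  assumes s: "0 < s" "s < 1" and \<rho>: "0 < \<rho>" "\<rho> \<le> 1 / 4"
  shows "\<exists>q0. 0 < q0 \<and> q0 \<le> \<rho>\<^sup>2 \<and> (\<forall>x::real^'n. 0 < (norm x)\<^sup>2 - \<rho>\<^sup>2 \<longrightarrow> (norm x)\<^sup>2 - \<rho>\<^sup>2 < q0 \<longrightarrow>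
    (\<exists>h. kernel_integrable s h \<and> (\<forall>z. z \<noteq> 0 \<longrightarrow> h z \<le> second_diff (barrier s \<rho>) x z)
      \<and> \<Lambda> \<le> kernel_integral s h))"
proof -
  define \<kappa> where "\<kappa> = s * (1 - s) / 4"
  have \<kappa>: "0 < \<kappa>" "\<kappa> \<le> 1 - s" "\<kappa> < s / 2"
  proof -
    show "0 < \<kappa>" using s by (simp add: \<kappa>_def)
    have "s * (1 - s) \<le> 1 * (1 - s)" "s * (1 - s) \<le> s * 1" using s by (auto intro!: mult_right_mono mult_left_mono)
    then have "s * (1 - s) / 4 \<le> 1 - s" "s * (1 - s) / 4 < s / 2" using s by (simp_all only: mult_1 mult_1_right)
    then show "\<kappa> \<le> 1 - s" "\<kappa> < s / 2" by (simp_all add: \<kappa>_def)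
  qed
  define I1 where "I1 = (\<integral>z. (indicator (ball 0 (1/4)) (z::real^'n) * norm z powr (2 * s + \<kappa>)) * riesz_kernel s z \<partial>lebesgue)"
  define I2 where "I2 = kernel_integral s (\<lambda>z::real^'n. indicator (- ball 0 (1/4)) z * norm z powr 0)"
  define g where "g = 3 powr (- real CARD('n) - 2 * s) * unit_ball_vol (real CARD('n))"
  have g: "0 < g" by (simp add: g_def)
  have I1: "0 \<le> I1" unfolding I1_def by (intro Bochner_Integration.integral_nonneg) auto
  have I2: "0 \<le> I2" unfolding I2_def by (intro Bochner_Integration.integral_nonneg) auto
  define A where "A = g * (2 * \<rho>) powr (2 * s) / 4"
  define B where "B = 2 * 2 powr \<kappa> * I1"
  define D where "D = 5 * I2 + \<bar>\<Lambda>\<bar> + 1"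
  have A: "0 < A" using g \<rho> by (simp add: A_def)
  have B: "0 \<le> B" using I1 by (simp add: B_def)
  have D: "0 < D" using I2 by (simp add: D_def add_nonneg_pos)
  define p where "p = s / 2 - \<kappa>"
  have p: "0 < p" using \<kappa> by (simp add: p_def)
  \<comment> \<open>The three bounds keep \<open>norm x\<close> below \<open>1 / 2\<close>, make the
    curvature error at most half of the gain, and make the other half exceed
    \<open>D\<close>.\<close>
  define q0 where "q0 = Min {\<rho>\<^sup>2, (A / (2 * B + 1)) powr (1 / p), (A / (2 * D)) powr (1 / (s / 2))}"
  have q0: "0 < q0" "q0 \<le> \<rho>\<^sup>2" "q0 \<le> (A / (2 * B + 1)) powr (1 / p)" "q0 \<le> (A / (2 * D)) powr (1 / (s / 2))"
    using A B D \<rho> by (auto simp: q0_def)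
  show ?thesis
  proof (intro exI[of _ q0] conjI allI impI)
    show "0 < q0" "q0 \<le> \<rho>\<^sup>2" by (fact q0)+
    fix x :: "real ^ 'n"
    define d where "d = (norm x)\<^sup>2 - \<rho>\<^sup>2"
    assume "0 < (norm x)\<^sup>2 - \<rho>\<^sup>2" "(norm x)\<^sup>2 - \<rho>\<^sup>2 < q0"
    then have d: "0 < d" "d < q0" by (auto simp: d_def)
    have \<rho>2: "\<rho>\<^sup>2 \<le> 1 / 16" using \<rho> power_mono[of \<rho> "1/4" 2] by (simp add: power2_eq_square)
    have d1: "d \<le> 1" using d q0 \<rho>2 by linarith
    have "(norm x)\<^sup>2 \<le> (1/2)\<^sup>2" using d q0 \<rho>2 unfolding d_def power2_eq_square by simp
    then have x: "norm x \<le> 1 / 2" by (rule power2_le_imp_le) simp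
    have "\<rho>\<^sup>2 \<le> (norm x)\<^sup>2" using d by (simp add: d_def)
    then have x\<rho>: "\<rho> \<le> norm x" by (rule power2_le_imp_le) simp
    define w where "w = (2 / d) *\<^sub>R x"
    have nw: "norm w = 2 * norm x / d" using d by (simp add: w_def)
    have w0: "w \<noteq> 0" using x\<rho> \<rho> d by (auto simp: w_def)
    have mw: "- w \<noteq> 0" using w0 by simp
    define \<gamma> where "\<gamma> = (1 - 3/4 * d powr (s / 2)) * d powr s"
    have ds: "0 \<le> d powr (s / 2)" "d powr (s / 2) \<le> 1" "0 \<le> d powr s" "d powr s \<le> 1" "0 \<le> d powr (3 * s / 2)" "d powr (3 * s / 2) \<le> 1"
      using d d1 s by (auto intro!: powr_le1)
    have \<gamma>: "0 \<le> \<gamma>" "\<gamma> \<le> 1"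
    proof -
      show "0 \<le> \<gamma>" unfolding \<gamma>_def using ds by (intro mult_nonneg_nonneg) auto
      show "\<gamma> \<le> 1" unfolding \<gamma>_def using ds by (intro mult_le_one) auto
    qed
    let ?E = "(d / 2) powr (- \<kappa>)"
    define h1 where "h1 z = half_line_diff s (z \<bullet> w)" for z
    define h2 where "h2 z = indicat_real {z. 1 \<le> z \<bullet> (- w)} z" for z
    define h3 where "h3 z = indicat_real {z. 1 \<le> z \<bullet> w} z" for z
    define h4 where "h4 z = indicator (ball 0 (1/4)) z * norm z powr (2 * s + \<kappa>)" for z :: "real ^ 'n"
    define h5 where "h5 z = indicator (- ball 0 (1/4)) z * norm z powr 0" for z :: "real ^ 'n"
    \<comment> \<open>The coefficient \<open>5\<close> pushes \<open>h\<close> below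
      \<open>- 2\<close> for jumps beyond \<open>1/4\<close>: there the first two terms are at most
      \<open>2 + 1/2\<close>, and second differences of a function with values in
      \<open>[0, 1]\<close> are at least \<open>- 2\<close>.\<close>
    define h where "h z = \<gamma> * h1 z + d powr (3 * s / 2) / 4 * (h2 z + h3 z) - 2 * ?E * h4 z - 5 * h5 z" for z
    have i1: "kernel_integrable s h1"
      unfolding h1_def by (rule half_space_diff_integrable[OF s])
    have i2: "kernel_integrable s h2"
      unfolding h2_def by (rule riesz_kernel_outer_half_space(1)[OF s(1) mw])
    have i3: "kernel_integrable s h3"
      unfolding h3_def by (rule riesz_kernel_outer_half_space(1)[OF s(1) w0])
    have i4: "kernel_integrable s h4"
      unfolding h4_def by (rule integrable_riesz_kernel_ball(1)) (use \<kappa> in auto)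
    have i5: "kernel_integrable s h5"
      unfolding h5_def by (rule integrable_riesz_kernel_compl_ball(1)) (use s in auto)
    have hK: "h z * riesz_kernel s z = \<gamma> * (h1 z * riesz_kernel s z) + d powr (3 * s / 2) / 4 * (h2 z * riesz_kernel s z)
       + d powr (3 * s / 2) / 4 * (h3 z * riesz_kernel s z) - 2 * ?E * (h4 z * riesz_kernel s z) - 5 * (h5 z * riesz_kernel s z)" for z
      by (simp add: h_def algebra_simps)
    show "\<exists>h. kernel_integrable s h \<and> (\<forall>z. z \<noteq> 0 \<longrightarrow> h z \<le> second_diff (barrier s \<rho>) x z)
      \<and> \<Lambda> \<le> kernel_integral s h"
    proof (intro exI[of _ h] conjI allI impI)
      show "kernel_integrable s h"
        unfolding hK using i1 i2 i3 i4 i5 by (intro Bochner_Integration.integrable_add Bochner_Integration.integrable_diff integrable_mult_right)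
    next
      fix z :: "real ^ 'n" assume z: "z \<noteq> 0"
      show "h z \<le> second_diff (barrier s \<rho>) x z"
      proof (cases "norm z < 1 / 4")
        case True
        have e: "h z = (\<gamma> * (1 - (max 0 (1 + z \<bullet> w)) powr s) + d powr (3 * s / 2) / 4 * indicator {z. z \<bullet> w \<le> - 1} z
            - ?E * norm z powr (2 * s + \<kappa>)) + (\<gamma> * (1 - (max 0 (1 + (- z) \<bullet> w)) powr s)
            + d powr (3 * s / 2) / 4 * indicator {z. z \<bullet> w \<le> - 1} (- z) - ?E * norm (- z) powr (2 * s + \<kappa>))"
          using True by (auto simp: h_def h1_def h2_def h3_def h4_def h5_def half_line_diff_def indicator_def algebra_simps)
        have "\<gamma> * (1 - (max 0 (1 + z \<bullet> w)) powr s) + d powr (3 * s / 2) / 4 * indicator {z. z \<bullet> w \<le> - 1} z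
          - ?E * norm z powr (2 * s + \<kappa>) \<le> barrier s \<rho> x - barrier s \<rho> (x + z)"
          unfolding \<gamma>_def w_def by (rule barrier_one_sided[OF s \<kappa>(1,2)]) (use z True d d1 x in \<open>auto simp: d_def\<close>)
        moreover have "\<gamma> * (1 - (max 0 (1 + (- z) \<bullet> w)) powr s) + d powr (3 * s / 2) / 4 * indicator {z. z \<bullet> w \<le> - 1} (- z)
          - ?E * norm (- z) powr (2 * s + \<kappa>) \<le> barrier s \<rho> x - barrier s \<rho> (x + (- z))"
          unfolding \<gamma>_def w_def by (rule barrier_one_sided[OF s \<kappa>(1,2)]) (use z True d d1 x in \<open>auto simp: d_def\<close>)
        ultimately have "h z \<le> (barrier s \<rho> x - barrier s \<rho> (x + z)) + (barrier s \<rho> x - barrier s \<rho> (x + (- z)))"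
          unfolding e by (rule add_mono)
        then show ?thesis by (simp add: second_diff_def)
      next
        case False
        have "h1 z \<le> 2"
          using powr_ge_zero[of "max 0 (1 + z \<bullet> w)" s] powr_ge_zero[of "max 0 (1 - z \<bullet> w)" s]
          unfolding h1_def half_line_diff_def by linarith
        then have "\<gamma> * h1 z \<le> 1 * 2" using \<gamma> by (intro order_trans[OF mult_left_mono mult_right_mono]) auto
        moreover have "d powr (3 * s / 2) / 4 * (h2 z + h3 z) \<le> 1 / 4 * 2"
          using ds by (intro mult_mono) (auto simp: h2_def h3_def indicator_def)
        moreover have h45: "h4 z = 0" "h5 z = 1" using False z by (auto simp: h4_def h5_def)
        ultimately have "h z \<le> - 2" unfolding h_def h45 by linarith
        also have "- 2 \<le> second_diff (barrier s \<rho>) x z"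
          using barrier_profile_bounds(1,2)[OF s(1)] unfolding second_diff_def barrier_def
          by (smt (verit))
        finally show ?thesis .
      qed
    next
      have "kernel_integral s h =
         \<gamma> * kernel_integral s h1 + d powr (3 * s / 2) / 4 * kernel_integral s h2
       + d powr (3 * s / 2) / 4 * kernel_integral s h3 - 2 * ?E * kernel_integral s h4
       - 5 * kernel_integral s h5"
        unfolding hK using i1 i2 i3 i4 i5 by simp
      also have "kernel_integral s h4 = I1" by (simp add: h4_def I1_def)
      also have "kernel_integral s h5 = I2" by (simp add: h5_def I2_def)
      finally have val: "kernel_integral s h =
         \<gamma> * kernel_integral s h1 + d powr (3 * s / 2) / 4 * kernel_integral s h2
       + d powr (3 * s / 2) / 4 * kernel_integral s h3 - 2 * ?E * I1 - 5 * I2" .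
      have p1: "0 \<le> \<gamma> * kernel_integral s h1"
        using \<gamma> half_space_diff_nonneg[OF s, of w] by (simp add: h1_def)
      have p2: "0 \<le> d powr (3 * s / 2) / 4 * kernel_integral s h2"
        by (intro mult_nonneg_nonneg Bochner_Integration.integral_nonneg) (auto simp: h2_def)
      have p3: "A * d powr (- (s / 2)) \<le> d powr (3 * s / 2) / 4 * kernel_integral s h3"
      proof -
        \<comment> \<open>The half-space starts at distance \<open>1 / norm w\<close>, at most
          \<open>d / (2 * \<rho>)\<close>, from the origin, so its mass is at least of order
          \<open>d powr (- 2 * s)\<close>; the prefactor \<open>d powr (3 * s / 2)\<close> leaves
          \<open>d powr (- (s / 2))\<close>.\<close>
        have "(2 * \<rho> / d) powr (2 * s) \<le> norm w powr (2 * s)"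
          unfolding nw using x\<rho> \<rho> d s by (intro powr_mono2) (auto simp: divide_right_mono)
        then have "g * (2 * \<rho> / d) powr (2 * s) \<le> g * norm w powr (2 * s)"
          using g by (intro mult_left_mono) auto
        also have "\<dots> \<le> kernel_integral s h3"
          unfolding h3_def g_def by (rule riesz_kernel_outer_half_space(2)[OF s(1) w0])
        finally have "d powr (3 * s / 2) / 4 * (g * (2 * \<rho> / d) powr (2 * s)) \<le> d powr (3 * s / 2) / 4 * kernel_integral s h3"
          by (intro mult_left_mono) auto
        moreover have "d powr (3 * s / 2) / 4 * (g * (2 * \<rho> / d) powr (2 * s)) = A * d powr (- (s / 2))"
        proof -
          have "(2 * \<rho> / d) powr (2 * s) = (2 * \<rho>) powr (2 * s) * d powr (- (2 * s))"
            using d \<rho> powr_divide[of "2 * \<rho>" d "2 * s"] by (simp add: powr_minus_divide)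
          moreover have "d powr (3 * s / 2) * d powr (- (2 * s)) = d powr (- (s / 2))"
            unfolding powr_add[symmetric] by (rule arg_cong[where f="\<lambda>q. d powr q"]) simp
          ultimately show ?thesis by (simp add: A_def)
        qed
        ultimately show ?thesis by simp
      qed
      have p4: "2 * ?E * I1 = B * d powr (- \<kappa>)"
        using d powr_divide[of d 2 "- \<kappa>"] by (simp add: B_def powr_minus_divide)
      have e\<kappa>: "d powr (- \<kappa>) = d powr (- (s / 2)) * d powr p"
        unfolding powr_add[symmetric] p_def by (rule arg_cong[where f="\<lambda>q. d powr q"]) simp
      have "d powr p < A / (2 * B + 1)" by (rule powr_small[OF p]) (use d q0 A B in auto)
      then have "(2 * B + 1) * d powr p < A" using B by (simp add: field_simps)
      moreover have "(2 * B + 1) * d powr p = 2 * (B * d powr p) + d powr p" by (simp add: algebra_simps)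
      ultimately have b1: "B * d powr p \<le> A / 2" using powr_ge_zero[of d p] by linarith
      have "d powr (s / 2) < A / (2 * D)" by (rule powr_small) (use d q0 A D s in auto)
      then have b2: "D < A / 2 * d powr (- (s / 2))"
        using d D by (simp add: powr_minus_divide field_simps)
      have "A * d powr (- (s / 2)) - B * d powr (- \<kappa>) = (A - B * d powr p) * d powr (- (s / 2))"
        unfolding e\<kappa> by (simp add: algebra_simps)
      also have "\<dots> \<ge> A / 2 * d powr (- (s / 2))"
        using b1 by (intro mult_right_mono) auto
      finally have "D \<le> A * d powr (- (s / 2)) - B * d powr (- \<kappa>)" using b2 by linarith
      then show "\<Lambda> \<le> kernel_integral s h"
        unfolding val p4 using p1 p2 p3 by (simp add: D_def)
    qed
  qed
qed

section \<open>Growth at the boundary\<close>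

lemma continuous_on_barrier:
  fixes z0 :: "real ^ 'n"
  assumes "0 < s"
  shows "continuous_on S (\<lambda>y. barrier s \<rho> (y - z0))"
proof -
  \<comment> \<open>Clamping the argument to \<open>[0, 1]\<close> gives a formula without cases
    that is visibly continuous at both joins.\<close>
  have eq: "barrier_profile s q = (min 1 (max 0 q)) powr s - (min 1 (max 0 q)) powr (3 * s / 2) / 2" for q
    by (auto simp: barrier_profile_def min_def max_def)
  show ?thesis
    unfolding barrier_def eq using assms
    by (intro continuous_intros continuous_on_powr') auto
qed

text \<open>What is left after truncation and division by the size of the data. The value of the
  fractional Laplacian is existential because truncation alters it, and continuity is recorded only
  at points of \<Omega>.\<close>

definition normalized_solution :: "real \<Rightarrow> real \<Rightarrow> (real ^ 'n) set \<Rightarrow> real ^ 'n \<Rightarrow> (real ^ 'n \<Rightarrow> real) \<Rightarrow> bool" where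
  "normalized_solution s \<rho> \<Omega> x0 v \<longleftrightarrow>
     open \<Omega> \<and> (\<forall>x. 0 \<le> v x \<and> v x \<le> 1) \<and> (\<forall>x. x \<notin> \<Omega> \<longrightarrow> v x = 0) \<and>
     (\<forall>x\<in>\<Omega> \<inter> ball x0 2. isCont v x \<and> (\<exists>l. \<bar>l\<bar> \<le> 1 \<and> pv_limit s (second_diff v x) l)) \<and>
     (\<forall>p\<in>frontier \<Omega> \<inter> ball x0 2. \<exists>z0. dist z0 p = \<rho> \<and> ball z0 \<rho> \<inter> \<Omega> = {})"

lemma nearest_frontier_point:
  fixes x :: "'a::euclidean_space"
  assumes "open \<Omega>" "x \<in> \<Omega>" "\<Omega> \<noteq> UNIV"
  obtains q where "q \<in> frontier \<Omega>" "x \<noteq> q" "ball x (dist x q) \<subseteq> \<Omega>"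
proof -
  have "closed (- \<Omega>)" "- \<Omega> \<noteq> {}" using assms by auto
  then obtain q where q: "q \<in> - \<Omega>" "\<And>y. y \<in> - \<Omega> \<Longrightarrow> dist x q \<le> dist x y"
    using distance_attains_inf[of "- \<Omega>" x] by blast
  have xq: "x \<noteq> q" using q assms by auto
  have sub: "ball x (dist x q) \<subseteq> \<Omega>" using q(2) by (force simp: not_le[symmetric])
  have "q \<in> closure (ball x (dist x q))" using xq by (simp add: closure_ball)
  then have "q \<in> closure \<Omega>" using closure_mono[OF sub] by blast
  then have "q \<in> frontier \<Omega>" using q assms by (simp add: frontier_def interior_open)
  with xq sub that show thesis by blast
qed

text \<open>No continuity up to the boundary is available. If \<open>f = v - A w\<close> had a positive supremum \<open>m\<close>, then
  at a point \<open>x1\<close> almost attaining it a paraboloid of height \<open>\<eta>\<close>, small compared with \<open>m\<close>, and of width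
  the distance \<open>r\<close> to the boundary produces a touching point; the error \<open>\<eta> r powr (- 2 s)\<close> is absorbed
  by the contribution \<open>m r powr (- 2 s)\<close> of the exterior ball nearby, where \<open>f \<le> 0\<close>.\<close>
lemma no_positive_maximum:
  assumes s: "0 < s" "s < 1"
  obtains \<kappa> where "0 < \<kappa>" "\<kappa> \<le> 1 / 2"
    and "\<And>(f :: real ^ 'n \<Rightarrow> real) m x1 c r \<Omega>.
     0 < m \<Longrightarrow> 0 < r \<Longrightarrow> (\<forall>y. f y \<le> m) \<Longrightarrow> m - \<kappa> * m / 2 < f x1 \<Longrightarrow> continuous_on (cball x1 (r / 2)) f \<Longrightarrow>
     ball x1 r \<subseteq> \<Omega> \<Longrightarrow> (\<forall>y. y \<notin> \<Omega> \<longrightarrow> f y \<le> 0) \<Longrightarrow> ball c r \<inter> \<Omega> = {} \<Longrightarrow> dist c x1 \<le> 2 * r \<Longrightarrow>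
     \<exists>x'. dist x1 x' < r / 2 \<and> 0 < f x' \<and> (\<exists>e. kernel_integrable s e \<and>
        0 \<le> kernel_integral s e \<and> (\<forall>z. e z \<le> second_diff f x' z))"
proof -
  define J1 where "J1 = kernel_integral s (\<lambda>z::real^'n. indicator (ball 0 1) z * norm z powr 2)"
  define J2 where "J2 = kernel_integral s (\<lambda>z::real^'n. indicator (- ball 0 1) z * norm z powr 0)"
  have J: "0 \<le> J1" "0 \<le> J2" unfolding J1_def J2_def by (auto intro!: Bochner_Integration.integral_nonneg)
  \<comment> \<open>Up to the common factor \<open>r powr (- 2 * s)\<close>, \<open>S\<close> is the
    cost of the paraboloid per unit of height and \<open>b\<close> a lower bound for the kernel mass
    of the exterior ball, all of which lies within distance \<open>4 * r\<close>. The choice of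
    \<kappa> makes this mass pay for the paraboloid.\<close>
  define S where "S = 8 * (1/4) powr (2 - 2 * s) * J1 + 2 * (1/4) powr (- 2 * s) * J2"
  have S: "0 \<le> S" using J by (simp add: S_def)
  define b where "b = 4 powr (- real CARD('n) - 2 * s) * unit_ball_vol (real CARD('n))"
  have b: "0 < b" by (simp add: b_def)
  define \<kappa> where "\<kappa> = min (1/2) (b / (S + 1))"
  have \<kappa>: "0 < \<kappa>" "\<kappa> \<le> 1 / 2" "\<kappa> * S \<le> b"
  proof -
    show "0 < \<kappa>" using b S by (auto simp: \<kappa>_def)
    show "\<kappa> \<le> 1 / 2" unfolding \<kappa>_def by (rule min.cobounded1)
    have "\<kappa> * S \<le> b / (S + 1) * S" using S by (intro mult_right_mono) (auto simp: \<kappa>_def)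
    also have "\<dots> \<le> b" using b S by (simp add: field_simps)
    finally show "\<kappa> * S \<le> b" .
  qed
  show thesis
  proof (rule that[OF \<kappa>(1,2)])
    fix f :: "real ^ 'n \<Rightarrow> real" and m x1 c r \<Omega>
    assume m: "0 < m" and r: "0 < r" and fm: "\<forall>y. f y \<le> m" and x1: "m - \<kappa> * m / 2 < f x1"
      and cont: "continuous_on (cball x1 (r / 2)) f" and sub: "ball x1 r \<subseteq> \<Omega>"
      and f0: "\<forall>y. y \<notin> \<Omega> \<longrightarrow> f y \<le> 0" and ext: "ball c r \<inter> \<Omega> = {}" and cx: "dist c x1 \<le> 2 * r"
    define \<eta> where "\<eta> = \<kappa> * m"
    have \<eta>: "0 < \<eta>" "\<eta> \<le> m / 2" "\<eta> * S \<le> m * b"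
      using \<kappa> m mult_left_mono[OF \<kappa>(3), of m] mult_right_mono[OF \<kappa>(2), of m] by (auto simp: \<eta>_def mult_ac)
    define P where "P y = \<eta> * (1 - 4 * (norm (y - x1))\<^sup>2 / r\<^sup>2)" for y
    have "continuous_on (cball x1 (r / 2)) (\<lambda>y. f y + P y)"
      unfolding P_def by (intro continuous_intros cont) (use r in auto)
    then obtain x' where x': "x' \<in> cball x1 (r / 2)" "\<And>y. y \<in> cball x1 (r / 2) \<Longrightarrow> f y + P y \<le> f x' + P x'"
      using continuous_attains_sup[OF compact_cball, of x1 "r / 2" "\<lambda>y. f y + P y"] r by (auto simp del: mem_cball)
    have P1: "P x1 = \<eta>" by (simp add: P_def)
    \<comment> \<open>At \<open>x1\<close> the sum already exceeds \<open>m\<close>, since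
      \<open>f x1\<close> misses \<open>m\<close> by less than half of the height \<eta>; at
      distance \<open>r / 2\<close> or more \<open>P \<le> 0\<close> keeps it at most
      \<open>m\<close>. So the maximum is interior and global.\<close>
    have Fm: "m < f x' + P x'" using x'(2)[of x1] x1 P1 r \<eta> by (simp add: \<eta>_def)
    have Ple: "P y \<le> \<eta>" for y using \<eta> by (simp add: P_def mult_left_le)
    have Pneg: "P y \<le> 0" if "r / 2 \<le> norm (y - x1)" for y
    proof -
      have "(r / 2)\<^sup>2 \<le> (norm (y - x1))\<^sup>2" using that r by (intro power_mono) auto
      then have "1 \<le> 4 * (norm (y - x1))\<^sup>2 / r\<^sup>2" using r by (simp add: field_simps power2_eq_square)
      then show ?thesis using \<eta> by (simp add: P_def mult_le_0_iff)
    qed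
    have max: "f y + P y \<le> f x' + P x'" for y
    proof (cases "y \<in> cball x1 (r / 2)")
      case False
      then have "P y \<le> 0" by (intro Pneg) (simp add: dist_norm norm_minus_commute)
      then show ?thesis using Fm fm[rule_format, of y] by linarith
    qed (use x' in auto)
    have fx': "m - \<eta> \<le> f x'" using Fm Ple[of x'] by linarith
    have dx': "dist x1 x' < r / 2"
    proof (rule ccontr)
      assume "\<not> dist x1 x' < r / 2"
      then have "P x' \<le> 0" by (intro Pneg) (simp add: dist_norm norm_minus_commute)
      then show False using Fm fm[rule_format, of x'] by linarith
    qed
    define e1 where "e1 z = indicator (ball 0 (r/4)) z * norm z powr 2" for z :: "real ^ 'n"
    define e2 where "e2 z = indicator (- ball 0 (r/4)) z * norm z powr 0" for z :: "real ^ 'n"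
    define e3 where "e3 z = indicat_real (ball (c - x') r) z" for z
    \<comment> \<open>The parts of the minorant: the second difference of the paraboloid for short
      jumps, \<open>- 2 * \<eta>\<close> for the others because \<open>f x' \<ge> m - \<eta>\<close>
      while \<open>f \<le> m\<close>, and a gain \<open>m\<close> on jumps into the exterior ball,
      where \<open>f \<le> 0\<close>.\<close>
    define e where "e z = - (8 * \<eta> / r\<^sup>2) * e1 z - 2 * \<eta> * e2 z + m * e3 z" for z
    have bc: "r / 2 < norm z \<and> norm z \<le> 4 * r" if "z \<in> ball (c - x') r" for z
    proof -
      have zc: "norm (x' + z - c) < r" using that by (simp add: dist_norm norm_minus_commute algebra_simps)
      then have "x' + z \<in> ball c r" by (simp add: dist_norm norm_minus_commute)
      then have "x' + z \<notin> \<Omega>" using ext by blast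
      then have "r \<le> dist x1 (x' + z)" using sub by (force simp: not_le[symmetric])
      also have "\<dots> \<le> dist x1 x' + norm z" using dist_triangle[of x1 "x' + z" x'] by (simp add: dist_norm)
      finally have "r / 2 < norm z" using dx' by linarith
      moreover have "norm z \<le> norm (x' + z - c) + norm (c - x1) + norm (x1 - x')"
        using norm_triangle_ineq[of "x' + z - c" "c - x1"] norm_triangle_ineq[of "x' + z - c + (c - x1)" "x1 - x'"] by simp
      then have "norm z \<le> 4 * r" using zc cx dx' r unfolding dist_norm by linarith
      ultimately show ?thesis by simp
    qed
    have i1: "kernel_integrable s e1"
      unfolding e1_def by (rule integrable_riesz_kernel_ball(1)) (use s r in auto)
    have i2: "kernel_integrable s e2"
      unfolding e2_def by (rule integrable_riesz_kernel_compl_ball(1)) (use s r in auto)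
    have i3: "kernel_integrable s e3"
    proof (rule integrable_riesz_kernelI[where r="r / 2" and p="2 * s + 1" and q=0 and A=0 and B=1])
      show "e3 \<in> borel_measurable lebesgue" unfolding e3_def by (rule borel_measurable_indicator) simp
      show "\<bar>e3 z\<bar> \<le> 0 * norm z powr (2 * s + 1)" if "norm z < r / 2" for z
        using bc[of z] that unfolding e3_def by (auto simp: indicator_def simp del: mem_ball)
      show "\<bar>e3 z\<bar> \<le> 1 * norm z powr 0" if "r / 2 \<le> norm z" for z
        using that r unfolding e3_def by (auto simp: indicator_def)
    qed (use s r in auto)
    have eK: "e z * riesz_kernel s z = - (8 * \<eta> / r\<^sup>2) * (e1 z * riesz_kernel s z) - 2 * \<eta> * (e2 z * riesz_kernel s z) + m * (e3 z * riesz_kernel s z)" for z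
      by (simp add: e_def algebra_simps)
    have inte: "kernel_integrable s e"
      unfolding eK using i1 i2 i3 by (intro Bochner_Integration.integrable_add Bochner_Integration.integrable_diff integrable_mult_right)
    have v1: "kernel_integral s e1 = (r / 4) powr (2 - 2 * s) * J1"
      unfolding e1_def J1_def by (rule integrable_riesz_kernel_ball(2)) (use s r in auto)
    have v2: "kernel_integral s e2 = (r / 4) powr (0 - 2 * s) * J2"
      unfolding e2_def J2_def by (rule integrable_riesz_kernel_compl_ball(2)) (use s r in auto)
    have v3: "1 * (4 * r) powr (- real CARD('n) - 2 * s) * (unit_ball_vol (real CARD('n)) * r ^ CARD('n)) \<le> kernel_integral s e3"
      by (rule riesz_kernel_integral_ball_lower[OF s(1) r _ i3, where c="c - x'"])
        (use bc r in \<open>force simp: e3_def simp del: mem_ball\<close>)+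
    have w3: "(4 * r) powr (- real CARD('n) - 2 * s) * (unit_ball_vol (real CARD('n)) * r ^ CARD('n)) = b * r powr (- 2 * s)"
    proof -
      have "r powr (- real CARD('n) - 2 * s) * r ^ CARD('n) = r powr (- real CARD('n) - 2 * s) * r powr real CARD('n)"
        using r by (simp add: powr_realpow)
      also have "\<dots> = r powr (- 2 * s)" unfolding powr_add[symmetric] by simp
      finally show ?thesis using r by (simp add: b_def powr_mult mult_ac)
    qed
    have w1: "8 * \<eta> / r\<^sup>2 * ((r / 4) powr (2 - 2 * s) * J1) = \<eta> * (8 * (1/4) powr (2 - 2 * s) * J1) * r powr (- 2 * s)"
    proof -
      have "(r / 4) powr (2 - 2 * s) = r powr (2 - 2 * s) * (1/4) powr (2 - 2 * s)"
        using r powr_mult[of r "1/4" "2 - 2 * s"] by simp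
      moreover have "r powr (2 - 2 * s) = r\<^sup>2 * r powr (- 2 * s)"
        using r powr_add[of r 2 "- 2 * s"] by simp
      ultimately show ?thesis using r by simp
    qed
    have w2: "2 * \<eta> * ((r / 4) powr (0 - 2 * s) * J2) = \<eta> * (2 * (1/4) powr (- 2 * s) * J2) * r powr (- 2 * s)"
      using r powr_mult[of r "1/4" "- 2 * s"] by simp
    have "kernel_integral s e =
       - (8 * \<eta> / r\<^sup>2) * kernel_integral s e1 - 2 * \<eta> * kernel_integral s e2 + m * kernel_integral s e3"
      unfolding eK using i1 i2 i3 by simp
    also have "\<dots> \<ge> - (\<eta> * S * r powr (- 2 * s)) + m * (b * r powr (- 2 * s))"
    proof -
      have "m * (b * r powr (- 2 * s)) \<le> m * kernel_integral s e3"
        using v3 m unfolding w3[symmetric] by (intro mult_left_mono) auto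
      moreover have "\<eta> * S * r powr (- 2 * s) = 8 * \<eta> / r\<^sup>2 * ((r / 4) powr (2 - 2 * s) * J1) + 2 * \<eta> * ((r / 4) powr (0 - 2 * s) * J2)"
        unfolding w1 w2 S_def by (simp add: algebra_simps)
      ultimately show ?thesis unfolding v1 v2 by simp
    qed
    finally have lowI: "(m * b - \<eta> * S) * r powr (- 2 * s) \<le> kernel_integral s e"
      by (simp add: algebra_simps)
    have pos: "0 \<le> kernel_integral s e"
      by (rule order_trans[OF _ lowI]) (use \<eta> in \<open>auto intro!: mult_nonneg_nonneg\<close>)
    have le: "e z \<le> second_diff f x' z" for z
    proof (cases "norm z < r / 4")
      case True
      have "e3 z = 0" using bc[of z] True r unfolding e3_def by (auto simp: indicator_def simp del: mem_ball)
      moreover have "e2 z = 0" "e1 z = (norm z)\<^sup>2" using True by (auto simp: e1_def e2_def)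
      ultimately have "e z = - (8 * \<eta> / r\<^sup>2) * (norm z)\<^sup>2" by (simp add: e_def)
      also have "\<dots> = P (x' + z) + P (x' - z) - 2 * P x'"
      proof -
        have "(norm (x' + z - x1))\<^sup>2 + (norm (x' - z - x1))\<^sup>2 = 2 * (norm (x' - x1))\<^sup>2 + 2 * (norm z)\<^sup>2"
          by (simp add: power2_norm_eq_inner inner_simps inner_commute algebra_simps)
        then have eq: "(norm (x' + z - x1))\<^sup>2 = 2 * (norm (x' - x1))\<^sup>2 + 2 * (norm z)\<^sup>2 - (norm (x' - z - x1))\<^sup>2"
          by linarith
        show ?thesis unfolding P_def eq using r by (simp add: field_simps)
      qed
      also have "\<dots> \<le> second_diff f x' z"
        using max[of "x' + z"] max[of "x' - z"] unfolding second_diff_def by linarith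
      finally show ?thesis .
    next
      case False
      then have "e z = - (2 * \<eta>) + m * e3 z" using r by (auto simp: e_def e1_def e2_def)
      moreover have "f (x' + z) \<le> m - m * e3 z"
      proof (cases "z \<in> ball (c - x') r")
        case True
        then have "x' + z \<in> ball c r" by (simp add: dist_norm norm_minus_commute algebra_simps)
        then have "f (x' + z) \<le> 0" using ext f0 by blast
        then show ?thesis using True by (simp add: e3_def)
      next
        case False
        then show ?thesis using fm by (simp add: e3_def)
      qed
      moreover have "f (x' - z) \<le> m" using fm by simp
      ultimately show ?thesis using fx' unfolding second_diff_def by linarith
    qed
    show "\<exists>x'. dist x1 x' < r / 2 \<and> 0 < f x' \<and> (\<exists>e. kernel_integrable s e \<and>
        0 \<le> kernel_integral s e \<and> (\<forall>z. e z \<le> second_diff f x' z))"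
      using dx' inte pos le fx' \<eta> m by (intro exI[of _ x'] conjI exI[of _ e]) auto
  qed
qed

text \<open>\<open>A\<close> makes \<open>A * barrier\<close> at least \<open>1\<close> where the
  defining function is at least \<open>q0\<close>, so \<open>v - A * barrier\<close> can be positive
  only in the thin annulus where the barrier is a strict supersolution. At the touching point
  supplied by \<open>no_positive_maximum\<close> the value of the equation for \<open>v\<close>
  would be at least \<open>2\<close>, by the choice \<open>4 / c\<close>.\<close>

lemma boundary_barrier_bound:
  assumes s: "0 < s" "s < 1" and \<rho>: "0 < \<rho>" "\<rho> \<le> 1 / 8"
  shows "\<exists>A>0. \<forall>(\<Omega> :: (real ^ 'n) set) x0 v p z0 y. normalized_solution s \<rho> \<Omega> x0 v \<longrightarrow>
    p \<in> ball x0 1 \<longrightarrow> dist z0 p = \<rho> \<longrightarrow> ball z0 \<rho> \<inter> \<Omega> = {} \<longrightarrow> v y \<le> A * barrier s \<rho> (y - z0)"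
proof -
  define c where "c = frac_laplacian_const CARD('n) s"
  have c: "0 < c" unfolding c_def by (rule frac_laplacian_const_pos[OF s])
  have "\<rho> \<le> 1 / 4" using \<rho> by simp
  from barrier_supersolution[OF s \<rho>(1) this, where 'n='n, of "4 / c"]
  obtain q0 where q0: "0 < q0" "q0 \<le> \<rho>\<^sup>2" and
    sup: "\<And>x::real^'n. 0 < (norm x)\<^sup>2 - \<rho>\<^sup>2 \<Longrightarrow> (norm x)\<^sup>2 - \<rho>\<^sup>2 < q0 \<Longrightarrow>
    (\<exists>h. kernel_integrable s h \<and> (\<forall>z. z \<noteq> 0 \<longrightarrow> h z \<le> second_diff (barrier s \<rho>) x z)
      \<and> 4 / c \<le> kernel_integral s h)" by blast
  have "\<rho>\<^sup>2 \<le> 1\<^sup>2" using \<rho> by (intro power_mono) auto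
  then have q01: "q0 \<le> 1" using q0 by simp
  define A where "A = 2 * q0 powr (- s)"
  have A1: "1 \<le> A"
  proof -
    have "1 powr (- s) \<le> q0 powr (- s)" using q0 q01 s by (intro powr_mono2') auto
    then show ?thesis by (simp add: A_def)
  qed
  obtain \<kappa> where \<kappa>: "0 < \<kappa>" "\<kappa> \<le> 1 / 2" and
    npm: "\<And>(f :: real ^ 'n \<Rightarrow> real) m x1 c r \<Omega>.
     0 < m \<Longrightarrow> 0 < r \<Longrightarrow> (\<forall>y. f y \<le> m) \<Longrightarrow> m - \<kappa> * m / 2 < f x1 \<Longrightarrow> continuous_on (cball x1 (r / 2)) f \<Longrightarrow>
     ball x1 r \<subseteq> \<Omega> \<Longrightarrow> (\<forall>y. y \<notin> \<Omega> \<longrightarrow> f y \<le> 0) \<Longrightarrow> ball c r \<inter> \<Omega> = {} \<Longrightarrow> dist c x1 \<le> 2 * r \<Longrightarrow>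
     \<exists>x'. dist x1 x' < r / 2 \<and> 0 < f x' \<and> (\<exists>e. kernel_integrable s e \<and>
        0 \<le> kernel_integral s e \<and> (\<forall>z. e z \<le> second_diff f x' z))"
    using no_positive_maximum[OF s, where 'n='n] by blast
  show ?thesis
  proof (intro exI[of _ A] conjI allI impI)
    show "0 < A" using A1 by simp
    fix \<Omega> :: "(real ^ 'n) set" and x0 v p z0 y
    assume N: "normalized_solution s \<rho> \<Omega> x0 v" and p: "p \<in> ball x0 1" and z0p: "dist z0 p = \<rho>"
      and ext: "ball z0 \<rho> \<inter> \<Omega> = {}"
    have op: "open \<Omega>" and v01: "\<And>x. 0 \<le> v x" "\<And>x. v x \<le> 1" and v0: "\<And>x. x \<notin> \<Omega> \<Longrightarrow> v x = 0"
      using N by (auto simp: normalized_solution_def)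
    define f where "f y = v y - A * barrier s \<rho> (y - z0)" for y
    have b0: "0 \<le> A * barrier s \<rho> (y - z0)" for y
      using A1 barrier_profile_bounds(1)[OF s(1)] by (auto simp: barrier_def)
    have f1: "f y \<le> 1" for y using v01(2)[of y] b0[of y] by (simp add: f_def)
    have f0: "f y \<le> 0" if "y \<notin> \<Omega>" for y using v0[OF that] b0[of y] by (simp add: f_def)
    have cext: "cball z0 \<rho> \<inter> \<Omega> = {}"
      using open_Int_closure_eq_empty[OF op, of "ball z0 \<rho>"] ext \<rho> by (auto simp: Int_commute)
    have annulus: "y \<in> \<Omega> \<and> 0 < (norm (y - z0))\<^sup>2 - \<rho>\<^sup>2 \<and> (norm (y - z0))\<^sup>2 - \<rho>\<^sup>2 < q0" if "0 < f y" for y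
    proof (intro conjI)
      show y: "y \<in> \<Omega>" using that f0[of y] by fastforce
      then have "\<rho> < norm (y - z0)" using cext by (force simp: dist_norm norm_minus_commute)
      then show "0 < (norm (y - z0))\<^sup>2 - \<rho>\<^sup>2" using \<rho> by (simp add: power_strict_mono)
      show "(norm (y - z0))\<^sup>2 - \<rho>\<^sup>2 < q0"
      proof (rule ccontr)
        assume "\<not> (norm (y - z0))\<^sup>2 - \<rho>\<^sup>2 < q0"
        then have "q0 powr s / 2 \<le> barrier s \<rho> (y - z0)"
          unfolding barrier_def using q0 q01 by (intro barrier_profile_bounds(4)[OF s(1)]) auto
        then have "A * (q0 powr s / 2) \<le> A * barrier s \<rho> (y - z0)" using A1 by (intro mult_left_mono) auto
        moreover have "A * (q0 powr s / 2) = 1" using q0 by (simp add: A_def powr_minus_divide)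
        ultimately show False using that v01(2)[of y] by (simp add: f_def)
      qed
    qed
    show "v y \<le> A * barrier s \<rho> (y - z0)"
    proof (rule ccontr)
      assume "\<not> v y \<le> A * barrier s \<rho> (y - z0)"
      then have fy: "0 < f y" by (simp add: f_def)
      define m where "m = (SUP y. f y)"
      have bdd: "bdd_above (range f)" using f1 by (intro bdd_aboveI[of _ 1]) auto
      have fm: "f y \<le> m" for y unfolding m_def by (rule cSUP_upper[OF _ bdd]) simp
      have m: "0 < m" using fy fm[of y] by linarith
      have km: "0 < \<kappa> * m" "\<kappa> * m \<le> m / 2" using \<kappa> m mult_right_mono[OF \<kappa>(2), of m] by auto
      then have "m - \<kappa> * m / 2 < (SUP y. f y)" unfolding m_def[symmetric] by linarith
      then have "\<exists>x\<in>UNIV. m - \<kappa> * m / 2 < f x"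
        by (subst (asm) less_cSUP_iff) (use bdd in auto)
      then obtain x1 where x1: "m - \<kappa> * m / 2 < f x1" by blast
      have fx1: "0 < f x1" using x1 km m by linarith
      note an1 = annulus[OF fx1]
      have "(norm (x1 - z0))\<^sup>2 < (2 * \<rho>)\<^sup>2" using an1 q0 zero_less_power[OF \<rho>(1), of 2] by (simp add: power_mult_distrib)
      then have x1z0: "norm (x1 - z0) < 2 * \<rho>" by (rule power2_less_imp_less) (use \<rho> in simp)
      have "z0 \<in> ball z0 \<rho>" using \<rho> by simp
      then have "z0 \<notin> \<Omega>" using ext by blast
      then have "\<Omega> \<noteq> UNIV" by blast
      then obtain q where q: "q \<in> frontier \<Omega>" "x1 \<noteq> q" "ball x1 (dist x1 q) \<subseteq> \<Omega>"
        using nearest_frontier_point[OF op conjunct1[OF an1]] by blast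
      define r where "r = dist x1 q"
      have r: "0 < r" using q by (simp add: r_def)
      have r\<rho>: "r \<le> \<rho>"
      proof -
        \<comment> \<open>The radial projection of \<open>x1\<close> to the exterior ball bounds the
          distance to the complement:
          \<open>r \<le> norm (x1 - z0) - \<rho> < \<rho>\<close>.\<close>
        define t where "t = z0 + (\<rho> / norm (x1 - z0)) *\<^sub>R (x1 - z0)"
        have nx: "\<rho> < norm (x1 - z0)" using an1 cext by (force simp: dist_norm norm_minus_commute)
        have "t \<in> cball z0 \<rho>" using nx \<rho> by (simp add: t_def dist_norm)
        then have "t \<notin> \<Omega>" using cext by blast
        then have "r \<le> dist x1 t" using q(3) by (force simp: r_def not_le[symmetric])
        also have "dist x1 t = norm (x1 - z0) - \<rho>"
        proof -
          have e: "x1 - t = (1 - \<rho> / norm (x1 - z0)) *\<^sub>R (x1 - z0)" by (simp add: t_def algebra_simps)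
          have "x1 \<noteq> z0" using nx \<rho> by auto
          then show ?thesis unfolding dist_norm e norm_scaleR using nx \<rho> by (simp add: abs_if field_simps)
        qed
        finally show ?thesis using x1z0 by linarith
      qed
      have dx0: "dist x0 x1 < 1 + 3 * \<rho>"
      proof -
        have "dist x0 x1 \<le> dist x0 p + dist p z0 + dist z0 x1"
          using dist_triangle[of x0 x1 p] dist_triangle[of p x1 z0] by linarith
        then show ?thesis using p z0p x1z0 by (simp add: dist_commute dist_norm norm_minus_commute)
      qed
      have "dist x0 q \<le> dist x0 x1 + r" unfolding r_def by (rule dist_triangle)
      then have "q \<in> ball x0 2" using dx0 r\<rho> \<rho> by simp
      then obtain zq where zq: "dist zq q = \<rho>" "ball zq \<rho> \<inter> \<Omega> = {}"
        using N q(1) unfolding normalized_solution_def by blast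
      \<comment> \<open>The exterior ball at \<open>q\<close> is shrunk to radius \<open>r\<close>
        while still touching at \<open>q\<close>, so that size and distance of a region where
        \<open>f \<le> 0\<close> are both comparable with \<open>r\<close>.\<close>
      define c' where "c' = q + (r / \<rho>) *\<^sub>R (zq - q)"
      have c'q: "dist c' q = r" using zq r \<rho> by (simp add: c'_def dist_norm)
      have "zq - c' = (1 - r / \<rho>) *\<^sub>R (zq - q)" by (simp add: c'_def algebra_simps)
      then have "dist zq c' = (1 - r / \<rho>) * \<rho>" using zq r r\<rho> \<rho> unfolding dist_norm by simp
      then have c'z: "dist zq c' = \<rho> - r" using \<rho> by (simp add: left_diff_distrib)
      have "ball c' r \<subseteq> ball zq \<rho>" using c'z by (subst ball_subset_ball_iff) (simp add: dist_commute)
      then have ext': "ball c' r \<inter> \<Omega> = {}" using zq by blast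
      have c'x: "dist c' x1 \<le> 2 * r" using dist_triangle[of c' x1 q] c'q by (simp add: r_def dist_commute)
      have in2: "x \<in> \<Omega> \<inter> ball x0 2" if "dist x1 x \<le> r / 2" for x
      proof -
        have "dist x0 x \<le> dist x0 x1 + dist x1 x" by (rule dist_triangle)
        then have "dist x0 x < 2" using that dx0 r\<rho> \<rho> by linarith
        moreover have "x \<in> ball x1 r" using that r by simp
        ultimately show ?thesis using q(3) by (auto simp: r_def)
      qed
      have "continuous_on (cball x1 (r / 2)) v"
        using N in2 unfolding normalized_solution_def by (intro continuous_at_imp_continuous_on) auto
      then have cf: "continuous_on (cball x1 (r / 2)) f"
        unfolding f_def by (intro continuous_intros continuous_on_barrier s(1))
      obtain x' e where x': "dist x1 x' < r / 2" "0 < f x'" and inte: "kernel_integrable s e"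
        and epos: "0 \<le> kernel_integral s e" and ele: "\<And>z. e z \<le> second_diff f x' z"
        using npm[OF m r allI[OF fm] x1 cf q(3)[folded r_def] _ ext' c'x] f0 by blast
      obtain h where inth: "kernel_integrable s h"
        and hle: "\<And>z. z \<noteq> 0 \<Longrightarrow> h z \<le> second_diff (barrier s \<rho>) (x' - z0) z"
        and hI: "4 / c \<le> kernel_integral s h"
        using sup[of "x' - z0"] annulus[OF x'(2)] by blast
      obtain l where l: "\<bar>l\<bar> \<le> 1" "pv_limit s (second_diff v x') l"
        using N in2[of x'] x'(1) unfolding normalized_solution_def by force
      have sd: "second_diff v x' z = A * second_diff (barrier s \<rho>) (x' - z0) z + second_diff f x' z" for z
        by (simp add: second_diff_def f_def algebra_simps)
      have HK: "(A * h z + e z) * riesz_kernel s z = A * (h z * riesz_kernel s z) + e z * riesz_kernel s z" for z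
        by (simp add: algebra_simps)
      have "c / 2 * (\<integral>z. (A * h z + e z) * riesz_kernel s z \<partial>lebesgue) \<le> l"
        unfolding c_def
      proof (rule pv_limit_lower[OF s l(2)])
        show "integrable lebesgue (\<lambda>z. (A * h z + e z) * riesz_kernel s z)"
          unfolding HK using inth inte by (intro Bochner_Integration.integrable_add integrable_mult_right)
        show "A * h z + e z \<le> second_diff v x' z" if "z \<noteq> 0" for z
          unfolding sd using hle[OF that] ele[of z] A1 by (intro add_mono mult_left_mono) auto
      qed
      moreover have "(\<integral>z. (A * h z + e z) * riesz_kernel s z \<partial>lebesgue)
         = A * kernel_integral s h + kernel_integral s e"
        unfolding HK using inth inte by simp
      moreover have "1 * (4 / c) \<le> A * kernel_integral s h"
        using A1 hI c by (intro mult_mono) auto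
      ultimately have "c / 2 * (4 / c) \<le> l"
        using epos c by (smt (verit) half_gt_zero mult_left_mono mult_1)
      then show False using l c by simp
    qed
  qed
qed

text \<open>The segment from \<open>x\<close> to \<open>p\<close> meets the boundary at a point
  \<open>p'\<close> no farther from \<open>x\<close>, and the defining function of the exterior ball
  at \<open>p'\<close> is at most \<open>3 * dist x p'\<close>, because
  \<open>dist x p' \<le> 2\<close> and \<rho> is small.\<close>

lemma boundary_growth:
  assumes s: "0 < s" "s < 1" and \<rho>: "0 < \<rho>" "\<rho> \<le> 1 / 8"
  shows "\<exists>C>0. \<forall>(\<Omega> :: (real ^ 'n) set) x0 v x p. normalized_solution s \<rho> \<Omega> x0 v \<longrightarrow>
    p \<in> ball x0 1 - \<Omega> \<longrightarrow> x \<in> ball x0 1 \<longrightarrow> v x \<le> C * dist x p powr s"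
proof -
  obtain A where A: "0 < A" and bd: "\<And>(\<Omega> :: (real ^ 'n) set) x0 v p z0 y. normalized_solution s \<rho> \<Omega> x0 v \<Longrightarrow>
    p \<in> ball x0 1 \<Longrightarrow> dist z0 p = \<rho> \<Longrightarrow> ball z0 \<rho> \<inter> \<Omega> = {} \<Longrightarrow> v y \<le> A * barrier s \<rho> (y - z0)"
    using boundary_barrier_bound[OF s \<rho>, where 'n='n] by metis
  show ?thesis
  proof (intro exI[of _ "A * 3 powr s"] conjI allI impI)
    show "0 < A * 3 powr s" using A by simp
    fix \<Omega> :: "(real ^ 'n) set" and x0 v x p
    assume N: "normalized_solution s \<rho> \<Omega> x0 v" and p: "p \<in> ball x0 1 - \<Omega>" and x: "x \<in> ball x0 1"
    show "v x \<le> A * 3 powr s * dist x p powr s"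
    proof (cases "x \<in> \<Omega>")
      case False
      then show ?thesis using N A by (simp add: normalized_solution_def)
    next
      case True
      have "closed_segment x p \<inter> frontier \<Omega> \<noteq> {}"
        by (rule connected_Int_frontier) (use True p in auto)
      then obtain p' where p': "p' \<in> closed_segment x p" "p' \<in> frontier \<Omega>" by blast
      have p'1: "p' \<in> ball x0 1"
        using p'(1) x p closed_segment_subset[of x "ball x0 1" p] by auto
      then have "p' \<in> ball x0 2" by simp
      then obtain z0 where z0: "dist z0 p' = \<rho>" "ball z0 \<rho> \<inter> \<Omega> = {}"
        using N p'(2) unfolding normalized_solution_def by blast
      have dp: "dist x p' \<le> dist x p" using p'(1) by (metis dist_in_closed_segment dist_commute)
      have d2: "dist x p' \<le> 2" using dist_triangle[of x p' x0] x p'1 by (simp add: dist_commute)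
      have "norm (x - z0) \<le> dist x p' + \<rho>" using dist_triangle[of x z0 p'] z0 by (simp add: dist_norm norm_minus_commute)
      then have "(norm (x - z0))\<^sup>2 \<le> (dist x p' + \<rho>)\<^sup>2" by (intro power_mono) auto
      also have "\<dots> = dist x p' * (dist x p' + 2 * \<rho>) + \<rho>\<^sup>2" by (simp add: power2_eq_square algebra_simps)
      also have "\<dots> \<le> dist x p' * 3 + \<rho>\<^sup>2" using d2 \<rho> by (intro add_right_mono mult_left_mono) auto
      finally have Q: "(norm (x - z0))\<^sup>2 - \<rho>\<^sup>2 \<le> 3 * dist x p" using dp by simp
      have "v x \<le> A * barrier s \<rho> (x - z0)" by (rule bd[OF N p'1 z0])
      also have "\<dots> \<le> A * (max 0 ((norm (x - z0))\<^sup>2 - \<rho>\<^sup>2)) powr s"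
        unfolding barrier_def using A by (intro mult_left_mono barrier_profile_bounds(3) s(1)) auto
      also have "\<dots> \<le> A * (3 * dist x p) powr s"
        using A s Q by (intro mult_left_mono powr_mono2) auto
      finally show ?thesis by (simp add: powr_mult)
    qed
  qed
qed

section \<open>Doubling of variables\<close>

text \<open>Quantitative strict concavity of \<open>t powr s\<close>: the difference of both sides
  vanishes at \<open>0\<close> and is nondecreasing for \<open>t \<ge> 0\<close>; evenness gives the
  rest.\<close>

lemma second_diff_powr_lower:
  fixes t s :: real
  assumes s: "0 < s" "s < 1" and t: "\<bar>t\<bar> < 1"
  shows "s * (1 - s) / 2 * t\<^sup>2 \<le> 2 - (1 + t) powr s - (1 - t) powr s"
proof -
  have main: "s * (1 - s) / 2 * t\<^sup>2 \<le> 2 - (1 + t) powr s - (1 - t) powr s" if "0 \<le> t" "t < 1" for t :: real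
  proof -
    let ?f = "\<lambda>t. 2 - (1 + t) powr s - (1 - t) powr s - s * (1 - s) / 2 * t\<^sup>2"
    have "?f 0 \<le> ?f t"
    proof (rule DERIV_nonneg_imp_nondecreasing[OF that(1)])
      fix x assume "0 \<le> x" "x \<le> t"
      then have x: "0 \<le> x" "x < 1" using that by auto
      have d: "(?f has_real_derivative s * ((1 - x) powr (s - 1) - (1 + x) powr (s - 1) - (1 - s) * x)) (at x)"
        using x by (auto intro!: derivative_eq_intros simp: field_simps)
      have "(1 + x) powr (s - 1) \<le> 1 powr (s - 1)" using x s by (intro powr_mono2') auto
      then have a: "(1 + x) powr (s - 1) \<le> 1" by simp
      \<comment> \<open>Bernoulli's inequality with exponent \<open>1 - s\<close>, inverted by means
        of \<open>(1 + y) * (1 - y) \<le> 1\<close>.\<close>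
      have b: "1 + (1 - s) * x \<le> (1 - x) powr (s - 1)"
      proof -
        have "(1 + (- x)) powr (1 - s) \<le> 1 + (1 - s) * (- x)"
          by (rule powr_bernoulli) (use x s in auto)
        then have "(1 - x) powr (1 - s) \<le> 1 - (1 - s) * x" by simp
        then have "(1 + (1 - s) * x) * (1 - x) powr (1 - s) \<le> (1 + (1 - s) * x) * (1 - (1 - s) * x)"
          using x s by (intro mult_left_mono) auto
        also have "\<dots> = 1 - ((1 - s) * x)\<^sup>2" by (simp add: power2_eq_square algebra_simps)
        also have "\<dots> \<le> 1" by simp
        finally have "(1 + (1 - s) * x) * (1 - x) powr (1 - s) * (1 - x) powr (s - 1) \<le> 1 * (1 - x) powr (s - 1)"
          by (intro mult_right_mono) auto
        then show ?thesis using x by (simp add: mult.assoc powr_add[symmetric])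
      qed
      have "0 \<le> s * ((1 - x) powr (s - 1) - (1 + x) powr (s - 1) - (1 - s) * x)"
        using a b s by (intro mult_nonneg_nonneg) auto
      with d show "\<exists>y. (?f has_real_derivative y) (at x) \<and> 0 \<le> y" by blast
    qed
    then show ?thesis by simp
  qed
  show ?thesis
  proof (cases "0 \<le> t")
    case True then show ?thesis using main[of t] t by simp
  next
    case False then show ?thesis using main[of "- t"] t by (simp add: algebra_simps)
  qed
qed

lemma second_diff_powr_lower_scaled:
  fixes r \<tau> s :: real
  assumes s: "0 < s" "s < 1" and r: "\<bar>\<tau>\<bar> < r"
  shows "s * (1 - s) / 2 * r powr (s - 2) * \<tau>\<^sup>2 \<le> 2 * r powr s - (r + \<tau>) powr s - (r - \<tau>) powr s"
proof -
  have r0: "0 < r" using r by linarith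
  have t: "\<bar>\<tau> / r\<bar> < 1" using r r0 by (simp add: field_simps abs_if split: if_splits)
  have e: "r + \<tau> = r * (1 + \<tau> / r)" "r - \<tau> = r * (1 - \<tau> / r)" using r0 by (auto simp: field_simps)
  have nn: "0 \<le> 1 + \<tau> / r" "0 \<le> 1 - \<tau> / r" using t by (auto simp: abs_if split: if_splits)
  have "r powr s * (s * (1 - s) / 2 * (\<tau> / r)\<^sup>2) \<le> r powr s * (2 - (1 + \<tau> / r) powr s - (1 - \<tau> / r) powr s)"
    by (intro mult_left_mono second_diff_powr_lower s t) auto
  also have "\<dots> = 2 * r powr s - (r + \<tau>) powr s - (r - \<tau>) powr s"
    using powr_mult[of r "1 + \<tau> / r" s] powr_mult[of r "1 - \<tau> / r" s] nn r0
    unfolding e[symmetric] by (simp add: right_diff_distrib)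
  also have "r powr s * (s * (1 - s) / 2 * (\<tau> / r)\<^sup>2) = s * (1 - s) / 2 * r powr (s - 2) * \<tau>\<^sup>2"
    using r0 by (simp add: powr_diff power_divide)
  finally show ?thesis .
qed

text \<open>Outside \<Omega> the growth estimate squeezes \<open>v\<close> to \<open>0\<close>.
  Continuity across the boundary lets the doubled function attain its maximum on a compact
  set.\<close>

lemma normalized_solution_continuous:
  fixes v :: "real ^ 'n \<Rightarrow> real"
  assumes s: "0 < s" and N: "normalized_solution s \<rho> \<Omega> x0 v"
    and growth: "\<And>x p. p \<in> ball x0 1 - \<Omega> \<Longrightarrow> x \<in> ball x0 1 \<Longrightarrow> v x \<le> C * dist x p powr s"
    and y: "y \<in> ball x0 1"
  shows "isCont v y"
proof (cases "y \<in> \<Omega>")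
  case True
  then show ?thesis using N y by (auto simp: normalized_solution_def)
next
  case False
  have vy: "v y = 0" using N False by (simp add: normalized_solution_def)
  have "(v \<longlongrightarrow> 0) (at y)"
  proof (rule tendsto_sandwich[of "\<lambda>_. 0" _ _ "\<lambda>x. C * dist x y powr s"])
    show "eventually (\<lambda>x. 0 \<le> v x) (at y)" using N by (simp add: normalized_solution_def)
    have "eventually (\<lambda>x. x \<in> ball x0 1) (at y)"
      using y by (intro eventually_at_in_open') auto
    then show "eventually (\<lambda>x. v x \<le> C * dist x y powr s) (at y)"
      by eventually_elim (use growth y False in auto)
    have "((\<lambda>x. dist x y) \<longlongrightarrow> 0) (at y)" by (rule tendsto_eq_intros refl | simp)+
    then show "((\<lambda>x. C * dist x y powr s) \<longlongrightarrow> 0) (at y)"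
      using s by (intro tendsto_mult_right_zero tendsto_zero_powrI[where b=s]) auto
  qed simp
  then show ?thesis by (simp add: isCont_def vy)
qed

text \<open>At a maximum point of \<open>v x - v y - L |x - y|\<^sup>s - 16 |x - x1|\<^sup>2\<close> the two
  equations are compared after coupling small jumps \<open>z\<close> at \<open>x\<close> with their mirror images at \<open>y\<close>. Strict concavity
  of \<open>t powr s\<close> then yields a gain of order \<open>L |x - y| powr (- s)\<close>.\<close>
lemma normalized_solution_holder:
  assumes s: "0 < s" "s < 1" and \<rho>: "0 < \<rho>" "\<rho> \<le> 1 / 8"
  shows "\<exists>L>0. \<forall>(\<Omega> :: (real ^ 'n) set) x0 v x y. normalized_solution s \<rho> \<Omega> x0 v \<longrightarrow>
    x \<in> ball x0 (1/2) \<longrightarrow> y \<in> ball x0 (1/2) \<longrightarrow> v x - v y \<le> L * dist x y powr s"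
proof -
  obtain C where C: "0 < C" and growth: "\<And>(\<Omega> :: (real ^ 'n) set) x0 v x p. normalized_solution s \<rho> \<Omega> x0 v \<Longrightarrow>
    p \<in> ball x0 1 - \<Omega> \<Longrightarrow> x \<in> ball x0 1 \<Longrightarrow> v x \<le> C * dist x p powr s"
    using boundary_growth[OF s \<rho>, where 'n='n] by blast
  define c where "c = frac_laplacian_const CARD('n) s"
  have c: "0 < c" unfolding c_def by (rule frac_laplacian_const_pos[OF s])
  define I1 where "I1 = kernel_integral s (\<lambda>z::real^'n. indicator (ball 0 (1/16)) z * norm z powr 2)"
  define I2 where "I2 = kernel_integral s (\<lambda>z::real^'n. indicator (- ball 0 (1/16)) z * norm z powr 0)"
  have I: "0 \<le> I1" "0 \<le> I2" unfolding I1_def I2_def by (auto intro!: Bochner_Integration.integral_nonneg)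
  \<comment> \<open>A lower bound, at distance \<open>\<alpha> = 1\<close>, for the integral of
    \<open>(z \<bullet> e)\<^sup>2\<close> against the kernel, taken from the ball of radius
    \<open>1/16\<close> about \<open>e / 8\<close>.\<close>
  define b1 where "b1 = (1/16)\<^sup>2 * (3/16) powr (- real CARD('n) - 2 * s) * (unit_ball_vol (real CARD('n)) * (1/16) ^ CARD('n))"
  have b1: "0 < b1" by (simp add: b1_def)
  define b2 where "b2 = 2 * s * (1 - s) * b1"
  have b2: "0 < b2" using b1 s by (simp add: b2_def)
  \<comment> \<open>\<open>16\<close> forces \<open>dist x y < 1/16\<close> at the maximum,
    \<open>C\<close> excludes a maximum with \<open>y\<close> outside \<Omega>, and the last term
    makes the coupling gain outweigh penalty, long jumps and right-hand sides.\<close>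
  define L where "L = 16 + C + (32 * I1 + 4 * I2 + 8 / c) / b2"
  have L: "16 \<le> L" "C \<le> L" "0 < L" "32 * I1 + 4 * I2 + 8 / c \<le> L * b2"
  proof -
    have "0 \<le> (32 * I1 + 4 * I2 + 8 / c) / b2" using I c b2 by simp
    then show "16 \<le> L" "C \<le> L" "0 < L" unfolding L_def using C by linarith+
    have "(32 * I1 + 4 * I2 + 8 / c) / b2 * b2 \<le> L * b2" using C b2 unfolding L_def by (intro mult_right_mono) auto
    then show "32 * I1 + 4 * I2 + 8 / c \<le> L * b2" using b2 by simp
  qed
  show ?thesis
  proof (intro exI[of _ L] conjI allI impI L(3))
    fix \<Omega> :: "(real ^ 'n) set" and x0 v x1 y1
    assume N: "normalized_solution s \<rho> \<Omega> x0 v" and x1: "x1 \<in> ball x0 (1/2)" and y1: "y1 \<in> ball x0 (1/2)"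
    have v01: "\<And>x. 0 \<le> v x" "\<And>x. v x \<le> 1" and v0: "\<And>x. x \<notin> \<Omega> \<Longrightarrow> v x = 0"
      using N by (auto simp: normalized_solution_def)
    show "v x1 - v y1 \<le> L * dist x1 y1 powr s"
    proof (rule ccontr)
      assume neg: "\<not> v x1 - v y1 \<le> L * dist x1 y1 powr s"
      \<comment> \<open>Failure of the estimate makes \<open>F\<close> positive at
        \<open>(x1, y1)\<close>. The penalty keeps the maximum within \<open>1/4\<close> of
        \<open>x1\<close>, because \<open>v\<close> oscillates by at most \<open>1\<close>.\<close>
      define F where "F = (\<lambda>(x, y). v x - v y - L * dist x y powr s - 16 * (norm (x - x1))\<^sup>2)"
      \<comment> \<open>Jumps shorter than \<open>1/16\<close> from \<open>x\<close>, within
        \<open>3/4\<close> of the centre, and from \<open>y\<close>, within \<open>13/16\<close>,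
        remain in this ball.\<close>
      let ?D = "cball x0 (7/8)"
      have cv: "continuous_on ?D v"
        by (intro continuous_at_imp_continuous_on ballI normalized_solution_continuous[OF s(1) N growth[OF N]]) auto
      have cF: "continuous_on (?D \<times> ?D) F"
        unfolding F_def case_prod_beta
        by (intro continuous_intros continuous_on_compose2[OF cv] continuous_on_powr') (use s in auto)
      have in0: "(x1, y1) \<in> ?D \<times> ?D" using x1 y1 by auto
      obtain P where P: "P \<in> ?D \<times> ?D" "\<And>Q. Q \<in> ?D \<times> ?D \<Longrightarrow> F Q \<le> F P"
        using continuous_attains_sup[OF compact_Times[OF compact_cball compact_cball] _ cF] in0 by blast
      obtain x y where xy: "P = (x, y)" by (cases P)
      have F0: "0 < F (x, y)"
      proof -
        have "0 < F (x1, y1)" using neg by (simp add: F_def)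
        also have "\<dots> \<le> F (x, y)" using P(2)[OF in0] xy by simp
        finally show ?thesis .
      qed
      have Fmax: "v x' - v y' - L * dist x' y' powr s - 16 * (norm (x' - x1))\<^sup>2 \<le> v x - v y - L * dist x y powr s - 16 * (norm (x - x1))\<^sup>2"
        if "x' \<in> ?D" "y' \<in> ?D" for x' y'
        using P(2)[of "(x', y')"] that xy by (simp add: F_def)
      have Fxy: "L * dist x y powr s + 16 * (norm (x - x1))\<^sup>2 < v x - v y" using F0 by (simp add: F_def)
      have xx1: "norm (x - x1) < 1 / 4"
      proof -
        have "0 \<le> L * dist x y powr s" using L by simp
        then have "16 * (norm (x - x1))\<^sup>2 < 1" using Fxy v01(2)[of x] v01(1)[of y] by linarith
        then have "(norm (x - x1))\<^sup>2 < (1/4)\<^sup>2" by (simp add: power2_eq_square)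
        then show ?thesis by (rule power2_less_imp_less) simp
      qed
      have dx: "dist x0 x < 3 / 4"
        using dist_triangle[of x0 x x1] x1 xx1 by (simp add: dist_norm norm_minus_commute)
      define \<alpha> where "\<alpha> = dist x y"
      have \<alpha>16: "\<alpha> < 1 / 16"
      proof (rule ccontr)
        assume "\<not> \<alpha> < 1 / 16"
        then have "(1/16) powr 1 \<le> (1/16::real) powr s" "(1/16) powr s \<le> \<alpha> powr s"
          using s by (intro powr_mono' powr_mono2; simp)+
        then have "16 * (1/16) \<le> L * \<alpha> powr s" using L by (intro mult_mono) auto
        moreover have "0 \<le> 16 * (norm (x - x1))\<^sup>2" by simp
        ultimately show False using Fxy v01(2)[of x] v01(1)[of y] unfolding \<alpha>_def by linarith
      qed
      have \<alpha>0: "0 < \<alpha>"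
      proof (rule ccontr)
        assume "\<not> 0 < \<alpha>"
        then have "x = y" by (simp add: \<alpha>_def)
        then show False using Fxy by simp
      qed
      have dy: "dist x0 y < 13 / 16"
        using dist_triangle[of x0 y x] dx \<alpha>16 by (simp add: \<alpha>_def dist_commute)
      have nn16: "0 \<le> 16 * (norm (x - x1))\<^sup>2" by simp
      have x\<Omega>: "x \<in> \<Omega>"
      proof (rule ccontr)
        assume "x \<notin> \<Omega>"
        moreover have "0 \<le> L * dist x y powr s" using L by simp
        ultimately show False using Fxy v0[of x] v01(1)[of y] nn16 by linarith
      qed
      have y\<Omega>: "y \<in> \<Omega>"
      proof (rule ccontr)
        assume "y \<notin> \<Omega>"
        then have "v x \<le> C * dist x y powr s" using growth[OF N, of y x] dx dy by auto
        also have "\<dots> \<le> L * dist x y powr s" using L by (intro mult_right_mono) auto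
        finally show False using Fxy v01(1)[of y] nn16 by linarith
      qed
      obtain lx where lx: "\<bar>lx\<bar> \<le> 1" "pv_limit s (second_diff v x) lx"
        using N x\<Omega> dx unfolding normalized_solution_def by force
      obtain ly where ly: "\<bar>ly\<bar> \<le> 1" "pv_limit s (second_diff v y) ly"
        using N y\<Omega> dy unfolding normalized_solution_def by force
      define e where "e = (1 / \<alpha>) *\<^sub>R (x - y)"
      have e: "norm e = 1" using \<alpha>0 by (simp add: e_def \<alpha>_def dist_norm)
      have ee: "e \<bullet> e = 1" using e by (simp add: dot_square_norm)
      have xye: "x - y = \<alpha> *\<^sub>R e" using \<alpha>0 by (simp add: e_def)
      \<comment> \<open>With this radius \<open>2 * (z \<bullet> e)\<close> stays below \<alpha> in
        size, so coupled jumps never interchange the two points along \<open>e\<close>.\<close>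
      define r where "r = \<alpha> / 4"
      have r: "0 < r" "r < 1 / 16" using \<alpha>0 \<alpha>16 by (auto simp: r_def)
      define D where "D z = second_diff v x z - (if norm z < r then second_diff v y (reflect e z) else second_diff v y z)" for z
      have pvD: "pv_limit s D (lx - ly)"
        unfolding D_def by (rule pv_limit_diff_reflect[OF lx(2) ly(2) e])
      define e1 where "e1 z = indicator (ball 0 r) z * (z \<bullet> e)\<^sup>2" for z
      define e2 where "e2 z = indicator (ball 0 (1/16)) z * norm z powr 2" for z :: "real ^ 'n"
      define e3 where "e3 z = indicator (- ball 0 (1/16)) z * norm z powr 0" for z :: "real ^ 'n"
      \<comment> \<open>The concavity constant \<open>s * (1 - s) / 2\<close> times the factor
        \<open>4\<close> from \<open>(2 * (z \<bullet> e))\<^sup>2\<close>.\<close>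
      define g where "g = L * (2 * s * (1 - s) * \<alpha> powr (s - 2))"
      have g: "0 \<le> g" using L s by (simp add: g_def)
      \<comment> \<open>\<open>32\<close> comes from the second difference of the penalty;
        \<open>4\<close> bounds the difference of two second differences of a function with values
        in \<open>[0, 1]\<close>.\<close>
      define h where "h z = g * e1 z - 32 * e2 z - 4 * e3 z" for z
      have i1: "kernel_integrable s e1"
      proof (rule integrable_riesz_kernelI[where r=r and p=2 and q=0 and A=1 and B=0])
        have "e1 \<in> borel_measurable lborel"
          unfolding e1_def by (intro borel_measurable_times borel_measurable_indicator borel_measurable_power borel_measurable_inner) auto
        then show "e1 \<in> borel_measurable lebesgue" by (rule measurable_completion)
        fix z :: "real ^ 'n"
        show "\<bar>e1 z\<bar> \<le> 0 * norm z powr 0" if "r \<le> norm z" using that by (simp add: e1_def)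
        assume "z \<noteq> 0" "norm z < r"
        have "\<bar>z \<bullet> e\<bar>\<^sup>2 \<le> (norm z)\<^sup>2"
          using Cauchy_Schwarz_ineq2[of z e] e by (intro power_mono) auto
        then show "\<bar>e1 z\<bar> \<le> 1 * norm z powr 2" using \<open>z \<noteq> 0\<close> by (simp add: e1_def indicator_def)
      qed (use s r in auto)
      have i2: "kernel_integrable s e2"
        unfolding e2_def by (rule integrable_riesz_kernel_ball(1)) (use s in auto)
      have i3: "kernel_integrable s e3"
        unfolding e3_def by (rule integrable_riesz_kernel_compl_ball(1)) (use s in auto)
      have hK: "h z * riesz_kernel s z = g * (e1 z * riesz_kernel s z) - 32 * (e2 z * riesz_kernel s z) - 4 * (e3 z * riesz_kernel s z)" for z
        by (simp add: h_def algebra_simps)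
      have le: "h z \<le> D z" if z: "z \<noteq> 0" for z
      proof (cases "norm z < 1 / 16")
        case False
        then have "h z = - 4" using r z by (simp add: h_def e1_def e2_def e3_def)
        moreover have "- 2 \<le> second_diff v x z" using v01(1)[of x] v01(2)[of "x + z"] v01(2)[of "x - z"] by (simp add: second_diff_def)
        moreover have "second_diff v y z' \<le> 2" for z' using v01(2)[of y] v01(1)[of "y + z'"] v01(1)[of "y - z'"] by (simp add: second_diff_def)
        ultimately show ?thesis by (simp add: D_def) (smt (verit))
      next
        case True
        have par: "2 * (norm (x - x1))\<^sup>2 - (norm (x + z - x1))\<^sup>2 - (norm (x - z - x1))\<^sup>2 = - 2 * (norm z)\<^sup>2"
          by (simp add: power2_norm_eq_inner inner_simps inner_commute algebra_simps)
        have h2: "h z = g * e1 z - 32 * (norm z)\<^sup>2" using True z by (simp add: h_def e2_def e3_def)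
        have inD: "x + z' \<in> ?D" "y + z' \<in> ?D" "x - z' \<in> ?D" "y - z' \<in> ?D" if "norm z' = norm z" for z'
          using dist_triangle[of x0 "x + z'" x] dist_triangle[of x0 "y + z'" y] dist_triangle[of x0 "x - z'" x] dist_triangle[of x0 "y - z'" y]
            dx dy True that by (auto simp: dist_norm)
        show ?thesis
        proof (cases "norm z < r")
          case False
          \<comment> \<open>Jumps of medium length are taken equal at both points; this leaves
            \<open>x - y\<close> unchanged and only the penalty costs.\<close>
          have "h z = - 32 * (norm z)\<^sup>2" using False by (simp add: h2 e1_def)
          moreover have "- 32 * (norm z)\<^sup>2 \<le> second_diff v x z - second_diff v y z"
            using Fmax[OF inD(1,2)[of z]] Fmax[OF inD(3,4)[of z]] par
            by (simp add: second_diff_def dist_norm)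
          ultimately show ?thesis using False by (simp add: D_def)
        next
          case zr: True
          let ?R = "reflect e z" and ?t = "2 * (z \<bullet> e)"
          have nR: "norm ?R = norm z" by (rule norm_reflect[OF e])
          have ze: "\<bar>z \<bullet> e\<bar> \<le> norm z" using Cauchy_Schwarz_ineq2[of z e] e by simp
          have t\<alpha>: "\<bar>?t\<bar> < \<alpha>" using ze zr \<alpha>0 by (simp add: r_def abs_mult)
          have tpos: "0 \<le> \<alpha> + ?t" "0 \<le> \<alpha> - ?t" using t\<alpha> by (simp_all only: abs_less_iff) linarith+
          \<comment> \<open>The reflected jump changes \<open>x - y\<close> along \<open>e\<close>
            only, so the new distance is affine in \<open>z \<bullet> e\<close>.\<close>
          have "(x + z) - (y + ?R) = (\<alpha> + ?t) *\<^sub>R e"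
            using xye by (simp add: reflect_def algebra_simps)
          then have d1: "dist (x + z) (y + ?R) = \<alpha> + ?t" unfolding dist_norm using e tpos by simp
          have "(x - z) - (y - ?R) = (\<alpha> - ?t) *\<^sub>R e"
            using xye by (simp add: reflect_def algebra_simps)
          then have d2: "dist (x - z) (y - ?R) = \<alpha> - ?t" unfolding dist_norm using e tpos by simp
          have "s * (1 - s) / 2 * \<alpha> powr (s - 2) * ?t\<^sup>2 \<le> 2 * \<alpha> powr s - (\<alpha> + ?t) powr s - (\<alpha> - ?t) powr s"
            by (rule second_diff_powr_lower_scaled[OF s t\<alpha>])
          then have "L * (s * (1 - s) / 2 * \<alpha> powr (s - 2) * ?t\<^sup>2) \<le> L * (2 * \<alpha> powr s - (\<alpha> + ?t) powr s - (\<alpha> - ?t) powr s)"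
            using L by (intro mult_left_mono) auto
          moreover have "L * (s * (1 - s) / 2 * \<alpha> powr (s - 2) * ?t\<^sup>2) = g * e1 z"
            using zr by (simp add: g_def e1_def power_mult_distrib)
          ultimately have gain: "g * e1 z \<le> 2 * (L * \<alpha> powr s) - L * (\<alpha> + ?t) powr s - L * (\<alpha> - ?t) powr s"
            by (simp add: algebra_simps)
          have "2 * (L * \<alpha> powr s) - L * (\<alpha> + ?t) powr s - L * (\<alpha> - ?t) powr s - 32 * (norm z)\<^sup>2 \<le> second_diff v x z - second_diff v y ?R"
            using Fmax[OF inD(1)[OF refl] inD(2)[OF nR]] Fmax[OF inD(3)[OF refl] inD(4)[OF nR]] par
            unfolding d1 d2 \<alpha>_def[symmetric] second_diff_def by linarith
          then show ?thesis using gain zr by (simp add: D_def h2)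
        qed
      qed
      have v1: "b1 * \<alpha> powr (2 - 2 * s) \<le> kernel_integral s e1"
      proof -
        have "(\<alpha>/16)\<^sup>2 * (3 * \<alpha> / 16) powr (- real CARD('n) - 2 * s) * (unit_ball_vol (real CARD('n)) * (\<alpha> / 16) ^ CARD('n))
          \<le> kernel_integral s e1"
        proof (rule riesz_kernel_integral_ball_lower[OF s(1) _ _ i1, where c="(\<alpha>/8) *\<^sub>R e"])
          fix z assume "z \<in> ball ((\<alpha>/8) *\<^sub>R e) (\<alpha>/16)"
          then have z: "norm (z - (\<alpha>/8) *\<^sub>R e) < \<alpha> / 16" by (simp add: dist_norm norm_minus_commute)
          have "\<bar>(z - (\<alpha>/8) *\<^sub>R e) \<bullet> e\<bar> \<le> norm (z - (\<alpha>/8) *\<^sub>R e)"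
            using Cauchy_Schwarz_ineq2[of "z - (\<alpha>/8) *\<^sub>R e" e] e by simp
          then have "\<bar>z \<bullet> e - \<alpha> / 8\<bar> < \<alpha> / 16" using z ee by (simp add: inner_diff_left)
          then have ze: "\<alpha> / 16 \<le> z \<bullet> e" by (simp add: abs_if split: if_splits)
          have nz: "norm z \<le> 3 * \<alpha> / 16"
            using norm_triangle_ineq[of "z - (\<alpha>/8) *\<^sub>R e" "(\<alpha>/8) *\<^sub>R e"] z e \<alpha>0 by simp
          moreover have "0 < norm z" using ze \<alpha>0 by auto
          moreover have "(\<alpha>/16)\<^sup>2 \<le> (z \<bullet> e)\<^sup>2" using ze \<alpha>0 by (intro power_mono) auto
          moreover have "norm z < r" using nz \<alpha>0 by (simp add: r_def)
          ultimately show "(\<alpha>/16)\<^sup>2 \<le> e1 z \<and> 0 < norm z \<and> norm z \<le> 3 * \<alpha> / 16" by (simp add: e1_def)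
        qed (use \<alpha>0 in \<open>auto simp: e1_def\<close>)
        moreover have "(\<alpha>/16)\<^sup>2 * (3 * \<alpha> / 16) powr (- real CARD('n) - 2 * s) * (unit_ball_vol (real CARD('n)) * (\<alpha> / 16) ^ CARD('n)) = b1 * \<alpha> powr (2 - 2 * s)"
        proof -
          have a1: "(3 * \<alpha> / 16) powr (- real CARD('n) - 2 * s) = (3/16) powr (- real CARD('n) - 2 * s) * \<alpha> powr (- real CARD('n) - 2 * s)"
            using \<alpha>0 powr_mult[of "3/16" \<alpha> "- real CARD('n) - 2 * s"] by simp
          have a2: "(\<alpha> / 16) ^ CARD('n) = \<alpha> powr real CARD('n) * (1/16) ^ CARD('n)"
            using \<alpha>0 by (simp add: powr_realpow power_divide)
          have a3: "(\<alpha>/16)\<^sup>2 = \<alpha> powr 2 * (1/16)\<^sup>2" using \<alpha>0 by (simp add: power_divide)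
          have "\<alpha> powr 2 * \<alpha> powr (- real CARD('n) - 2 * s) * \<alpha> powr real CARD('n) = \<alpha> powr (2 - 2 * s)"
            unfolding powr_add[symmetric] by (rule arg_cong[where f="\<lambda>q. \<alpha> powr q"]) simp
          then show ?thesis unfolding a1 a2 a3 b1_def by (simp add: mult_ac)
        qed
        ultimately show ?thesis by simp
      qed
      have "c / 2 * kernel_integral s h \<le> lx - ly"
        unfolding c_def
      proof (rule pv_limit_lower[OF s pvD _ le])
        show "kernel_integrable s h"
          unfolding hK using i1 i2 i3 by (intro Bochner_Integration.integrable_diff integrable_mult_right)
      qed
      moreover have "kernel_integral s h = g * kernel_integral s e1 - 32 * I1 - 4 * I2"
        unfolding hK I1_def I2_def e2_def[symmetric] e3_def[symmetric] using i1 i2 i3 by simp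
      moreover have "L * b2 \<le> g * kernel_integral s e1"
      proof -
        have "1 \<le> \<alpha> powr (- s)"
          using \<alpha>0 \<alpha>16 s powr_mono2'[of "- s" \<alpha> 1] by simp
        then have "L * b2 * 1 \<le> L * b2 * \<alpha> powr (- s)" using L b2 by (intro mult_left_mono) auto
        also have "\<alpha> powr (- s) = \<alpha> powr (s - 2) * \<alpha> powr (2 - 2 * s)"
          unfolding powr_add[symmetric] by (rule arg_cong[where f="\<lambda>q. \<alpha> powr q"]) simp
        also have "L * b2 * (\<alpha> powr (s - 2) * \<alpha> powr (2 - 2 * s)) = g * (b1 * \<alpha> powr (2 - 2 * s))"
          by (simp add: g_def b2_def mult_ac)
        also have "\<dots> \<le> g * kernel_integral s e1"
          using v1 g by (intro mult_left_mono) auto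
        finally show ?thesis by simp
      qed
      \<comment> \<open>The left side is \<open>4\<close>, whereas two values of size at most
        \<open>1\<close> differ by at most \<open>2\<close>.\<close>
      ultimately have "c / 2 * (8 / c) \<le> lx - ly"
        using L(4) c by (smt (verit) half_gt_zero mult_left_mono)
      then show False using lx ly c by simp
    qed
  qed
qed

section \<open>Bounding the mass far away\<close>

text \<open>The paraboloid \<open>2 \<Lambda> (1 - |y - z0|\<^sup>2 / \<kappa>\<^sup>2)\<close>, shifted down, touches \<open>u\<close> from below at some point of the ball because \<open>u \<ge> 0\<close>
  everywhere; the equation at that point bounds the mass of \<open>u\<close> far away by local quantities.\<close>
lemma mass_bound_at_touching_point:
  fixes u :: "real ^ 'n \<Rightarrow> real"
  assumes s: "0 < s" "s < 1" and \<kappa>: "0 < \<kappa>" and \<Lambda>: "0 < \<Lambda>"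
    and pos: "\<And>x. 0 \<le> u x"
    and sol: "\<And>x. x \<in> cball z0 \<kappa> \<Longrightarrow> u x \<le> \<Lambda> \<and> isCont u x \<and> (\<exists>l. - \<Lambda> \<le> l \<and> has_frac_laplacian s u x l)"
  shows "\<exists>x\<in>cball z0 \<kappa>. integrable lebesgue (\<lambda>z. indicator (- ball 0 1) z * (u (x + z) * riesz_kernel s z)) \<and>
    (\<integral>z. indicator (- ball 0 1) z * (u (x + z) * riesz_kernel s z) \<partial>lebesgue)
     \<le> \<Lambda> * (1 / frac_laplacian_const CARD('n) s
        + 2 / \<kappa>\<^sup>2 * kernel_integral s (\<lambda>z::real^'n. indicator (ball 0 1) z * norm z powr 2)
        + kernel_integral s (\<lambda>z::real^'n. indicator (- ball 0 1) z * norm z powr 0))"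
proof -
  define c where "c = frac_laplacian_const CARD('n) s"
  have c: "0 < c" unfolding c_def by (rule frac_laplacian_const_pos[OF s])
  \<comment> \<open>The height \<open>2 * \<Lambda>\<close> exceeds
    \<open>u z0 \<le> \<Lambda>\<close>, so \<open>u - P\<close> is negative at the centre; outside
    the ball \<open>P \<le> 0 \<le> u\<close>, hence the minimum over the ball is global.\<close>
  define P where "P y = 2 * \<Lambda> * (1 - (norm (y - z0))\<^sup>2 / \<kappa>\<^sup>2)" for y
  have "continuous_on (cball z0 \<kappa>) (\<lambda>y. u y - P y)"
    unfolding P_def using sol \<kappa> by (intro continuous_intros continuous_at_imp_continuous_on) auto
  then obtain x where x: "x \<in> cball z0 \<kappa>" "\<And>y. y \<in> cball z0 \<kappa> \<Longrightarrow> u x - P x \<le> u y - P y"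
    using continuous_attains_inf[OF compact_cball, of z0 \<kappa> "\<lambda>y. u y - P y"] \<kappa> by (auto simp del: mem_cball)
  have "P z0 = 2 * \<Lambda>" by (simp add: P_def)
  then have neg: "u x - P x < 0" using x(2)[of z0] sol[of z0] \<kappa> \<Lambda> by auto
  have min: "u x - P x \<le> u y - P y" for y
  proof (cases "y \<in> cball z0 \<kappa>")
    case False
    then have "\<kappa>\<^sup>2 \<le> (norm (y - z0))\<^sup>2" using \<kappa> by (intro power_mono) (auto simp: dist_norm norm_minus_commute)
    then have "1 \<le> (norm (y - z0))\<^sup>2 / \<kappa>\<^sup>2" using \<kappa> by simp
    then have "P y \<le> 0" using \<Lambda> by (simp add: P_def mult_le_0_iff)
    then show ?thesis using neg pos[of y] by linarith
  qed (use x in auto)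
  obtain l where l: "- \<Lambda> \<le> l" "has_frac_laplacian s u x l" using sol[OF x(1)] by blast
  have ux: "u x \<le> \<Lambda>" using sol[OF x(1)] by blast
  define e1 where "e1 z = indicator (ball 0 1) z * norm z powr 2" for z :: "real ^ 'n"
  define e2 where "e2 z = indicator (- ball 0 1) z * norm z powr 0" for z :: "real ^ 'n"
  define G where "G z = indicator (- ball 0 1) z * (u (x + z) * riesz_kernel s z)" for z
  have i1: "kernel_integrable s e1"
    unfolding e1_def by (rule integrable_riesz_kernel_ball(1)) (use s in auto)
  have i2: "kernel_integrable s e2"
    unfolding e2_def by (rule integrable_riesz_kernel_compl_ball(1)) (use s in auto)
  have "integrable lebesgue (\<lambda>z. indicator (- ball 0 1) z * ((u x - u (x + z)) * riesz_kernel s z))"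
    by (rule has_frac_laplacian_integrable(1)[OF l(2)]) simp
  then have "integrable lebesgue (\<lambda>z. u x * (e2 z * riesz_kernel s z) - indicator (- ball 0 1) z * ((u x - u (x + z)) * riesz_kernel s z))"
    using i2 by (intro Bochner_Integration.integrable_diff integrable_mult_right)
  moreover have "u x * (e2 z * riesz_kernel s z) - indicator (- ball 0 1) z * ((u x - u (x + z)) * riesz_kernel s z) = G z" for z
    by (auto simp: e2_def G_def indicator_def algebra_simps)
  ultimately have iG: "integrable lebesgue G" by simp
  have iG': "integrable lebesgue (\<lambda>z. G (- z))"
    using lebesgue_preserving_integral(1)[OF lebesgue_preserving_uminus, of G] iG by auto
  have vG': "(\<integral>z. G (- z) \<partial>lebesgue) = (\<integral>z. G z \<partial>lebesgue)"
    using lebesgue_preserving_integral(2)[OF lebesgue_preserving_uminus, of G] iG by auto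
  \<comment> \<open>For long jumps \<open>u (x + z) + u (x - z)\<close> is kept with its sign
    instead of being estimated: the equation bounds precisely this mass.\<close>
  define h where "h z = 4 * \<Lambda> / \<kappa>\<^sup>2 * e1 z + 2 * \<Lambda> * e2 z - indicator (- ball 0 1) z * (u (x + z) + u (x - z))" for z
  have hK: "h z * riesz_kernel s z = 4 * \<Lambda> / \<kappa>\<^sup>2 * (e1 z * riesz_kernel s z) + 2 * \<Lambda> * (e2 z * riesz_kernel s z) - (G z + G (- z))" for z
    by (auto simp: h_def G_def indicator_def algebra_simps)
  have ih: "kernel_integrable s h"
    unfolding hK using i1 i2 iG iG' by (intro Bochner_Integration.integrable_add Bochner_Integration.integrable_diff integrable_mult_right)
  have "l \<le> c / 2 * kernel_integral s h"
    unfolding c_def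
  proof (rule pv_limit_upper[OF s has_frac_laplacian_imp_pv_limit[OF l(2)] ih])
    fix z :: "real ^ 'n" assume z: "z \<noteq> 0"
    show "second_diff u x z \<le> h z"
    proof (cases "norm z < 1")
      case True
      have par: "(norm (x + z - z0))\<^sup>2 + (norm (x - z - z0))\<^sup>2 - 2 * (norm (x - z0))\<^sup>2 = 2 * (norm z)\<^sup>2"
        by (simp add: power2_norm_eq_inner inner_simps inner_commute algebra_simps)
      have "2 * P x - P (x + z) - P (x - z) = 2 * \<Lambda> / \<kappa>\<^sup>2 * ((norm (x + z - z0))\<^sup>2 + (norm (x - z - z0))\<^sup>2 - 2 * (norm (x - z0))\<^sup>2)"
        using \<kappa> by (simp add: P_def field_simps)
      also have "\<dots> = 4 * \<Lambda> / \<kappa>\<^sup>2 * (norm z)\<^sup>2" unfolding par by simp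
      finally have "second_diff u x z \<le> 4 * \<Lambda> / \<kappa>\<^sup>2 * (norm z)\<^sup>2"
        using min[of "x + z"] min[of "x - z"] unfolding second_diff_def by linarith
      then show ?thesis using True z by (simp add: h_def e1_def e2_def)
    next
      case False
      then have "h z = 2 * \<Lambda> - (u (x + z) + u (x - z))" using z by (simp add: h_def e1_def e2_def)
      then show ?thesis using ux by (simp add: second_diff_def)
    qed
  qed
  moreover have "kernel_integral s h = 4 * \<Lambda> / \<kappa>\<^sup>2 * kernel_integral s e1
     + 2 * \<Lambda> * kernel_integral s e2 - 2 * (\<integral>z. G z \<partial>lebesgue)"
    unfolding hK using i1 i2 iG iG' vG' by simp
  ultimately have "- \<Lambda> \<le> c / 2 * (4 * \<Lambda> / \<kappa>\<^sup>2 * kernel_integral s e1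
     + 2 * \<Lambda> * kernel_integral s e2 - 2 * (\<integral>z. G z \<partial>lebesgue))" using l(1) by simp
  then have "c * (\<integral>z. G z \<partial>lebesgue) \<le> c * (\<Lambda> * (1 / c + 2 / \<kappa>\<^sup>2 * kernel_integral s e1 + kernel_integral s e2))"
    using c by (simp add: algebra_simps)
  then have "(\<integral>z. G z \<partial>lebesgue) \<le> \<Lambda> * (1 / c + 2 / \<kappa>\<^sup>2 * kernel_integral s e1 + kernel_integral s e2)"
    using c by simp
  then show ?thesis
    using x(1) iG unfolding G_def[abs_def] e1_def e2_def c_def by blast
qed

section \<open>Truncation far away and normalisation\<close>

lemma pv_limit_cmult:
  fixes D :: "real ^ 'n \<Rightarrow> real"
  assumes "pv_limit s D l" shows "pv_limit s (\<lambda>z. a * D z) (a * l)"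
proof -
  have eq: "indicator (cutoff i) z * (a * D z * riesz_kernel s z) = a * (indicator (cutoff i) z * (D z * riesz_kernel s z))" for i and z :: "real ^ 'n"
    by simp
  have "(\<lambda>i. a * (frac_laplacian_const CARD('n) s / 2 * (\<integral>z. indicator (cutoff i) z * (D z * riesz_kernel s z) \<partial>lebesgue))) \<longlonglongrightarrow> a * l"
    using assms by (intro tendsto_mult_left) (simp add: pv_limit_def)
  then show ?thesis
    using assms unfolding pv_limit_def eq by (simp add: mult_ac)
qed

text \<open>Beyond \<open>ball x0 3\<close> the distance to \<open>x\<close> is at least
  \<open>1\<close> while \<open>dist x x' < 3\<close>, so the distance to \<open>x'\<close> is at
  most \<open>4\<close> times the distance to \<open>x\<close>. The tail seen from the single
  touching point \<open>x'\<close> thus controls the tail seen from every \<open>x\<close>.\<close>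

lemma tail_comparison:
  fixes u :: "real ^ 'n \<Rightarrow> real"
  assumes s: "0 < s" and pos: "\<And>y. 0 \<le> u y"
    and x: "x \<in> ball x0 2" and x': "x' \<in> ball x0 1"
    and int: "integrable lebesgue (\<lambda>z. indicator (- ball 0 1) z * (u (x' + z) * riesz_kernel s z))"
  shows "integrable lebesgue (\<lambda>z. indicator (- ball x0 3) (x + z) * u (x + z) * riesz_kernel s z)"
    and "(\<integral>z. indicator (- ball x0 3) (x + z) * u (x + z) * riesz_kernel s z \<partial>lebesgue)
      \<le> 4 powr (real CARD('n) + 2 * s) * (\<integral>z. indicator (- ball 0 1) z * (u (x' + z) * riesz_kernel s z) \<partial>lebesgue)"
proof -
  define b where "b = (4::real) powr (real CARD('n) + 2 * s)"
  define G where "G z = indicator (- ball 0 1) z * (u (x' + z) * riesz_kernel s z)" for z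
  define H where "H z = indicator (- ball x0 3) (x + z) * u (x + z) * riesz_kernel s z" for z
  have G: "integrable lebesgue G" using int by (simp add: G_def[abs_def])
  have G0: "0 \<le> G z" for z using pos by (simp add: G_def)
  define d where "d = x - x'"
  have Gd: "integrable lebesgue (\<lambda>z. G (d + z))" and vGd: "(\<integral>z. G (d + z) \<partial>lebesgue) = (\<integral>z. G z \<partial>lebesgue)"
    using lebesgue_preserving_integral[OF lebesgue_preserving_plus[of d], of G] G by auto
  have far: "1 \<le> norm z" "1 \<le> norm (d + z)" "norm (d + z) \<le> 4 * norm z" if "x + z \<notin> ball x0 3" for z
  proof -
    have "3 \<le> dist x0 (x + z)" using that by simp
    moreover have "dist x0 (x + z) \<le> dist x0 x + norm z" using dist_triangle[of x0 "x + z" x] by (simp add: dist_norm)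
    moreover have "dist x0 (x + z) \<le> dist x0 x' + norm (d + z)" using dist_triangle[of x0 "x + z" x'] by (simp add: d_def dist_norm norm_minus_commute algebra_simps)
    moreover have "norm (d + z) \<le> dist x0 x + dist x0 x' + norm z"
      using norm_triangle_ineq[of d z] norm_triangle_ineq4[of "x - x0" "x' - x0"] by (simp add: d_def dist_norm norm_minus_commute)
    ultimately show "1 \<le> norm z" "1 \<le> norm (d + z)" "norm (d + z) \<le> 4 * norm z" using x x' by (simp_all add: dist_commute)
  qed
  have bound: "H z \<le> b * G (d + z)" for z
  proof (cases "x + z \<in> ball x0 3")
    case True
    then show ?thesis using G0[of "d + z"] by (simp add: H_def b_def)
  next
    case False
    note f = far[OF False]
    have "riesz_kernel s z \<le> b * riesz_kernel s (d + z)"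
    proof -
      have "norm z powr (- (real CARD('n) + 2 * s)) \<le> (norm (d + z) / 4) powr (- (real CARD('n) + 2 * s))"
        using f s by (intro powr_mono2') auto
      also have "\<dots> = b * norm (d + z) powr (- (real CARD('n) + 2 * s))"
        unfolding b_def using powr_divide[of "norm (d + z)" 4 "- (real CARD('n) + 2 * s)"]
        by (simp only: powr_minus norm_ge_zero) (simp add: field_simps)
      finally show ?thesis by (simp add: riesz_kernel_def)
    qed
    then have "u (x + z) * riesz_kernel s z \<le> u (x + z) * (b * riesz_kernel s (d + z))"
      using pos by (intro mult_left_mono) auto
    then show ?thesis using False f by (simp add: H_def G_def d_def algebra_simps)
  qed
  have H0: "0 \<le> H z" for z using pos by (simp add: H_def)
  have Hm: "H \<in> borel_measurable lebesgue"
  proof -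
    \<comment> \<open>Measurability of \<open>u\<close> far away is recovered from the integrable
      product by dividing out the kernel, which is positive off the origin.\<close>
    have Kinv: "(\<lambda>z::real^'n. norm z powr (real CARD('n) + 2 * s) * (G z)) \<in> borel_measurable lebesgue"
    proof -
      have "(\<lambda>z::real^'n. norm z powr (real CARD('n) + 2 * s)) \<in> borel_measurable lborel" by measurable
      then have "(\<lambda>z::real^'n. norm z powr (real CARD('n) + 2 * s)) \<in> borel_measurable lebesgue" by (rule measurable_completion)
      then show ?thesis using G by (intro borel_measurable_times) auto
    qed
    have "norm z powr (real CARD('n) + 2 * s) * G z = indicator (- ball 0 1) z * u (x' + z)" for z
    proof (cases "norm z < 1")
      case False
      then have "norm z powr (real CARD('n) + 2 * s) * riesz_kernel s z = 1"
        unfolding riesz_kernel_def powr_add[symmetric] by auto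
      then show ?thesis using False by (simp add: G_def)
    qed (simp add: G_def)
    then have "(\<lambda>z. indicator (- ball 0 1) z * u (x' + z)) \<in> borel_measurable lebesgue" using Kinv by simp
    then have A: "(\<lambda>z. indicator (- ball 0 1) (d + z) * u (x' + (d + z))) \<in> borel_measurable lebesgue"
      by (rule lebesgue_preserving_measurable[OF lebesgue_preserving_plus, of "\<lambda>z. indicator (- ball 0 1) z * u (x' + z)"])
    have ind: "(\<lambda>z. indicat_real (- ball (x0 - x) 3) z) \<in> borel_measurable lebesgue"
      by (intro borel_measurable_indicator) simp
    have eq: "H z = indicator (- ball (x0 - x) 3) z * (indicator (- ball 0 1) (d + z) * u (x' + (d + z))) * riesz_kernel s z" for z
    proof (cases "x + z \<in> ball x0 3")
      case True
      then have "z \<in> ball (x0 - x) 3" by (simp add: dist_norm algebra_simps)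
      then show ?thesis using True by (simp add: H_def)
    next
      case False
      then have "z \<notin> ball (x0 - x) 3" by (simp add: dist_norm algebra_simps)
      then show ?thesis using False far[OF False] by (simp add: H_def d_def algebra_simps)
    qed
    show ?thesis unfolding eq[abs_def] by (intro borel_measurable_times ind A riesz_kernel_measurable)
  qed
  have iH: "integrable lebesgue H"
  proof (rule Bochner_Integration.integrable_bound[OF integrable_mult_right[OF Gd, of b] Hm])
    show "AE z in lebesgue. norm (H z) \<le> norm (b * G (d + z))"
      using bound H0 by (auto intro: order_trans[OF _ abs_ge_self])
  qed
  then show "integrable lebesgue (\<lambda>z. indicator (- ball x0 3) (x + z) * u (x + z) * riesz_kernel s z)"
    by (simp add: H_def[abs_def])
  have "(\<integral>z. H z \<partial>lebesgue) \<le> (\<integral>z. b * G (d + z) \<partial>lebesgue)"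
    by (rule integral_mono[OF iH _ bound]) (use Gd in auto)
  then show "(\<integral>z. indicator (- ball x0 3) (x + z) * u (x + z) * riesz_kernel s z \<partial>lebesgue)
      \<le> 4 powr (real CARD('n) + 2 * s) * (\<integral>z. indicator (- ball 0 1) z * (u (x' + z) * riesz_kernel s z) \<partial>lebesgue)"
    using vGd by (simp add: H_def G_def b_def)
qed

abbreviation bounded_solution ::
  "real \<Rightarrow> (real ^ 'n) set \<Rightarrow> (real ^ 'n \<Rightarrow> real) \<Rightarrow> (real ^ 'n \<Rightarrow> real) \<Rightarrow> real \<Rightarrow> bool" where
  "bounded_solution s U g u \<Lambda> \<equiv>
     \<forall>x\<in>U. u x \<le> \<Lambda> \<and> isCont u x \<and> \<bar>g x\<bar> \<le> \<Lambda> \<and> has_frac_laplacian s u x (g x)"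

text \<open>Cutting \<open>u\<close> off outside \<open>ball x0 3\<close> changes the fractional
  Laplacian at points of \<Omega> in \<open>ball x0 2\<close> by \<open>c\<close> times a tail
  integral, at most \<open>c * T * \<Lambda>\<close>. Division by \<open>M * \<Lambda>\<close> with
  \<open>M = 1 + c * T\<close> normalises function and right-hand side together.\<close>

lemma normalized_truncation:
  assumes s: "0 < s" "s < 1" and \<kappa>: "0 < \<kappa>"
  shows "\<exists>M\<ge>1. \<forall>(\<Omega> :: (real ^ 'n) set) x0 u g \<Lambda> z0 \<rho>. 0 < \<Lambda> \<longrightarrow> open \<Omega> \<longrightarrow> (\<forall>x. 0 \<le> u x) \<longrightarrow>
    (\<forall>x\<in>ball x0 4 - \<Omega>. u x = 0) \<longrightarrow>
    bounded_solution s (\<Omega> \<inter> ball x0 4) g u \<Lambda> \<longrightarrow>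
    (\<forall>p\<in>frontier \<Omega> \<inter> ball x0 2. \<exists>z0. dist z0 p = \<rho> \<and> ball z0 \<rho> \<inter> \<Omega> = {}) \<longrightarrow>
    cball z0 \<kappa> \<subseteq> \<Omega> \<inter> ball x0 1 \<longrightarrow>
    normalized_solution s \<rho> \<Omega> x0 (\<lambda>y. (if y \<in> ball x0 3 then u y else 0) / (M * \<Lambda>))"
proof -
  define c where "c = frac_laplacian_const CARD('n) s"
  have c: "0 < c" unfolding c_def by (rule frac_laplacian_const_pos[OF s])
  define I1 where "I1 = kernel_integral s (\<lambda>z::real^'n. indicator (ball 0 1) z * norm z powr 2)"
  define I2 where "I2 = kernel_integral s (\<lambda>z::real^'n. indicator (- ball 0 1) z * norm z powr 0)"
  have I: "0 \<le> I1" "0 \<le> I2" unfolding I1_def I2_def by (auto intro!: Bochner_Integration.integral_nonneg)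
  define b where "b = (4::real) powr (real CARD('n) + 2 * s)"
  define T where "T = b * (1 / c + 2 / \<kappa>\<^sup>2 * I1 + I2)"
  have T: "0 \<le> T" using I c by (simp add: T_def b_def)
  define M where "M = 1 + c * T"
  have M: "1 \<le> M" using T c by (simp add: M_def)
  show ?thesis
  proof (intro exI[of _ M] conjI allI impI M)
    fix \<Omega> :: "(real ^ 'n) set" and x0 u g \<Lambda> z0 \<rho>
    assume \<Lambda>: "0 < \<Lambda>" and op: "open \<Omega>" and pos: "\<forall>x. 0 \<le> u x" and zero: "\<forall>x\<in>ball x0 4 - \<Omega>. u x = 0"
      and sol: "bounded_solution s (\<Omega> \<inter> ball x0 4) g u \<Lambda>"
      and ext: "\<forall>p\<in>frontier \<Omega> \<inter> ball x0 2. \<exists>z0. dist z0 p = \<rho> \<and> ball z0 \<rho> \<inter> \<Omega> = {}"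
      and cb: "cball z0 \<kappa> \<subseteq> \<Omega> \<inter> ball x0 1"
    have \<Lambda>M: "\<Lambda> \<le> M * \<Lambda>" "0 < M * \<Lambda>" using M \<Lambda> mult_right_mono[OF M, of \<Lambda>] by auto
    define v where "v y = (if y \<in> ball x0 3 then u y else 0) / (M * \<Lambda>)" for y
    have sol': "u x \<le> \<Lambda> \<and> isCont u x \<and> (\<exists>l. - \<Lambda> \<le> l \<and> has_frac_laplacian s u x l)" if "x \<in> cball z0 \<kappa>" for x
    proof -
      have "x \<in> \<Omega> \<inter> ball x0 4" using that cb by auto
      then have h: "u x \<le> \<Lambda>" "isCont u x" "\<bar>g x\<bar> \<le> \<Lambda>" "has_frac_laplacian s u x (g x)" using sol by auto
      moreover have "- \<Lambda> \<le> g x" using h(3) by linarith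
      ultimately show ?thesis by blast
    qed
    obtain x' where x': "x' \<in> cball z0 \<kappa>"
      and ix': "integrable lebesgue (\<lambda>z. indicator (- ball 0 1) z * (u (x' + z) * riesz_kernel s z))"
      and vx': "(\<integral>z. indicator (- ball 0 1) z * (u (x' + z) * riesz_kernel s z) \<partial>lebesgue) \<le> \<Lambda> * (1 / c + 2 / \<kappa>\<^sup>2 * I1 + I2)"
      using mass_bound_at_touching_point[OF s \<kappa> \<Lambda> _ sol'] pos unfolding c_def I1_def I2_def by blast
    have x'1: "x' \<in> ball x0 1" using x' cb by blast
    have "isCont v x \<and> (\<exists>l. \<bar>l\<bar> \<le> 1 \<and> pv_limit s (second_diff v x) l)" if x: "x \<in> \<Omega> \<inter> ball x0 2" for x
    proof (intro conjI)
      have x4: "x \<in> \<Omega> \<inter> ball x0 4" using x by auto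
      have "isCont (\<lambda>y. u y / (M * \<Lambda>)) x" using sol x4 \<Lambda>M by (intro continuous_intros) auto
      moreover have "eventually (\<lambda>y. u y / (M * \<Lambda>) = v y) (nhds x)"
      proof (rule eventually_mono)
        show "eventually (\<lambda>y. y \<in> ball x0 3) (nhds x)" using x by (intro eventually_nhds_in_open) auto
      qed (simp add: v_def)
      ultimately show "isCont v x" using isCont_cong[of "\<lambda>y. u y / (M * \<Lambda>)" v x] by blast
      \<comment> \<open>The removed part: before scaling, the second difference of the truncation is
        that of \<open>u\<close> plus \<open>G z + G (- z)\<close>.\<close>
      define G where "G z = indicator (- ball x0 3) (x + z) * u (x + z)" for z
      have x2: "x \<in> ball x0 2" using x by simp
      note tc = tail_comparison[OF s(1) _ x2 x'1 ix']
      have iG: "kernel_integrable s G"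
        and vG: "kernel_integral s G \<le> b * (\<Lambda> * (1 / c + 2 / \<kappa>\<^sup>2 * I1 + I2))"
      proof -
        show "kernel_integrable s G" unfolding G_def using tc(1) pos by blast
        have "kernel_integral s G \<le> b * (\<integral>z. indicator (- ball 0 1) z * (u (x' + z) * riesz_kernel s z) \<partial>lebesgue)"
          unfolding G_def b_def using tc(2) pos by blast
        also have "\<dots> \<le> b * (\<Lambda> * (1 / c + 2 / \<kappa>\<^sup>2 * I1 + I2))"
          using vx' by (intro mult_left_mono) (auto simp: b_def)
        finally show "kernel_integral s G \<le> b * (\<Lambda> * (1 / c + 2 / \<kappa>\<^sup>2 * I1 + I2))" .
      qed
      have G0: "0 \<le> kernel_integral s G"
        using pos by (intro Bochner_Integration.integral_nonneg) (auto simp: G_def)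
      have iG': "integrable lebesgue (\<lambda>z. G (- z) * riesz_kernel s z)"
        and vG': "(\<integral>z. G (- z) * riesz_kernel s z \<partial>lebesgue) = kernel_integral s G"
        using lebesgue_preserving_integral[OF lebesgue_preserving_uminus, of "\<lambda>z. G z * riesz_kernel s z"] iG by auto
      have GG: "(G z + G (- z)) * riesz_kernel s z = G z * riesz_kernel s z + G (- z) * riesz_kernel s z" for z
        by (simp add: algebra_simps)
      define l where "l = (g x + c * kernel_integral s G) / (M * \<Lambda>)"
      have pu: "pv_limit s (second_diff u x) (g x)"
        using sol x4 by (intro has_frac_laplacian_imp_pv_limit) auto
      have "pv_limit s (\<lambda>z. second_diff u x z + (G z + G (- z))) (g x + c / 2 * (\<integral>z. (G z + G (- z)) * riesz_kernel s z \<partial>lebesgue))"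
        unfolding c_def by (rule pv_limit_add[OF pu]) (use iG iG' GG in simp)
      also have "g x + c / 2 * (\<integral>z. (G z + G (- z)) * riesz_kernel s z \<partial>lebesgue) = g x + c * kernel_integral s G"
        unfolding GG using iG iG' vG' by simp
      finally have "pv_limit s (\<lambda>z. 1 / (M * \<Lambda>) * (second_diff u x z + (G z + G (- z)))) (1 / (M * \<Lambda>) * (g x + c * kernel_integral s G))"
        by (rule pv_limit_cmult)
      moreover have "1 / (M * \<Lambda>) * (second_diff u x z + (G z + G (- z))) = second_diff v x z" for z
      proof -
        have "u y / (M * \<Lambda>) - indicator (- ball x0 3) y * u y / (M * \<Lambda>) = v y" for y
          by (simp add: v_def)
        from this[of x] this[of "x + z"] this[of "x - z"] show ?thesis
          using x by (simp add: second_diff_def G_def add_divide_distrib diff_divide_distrib)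
      qed
      ultimately have "pv_limit s (second_diff v x) l" by (simp add: l_def)
      moreover have "\<bar>l\<bar> \<le> 1"
      proof -
        have "\<bar>g x\<bar> \<le> \<Lambda>" using sol x4 by auto
        moreover have "c * kernel_integral s G \<le> c * (b * (\<Lambda> * (1 / c + 2 / \<kappa>\<^sup>2 * I1 + I2)))"
          using vG c by (intro mult_left_mono) auto
        moreover have "\<Lambda> + c * (b * (\<Lambda> * (1 / c + 2 / \<kappa>\<^sup>2 * I1 + I2))) = M * \<Lambda>"
          by (simp add: M_def T_def algebra_simps)
        moreover have "0 \<le> c * kernel_integral s G" using c G0 by simp
        ultimately have "\<bar>g x + c * kernel_integral s G\<bar> \<le> M * \<Lambda>" by linarith
        then show ?thesis unfolding l_def using \<Lambda>M(2) by (simp add: abs_divide)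
      qed
      ultimately show "\<exists>l. \<bar>l\<bar> \<le> 1 \<and> pv_limit s (second_diff v x) l" by blast
    qed
    moreover have "0 \<le> v y \<and> v y \<le> 1" for y
    proof -
      have "u y \<le> M * \<Lambda>" if "y \<in> ball x0 3"
      proof (cases "y \<in> \<Omega>")
        case True
        then have "u y \<le> \<Lambda>" using that sol by auto
        then show ?thesis using \<Lambda>M by linarith
      next
        case False
        then have "u y = 0" using that zero by auto
        then show ?thesis using \<Lambda>M by linarith
      qed
      then show ?thesis using pos \<Lambda>M(2) by (simp add: v_def)
    qed
    moreover have "v y = 0" if "y \<notin> \<Omega>" for y
      using that zero by (auto simp: v_def)
    ultimately show "normalized_solution s \<rho> \<Omega> x0 (\<lambda>y. (if y \<in> ball x0 3 then u y else 0) / (M * \<Lambda>))"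
      unfolding normalized_solution_def v_def[symmetric, abs_def] using op ext by blast
  qed
qed

section \<open>Tangent balls of a \<open>C\<^sup>1\<^sup>,\<^sup>1\<close> boundary\<close>

lemma GDERIV_unique: "GDERIV f x :> D \<Longrightarrow> GDERIV f x :> E \<Longrightarrow> D = E"
  for f :: "'a::real_inner \<Rightarrow> real"
proof -
  assume "GDERIV f x :> D" "GDERIV f x :> E"
  then have "(\<lambda>h. h \<bullet> D) = (\<lambda>h. h \<bullet> E)"
    unfolding gderiv_def by (rule has_derivative_unique)
  then have "(D - E) \<bullet> D = (D - E) \<bullet> E" by meson
  then have "(D - E) \<bullet> (D - E) = 0" by (simp add: inner_diff_right)
  then show "D = E" by simp
qed

lemma gradient_eqI: "GDERIV f x :> D \<Longrightarrow> gradient f x = D"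
  for f :: "'a::real_inner \<Rightarrow> real"
  unfolding gradient_def by (rule the_equality) (auto intro: GDERIV_unique)

lemma differentiable_imp_GDERIV_gradient:
  fixes f :: "'a::euclidean_space \<Rightarrow> real"
  assumes "f differentiable (at x)"
  shows "GDERIV f x :> gradient f x"
proof -
  obtain f' where f': "(f has_derivative f') (at x)" using assms by (auto simp: differentiable_def)
  interpret f': linear f' using f' by (rule has_derivative_linear)
  define D where "D = (\<Sum>b\<in>Basis. f' b *\<^sub>R b)"
  have "f' h = h \<bullet> D" for h
  proof -
    have "f' h = f' (\<Sum>b\<in>Basis. (h \<bullet> b) *\<^sub>R b)" by (simp add: euclidean_representation)
    also have "\<dots> = (\<Sum>b\<in>Basis. (h \<bullet> b) * f' b)" by (simp add: f'.sum f'.scaleR)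
    also have "\<dots> = h \<bullet> D" by (simp add: D_def inner_sum_right mult.commute)
    finally show ?thesis .
  qed
  then have "f' = (\<lambda>h. h \<bullet> D)" by (rule ext)
  then have "GDERIV f x :> D" using f' unfolding gderiv_def by simp
  then show ?thesis using gradient_eqI by metis
qed

text \<open>Mean value inequality for \<open>f\<close> minus its tangent plane, whose gradient on
  the ball has norm at most \<open>M * norm h\<close>.\<close>

lemma gradient_lipschitz_taylor:
  fixes f :: "'a::euclidean_space \<Rightarrow> real"
  assumes diff: "\<And>y. y \<in> cball x (norm h) \<Longrightarrow> f differentiable (at y)"
    and lip: "\<And>y. y \<in> cball x (norm h) \<Longrightarrow> norm (gradient f y - gradient f x) \<le> M * norm (y - x)" and M: "0 \<le> M"
  shows "\<bar>f (x + h) - f x - gradient f x \<bullet> h\<bar> \<le> M * (norm h)\<^sup>2"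
proof -
  let ?b = "gradient f x"
  have "norm ((f (x + h) - ?b \<bullet> (x + h)) - (f x - ?b \<bullet> x)) \<le> (M * norm h) * norm (x + h - x)"
  proof (rule differentiable_bound[of "cball x (norm h)" "\<lambda>y. f y - ?b \<bullet> y" "\<lambda>y k. k \<bullet> (gradient f y - ?b)"])
    fix y assume y: "y \<in> cball x (norm h)"
    have "(f has_derivative (\<lambda>k. k \<bullet> gradient f y)) (at y)"
      using differentiable_imp_GDERIV_gradient[OF diff[OF y]] by (simp add: gderiv_def)
    then have "((\<lambda>y. f y - ?b \<bullet> y) has_derivative (\<lambda>k. k \<bullet> (gradient f y - ?b))) (at y)"
      by (auto intro!: derivative_eq_intros simp: inner_diff_right inner_commute)
    then show "((\<lambda>y. f y - ?b \<bullet> y) has_derivative (\<lambda>k. k \<bullet> (gradient f y - ?b))) (at y within cball x (norm h))"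
      by (rule has_derivative_at_withinI)
    show "onorm (\<lambda>k. k \<bullet> (gradient f y - ?b)) \<le> M * norm h"
    proof (rule onorm_le)
      fix k
      have "norm (k \<bullet> (gradient f y - ?b)) \<le> norm k * norm (gradient f y - ?b)" using Cauchy_Schwarz_ineq2 by simp
      also have "\<dots> \<le> norm k * (M * norm h)"
        using lip[OF y] y M by (intro mult_left_mono) (auto simp: dist_norm norm_minus_commute intro: order_trans[OF _ mult_left_mono])
      finally show "norm (k \<bullet> (gradient f y - ?b)) \<le> M * norm h * norm k" by (simp add: mult_ac)
    qed
  qed (auto simp: dist_norm)
  then show ?thesis by (simp add: power2_eq_square algebra_simps inner_add_right)
qed

lemma holder_norm_1_lipschitz:
  assumes "holder_norm 1 A f \<le> ennreal M" "0 \<le> M" "x \<in> A" "y \<in> A"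
  shows "norm (f x - f y) \<le> M * dist x y"
proof (cases "x = y")
  case False
  have "ennreal (norm (f x - f y) / dist x y powr 1) \<le> holder_seminorm 1 A f"
    unfolding holder_seminorm_def using assms(3,4) False by (intro SUP_upper2[where i="(x, y)"]) auto
  also have "\<dots> \<le> holder_norm 1 A f"
    unfolding holder_norm_def by (rule add_increasing) auto
  also have "\<dots> \<le> ennreal M" by (rule assms(1))
  finally show ?thesis using assms(2) False by (simp add: ennreal_le_iff field_simps)
qed simp

section \<open>Recentring graphs and uniform representations\<close>

lemma sup_norm_mono: "A \<subseteq> B \<Longrightarrow> sup_norm A f \<le> sup_norm B f"
  unfolding sup_norm_def by (rule SUP_subset_mono) auto

lemma holder_norm_mono: "A \<subseteq> B \<Longrightarrow> holder_norm \<alpha> A f \<le> holder_norm \<alpha> B f"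
  unfolding holder_norm_def holder_seminorm_def
  by (intro add_mono sup_norm_mono SUP_subset_mono) auto

lemma C11_graph_near_mono:
  fixes \<Omega> :: "'a::euclidean_space set"
  assumes "C11_graph_near \<Omega> p r M" "r' \<le> r" "M \<le> M'"
  shows "C11_graph_near \<Omega> p r' M'"
proof -
  obtain \<nu> \<phi> where h: "norm \<nu> = 1" "\<forall>y t. \<phi> (y + t *\<^sub>R \<nu>) = \<phi> y" "\<forall>y\<in>ball 0 r. \<phi> differentiable (at y)"
    "C11_norm (ball 0 r) \<phi> \<le> ennreal M" "\<Omega> \<inter> ball p r = {x \<in> ball p r. \<phi> (x - p) < (x - p) \<bullet> \<nu>}"
    using assms(1) unfolding C11_graph_near_def by blast
  have sub: "ball 0 r' \<subseteq> (ball 0 r :: 'a set)" "ball p r' \<subseteq> ball p r" using assms(2) by (auto intro: subset_ball)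
  have "C11_norm (ball 0 r') \<phi> \<le> C11_norm (ball 0 r) \<phi>"
    unfolding C11_norm_def by (rule add_mono[OF sup_norm_mono[OF sub(1)] holder_norm_mono[OF sub(1)]])
  also have "\<dots> \<le> ennreal M'" using h(4) assms(3) by (meson ennreal_leI order_trans)
  finally have "C11_norm (ball 0 r') \<phi> \<le> ennreal M'" .
  moreover have "\<Omega> \<inter> ball p r' = {x \<in> ball p r'. \<phi> (x - p) < (x - p) \<bullet> \<nu>}"
    using h(5) sub(2) by blast
  moreover have "\<forall>y\<in>ball 0 r'. \<phi> differentiable (at y)" using h(3) assms(2) by auto
  ultimately show ?thesis
    unfolding C11_graph_near_def using h(1,2) by blast
qed

text \<open>Recentring at \<open>q\<close> turns the graph function into
  \<open>\<phi> (y + d) - d \<bullet> \<nu>\<close>: the gradient is merely translated and the sup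
  norm grows by at most \<open>r\<close>.\<close>

lemma C11_graph_near_translate:
  fixes p q :: "'a::euclidean_space"
  assumes "C11_graph_near \<Omega> p r M" "dist p q < r / 2" "0 \<le> M"
  shows "C11_graph_near \<Omega> q (r / 2) (M + r)"
proof -
  obtain \<nu> \<phi> where h: "norm \<nu> = 1" "\<forall>y t. \<phi> (y + t *\<^sub>R \<nu>) = \<phi> y" "\<forall>y\<in>ball 0 r. \<phi> differentiable (at y)"
    "C11_norm (ball 0 r) \<phi> \<le> ennreal M" "\<Omega> \<inter> ball p r = {x \<in> ball p r. \<phi> (x - p) < (x - p) \<bullet> \<nu>}"
    using assms(1) unfolding C11_graph_near_def by blast
  have r: "0 < r" using assms(2) zero_le_dist[of p q] by linarith
  define d where "d = q - p"
  have d: "norm d < r / 2" using assms(2) by (simp add: d_def dist_norm norm_minus_commute)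
  have sh: "y + d \<in> ball 0 r" if "y \<in> ball 0 (r / 2)" for y
    using that d norm_triangle_ineq[of y d] by simp
  define \<psi> where "\<psi> y = \<phi> (y + d) - d \<bullet> \<nu>" for y
  have gd: "GDERIV \<psi> y :> gradient \<phi> (y + d)" if "y \<in> ball 0 (r / 2)" for y
  proof -
    have "(\<phi> has_derivative (\<lambda>h. h \<bullet> gradient \<phi> (y + d))) (at (y + d))"
      using differentiable_imp_GDERIV_gradient h(3) sh[OF that] unfolding gderiv_def by blast
    then have "((\<lambda>y. \<phi> (y + d)) has_derivative (\<lambda>h. h \<bullet> gradient \<phi> (y + d))) (at y)"
      by (rule has_derivative_compose[where f="\<lambda>y. y + d", rotated, simplified]) (auto intro!: derivative_eq_intros)
    then show ?thesis unfolding gderiv_def \<psi>_def by (auto intro!: derivative_eq_intros)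
  qed
  have gr: "gradient \<psi> y = gradient \<phi> (y + d)" if "y \<in> ball 0 (r / 2)" for y
    by (rule gradient_eqI[OF gd[OF that]])
  have dnu: "\<bar>d \<bullet> \<nu>\<bar> \<le> r" using Cauchy_Schwarz_ineq2[of d \<nu>] h(1) d r by simp
  have a1: "sup_norm (ball 0 (r / 2)) \<psi> \<le> sup_norm (ball 0 r) \<phi> + ennreal r"
    unfolding sup_norm_def
  proof (rule SUP_least)
    fix y :: 'a assume y: "y \<in> ball 0 (r / 2)"
    have "ennreal (norm (\<psi> y)) \<le> ennreal (norm (\<phi> (y + d)) + r)"
      using dnu by (intro ennreal_leI) (auto simp: \<psi>_def)
    also have "\<dots> = ennreal (norm (\<phi> (y + d))) + ennreal r" using r by (simp add: ennreal_plus)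
    also have "\<dots> \<le> (SUP x\<in>ball 0 r. ennreal (norm (\<phi> x))) + ennreal r"
      by (intro add_right_mono SUP_upper sh y)
    finally show "ennreal (norm (\<psi> y)) \<le> (SUP x\<in>ball 0 r. ennreal (norm (\<phi> x))) + ennreal r" .
  qed
  have a2: "holder_norm 1 (ball 0 (r / 2)) (gradient \<psi>) \<le> holder_norm 1 (ball 0 r) (gradient \<phi>)"
    unfolding holder_norm_def
  proof (rule add_mono)
    show "sup_norm (ball 0 (r / 2)) (gradient \<psi>) \<le> sup_norm (ball 0 r) (gradient \<phi>)"
      unfolding sup_norm_def by (rule SUP_least) (auto simp: gr intro!: SUP_upper2[OF sh])
    show "holder_seminorm 1 (ball 0 (r / 2)) (gradient \<psi>) \<le> holder_seminorm 1 (ball 0 r) (gradient \<phi>)"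
      unfolding holder_seminorm_def
    proof (rule SUP_least, clarify)
      fix x y :: 'a assume xy: "x \<in> ball 0 (r / 2)" "y \<in> ball 0 (r / 2)" "x \<noteq> y"
      show "ennreal (norm (gradient \<psi> x - gradient \<psi> y) / dist x y powr 1)
        \<le> (SUP (x, y)\<in>{(x, y). x \<in> ball 0 r \<and> y \<in> ball 0 r \<and> x \<noteq> y}. ennreal (norm (gradient \<phi> x - gradient \<phi> y) / dist x y powr 1))"
        using sh[OF xy(1)] sh[OF xy(2)] xy(3) gr[OF xy(1)] gr[OF xy(2)]
        by (intro SUP_upper2[where i="(x + d, y + d)"]) (auto simp: dist_norm simp del: mem_ball)
    qed
  qed
  have "C11_norm (ball 0 (r / 2)) \<psi> \<le> C11_norm (ball 0 r) \<phi> + ennreal r"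
    using add_mono[OF a1 a2] by (simp add: C11_norm_def add_ac)
  also have "\<dots> \<le> ennreal M + ennreal r" by (intro add_right_mono h(4))
  also have "\<dots> = ennreal (M + r)" using assms(3) r by (simp add: ennreal_plus)
  finally have "C11_norm (ball 0 (r / 2)) \<psi> \<le> ennreal (M + r)" .
  moreover have "\<Omega> \<inter> ball q (r / 2) = {x \<in> ball q (r / 2). \<psi> (x - q) < (x - q) \<bullet> \<nu>}"
  proof -
    have "x \<in> ball p r" if "x \<in> ball q (r / 2)" for x
      using that assms(2) dist_triangle[of p x q] by simp
    moreover have "\<psi> (x - q) < (x - q) \<bullet> \<nu> \<longleftrightarrow> \<phi> (x - p) < (x - p) \<bullet> \<nu>" for x
      by (simp add: \<psi>_def d_def inner_diff_left algebra_simps)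
    ultimately show ?thesis using h(5) by (auto simp: set_eq_iff)
  qed
  moreover have "\<psi> (y + t *\<^sub>R \<nu>) = \<psi> y" for y t
    using h(2)[rule_format, of "y + d" t] by (simp add: \<psi>_def add_ac)
  moreover have "\<psi> differentiable (at y)" if "y \<in> ball 0 (r / 2)" for y
    using gd[OF that] unfolding gderiv_def differentiable_def by blast
  ultimately show ?thesis
    unfolding C11_graph_near_def using h(1) by blast
qed

text \<open>A finite subcover of the boundary inside the closed ball, with one number dominating
  both graph norms and inverse radii. It shows that the infimum in \<open>C11_boundary_norm\<close>
  is finite.\<close>

lemma locally_C11_domain_uniform:
  fixes \<Omega> :: "'a::euclidean_space set"
  assumes "locally_C11_domain \<Omega>"
  shows "\<exists>M>0. \<forall>p\<in>frontier \<Omega> \<inter> ball x0 R. C11_graph_near \<Omega> p (1 / M) M"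
proof -
  let ?K = "frontier \<Omega> \<inter> cball x0 R"
  have "\<forall>p\<in>?K. \<exists>r M. 0 < r \<and> 0 \<le> M \<and> C11_graph_near \<Omega> p r M"
  proof
    fix p assume "p \<in> ?K"
    then obtain r M where "0 < r" "C11_graph_near \<Omega> p r M" using assms by (auto simp: locally_C11_domain_def)
    then have "0 < r \<and> 0 \<le> max M 0 \<and> C11_graph_near \<Omega> p r (max M 0)"
      using C11_graph_near_mono[of \<Omega> p r M r "max M 0"] by auto
    then show "\<exists>r M. 0 < r \<and> 0 \<le> M \<and> C11_graph_near \<Omega> p r M" by blast
  qed
  then obtain r M where rM: "\<And>p. p \<in> ?K \<Longrightarrow> 0 < r p \<and> 0 \<le> M p \<and> C11_graph_near \<Omega> p (r p) (M p)"
    by metis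
  have comp: "compact ?K" by (intro closed_Int_compact frontier_closed compact_cball)
  have cov: "?K \<subseteq> (\<Union>p\<in>?K. ball p (r p / 2))" using rM by force
  obtain F where F: "F \<subseteq> ?K" "finite F" "?K \<subseteq> (\<Union>p\<in>F. ball p (r p / 2))"
    by (rule compactE_image[OF comp _ cov]) auto
  define N where "N = 1 + (\<Sum>p\<in>F. M p + r p + 2 / r p)"
  have pos: "0 \<le> M p + r p + 2 / r p" if "p \<in> F" for p
  proof -
    have "0 < r p" "0 \<le> M p" using rM[OF subsetD[OF F(1) that]] by auto
    then show ?thesis by simp
  qed
  have N: "M p + r p + 2 / r p \<le> N" if "p \<in> F" for p
    unfolding N_def using member_le_sum[OF that, of "\<lambda>p. M p + r p + 2 / r p"] pos F(2) by force
  have N0: "0 < N" unfolding N_def using sum_nonneg[of F "\<lambda>p. M p + r p + 2 / r p"] pos by force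
  show ?thesis
  proof (intro exI[of _ N] conjI ballI N0)
    fix q assume "q \<in> frontier \<Omega> \<inter> ball x0 R"
    then have "q \<in> ?K" by auto
    then obtain p where p: "p \<in> F" "dist p q < r p / 2" using F(3) by auto
    have rp: "0 < r p" "0 \<le> M p" "C11_graph_near \<Omega> p (r p) (M p)" using rM[OF subsetD[OF F(1) p(1)]] by auto
    have le: "2 / r p \<le> N" "M p + r p \<le> N" using N[OF p(1)] rp by (smt (verit) divide_pos_pos)+
    have "1 / N \<le> r p / 2" using le(1) rp N0 by (simp add: field_simps)
    then show "C11_graph_near \<Omega> q (1 / N) N"
      using C11_graph_near_mono[OF C11_graph_near_translate[OF rp(3) p(2) rp(2)]] le(2) by blast
  qed
qed

text \<open>The infimum need not be attained; adding \<open>1\<close> leaves room for an admissible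
  value below, and monotonicity in radius and bound does the rest.\<close>

lemma C11_boundary_norm_graph:
  fixes \<Omega> :: "'a::euclidean_space set"
  assumes "locally_C11_domain \<Omega>" "p \<in> frontier \<Omega> \<inter> ball x0 R"
  defines "M \<equiv> enn2real (C11_boundary_norm \<Omega> (ball x0 R)) + 1"
  shows "C11_graph_near \<Omega> p (1 / M) M"
proof -
  let ?S = "{M. 0 < M \<and> (\<forall>p\<in>frontier \<Omega> \<inter> ball x0 R. C11_graph_near \<Omega> p (1 / M) M)}"
  let ?N = "C11_boundary_norm \<Omega> (ball x0 R)"
  obtain M0 where "M0 \<in> ?S" using locally_C11_domain_uniform[OF assms(1)] by blast
  then have "?N \<le> ennreal M0" unfolding C11_boundary_norm_def by (intro Inf_lower) auto
  then have fin: "?N < top" by (simp add: le_less_trans)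
  then have e: "ennreal (enn2real ?N) = ?N" by (simp add: less_top)
  have "?N < ennreal M" by (subst e[symmetric]) (simp add: M_def ennreal_less_iff)
  then obtain M1 where M1: "M1 \<in> ?S" "ennreal M1 < ennreal M"
    unfolding C11_boundary_norm_def Inf_less_iff by blast
  then have "M1 \<le> M" by (simp add: ennreal_less_iff)
  moreover have "1 / M \<le> 1 / M1" using M1 \<open>M1 \<le> M\<close> by (auto intro!: frac_le)
  ultimately show ?thesis using M1 assms(2) C11_graph_near_mono by blast
qed

text \<open>By Taylor expansion \<Omega> near \<open>p\<close> agrees with the half-space
  \<open>b \<bullet> h < h \<bullet> \<nu>\<close> up to an error
  \<open>M * (norm h)\<^sup>2\<close>. The normal \<open>w = b - \<nu>\<close> has length at least
  \<open>1\<close> because \<open>b\<close> is orthogonal to \<nu>, and inside a ball of radius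
  \<rho> tangent to the plane at \<open>p\<close> the error is smaller than the distance to the
  plane once \<open>2 * M * \<rho> \<le> 1\<close>.\<close>

lemma C11_graph_near_tangent_balls:
  fixes \<Omega> :: "'a::euclidean_space set"
  assumes op: "open \<Omega>" and p: "p \<in> frontier \<Omega>" and G: "C11_graph_near \<Omega> p r M" and M: "0 < M"
    and \<rho>: "0 < \<rho>" "2 * \<rho> \<le> r" "2 * M * \<rho> \<le> 1"
  shows "\<exists>n. norm n = 1 \<and> ball (p + \<rho> *\<^sub>R n) \<rho> \<inter> \<Omega> = {} \<and> ball (p - \<rho> *\<^sub>R n) \<rho> \<subseteq> \<Omega>"
proof -
  obtain \<nu> \<phi> where \<nu>: "norm \<nu> = 1" and inv: "\<And>y t. \<phi> (y + t *\<^sub>R \<nu>) = \<phi> y"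
    and diff: "\<And>y. y \<in> ball 0 r \<Longrightarrow> \<phi> differentiable (at y)"
    and nrm: "C11_norm (ball 0 r) \<phi> \<le> ennreal M" and eq: "\<Omega> \<inter> ball p r = {x \<in> ball p r. \<phi> (x - p) < (x - p) \<bullet> \<nu>}"
    using G unfolding C11_graph_near_def by blast
  have r: "0 < r" using \<rho> by linarith
  define b where "b = gradient \<phi> 0"
  have "holder_norm 1 (ball 0 r) (gradient \<phi>) \<le> ennreal M"
    by (rule order_trans[OF _ nrm]) (auto simp: C11_norm_def intro: add_increasing)
  then have lip: "norm (gradient \<phi> x - b) \<le> M * norm x" if x: "x \<in> ball 0 r" for x
    using holder_norm_1_lipschitz[of "ball 0 r" "gradient \<phi>" M x 0] x r M by (simp add: b_def)
  have taylor: "\<bar>\<phi> h - \<phi> 0 - b \<bullet> h\<bar> \<le> M * (norm h)\<^sup>2" if h: "h \<in> ball 0 r" for h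
    using gradient_lipschitz_taylor[of 0 h \<phi> M] lip diff h M by (auto simp: b_def)
  have p\<Omega>: "p \<notin> \<Omega>" using p op by (simp add: frontier_def interior_open)
  \<comment> \<open>A boundary point lies on the graph: a negative value would put \<open>p\<close>
    into the open set, a positive one would separate \<open>p\<close> from it by continuity.\<close>
  have \<phi>0: "\<phi> 0 = 0"
  proof (rule antisym)
    show "0 \<le> \<phi> 0"
    proof (rule ccontr)
      assume "\<not> 0 \<le> \<phi> 0"
      then have "p \<in> \<Omega> \<inter> ball p r" unfolding eq using r by simp
      then show False using p\<Omega> by blast
    qed
    show "\<phi> 0 \<le> 0"
    proof (rule ccontr)
      assume "\<not> \<phi> 0 \<le> 0"
      have "isCont \<phi> 0" using diff[of 0] r by (intro differentiable_imp_continuous_within) auto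
      then have "((\<lambda>h. \<phi> h - h \<bullet> \<nu>) \<longlongrightarrow> \<phi> 0 - 0 \<bullet> \<nu>) (at 0)"
        by (intro tendsto_intros) (auto simp: isCont_def)
      then have "eventually (\<lambda>h. 0 < \<phi> h - h \<bullet> \<nu>) (at 0)"
        using \<open>\<not> \<phi> 0 \<le> 0\<close> by (intro order_tendstoD(1)) auto
      then obtain \<delta> where \<delta>: "0 < \<delta>" "\<And>h. h \<noteq> 0 \<Longrightarrow> dist h 0 < \<delta> \<Longrightarrow> 0 < \<phi> h - h \<bullet> \<nu>"
        unfolding eventually_at by auto
      have "p \<in> closure \<Omega>" using p by (simp add: frontier_def)
      then obtain y where y: "y \<in> \<Omega>" "dist y p < min \<delta> r" using \<delta> r closure_approachable[of p \<Omega>] by (metis min_less_iff_conj)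
      then have "y \<in> \<Omega> \<inter> ball p r" by (simp add: dist_commute)
      then have "\<phi> (y - p) < (y - p) \<bullet> \<nu>" unfolding eq by simp
      moreover have "0 < \<phi> (y - p) - (y - p) \<bullet> \<nu>"
        using y p\<Omega> by (intro \<delta>(2)) (auto simp: dist_norm)
      ultimately show False by simp
    qed
  qed
  have b\<nu>: "b \<bullet> \<nu> = 0"
  proof (rule ccontr)
    assume nz: "b \<bullet> \<nu> \<noteq> 0"
    \<comment> \<open>\<phi> is constant along \<nu>, so its derivative in that direction vanishes;
      \<open>t\<close> is small enough for the Taylor error to contradict a nonzero value.\<close>
    define t where "t = min (r / 2) (\<bar>b \<bullet> \<nu>\<bar> / (2 * M))"
    have t: "0 < t" "t < r" "t * (2 * M) \<le> \<bar>b \<bullet> \<nu>\<bar>"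
    proof -
      show "0 < t" "t < r" using r nz M by (auto simp: t_def)
      have "t \<le> \<bar>b \<bullet> \<nu>\<bar> / (2 * M)" by (simp add: t_def)
      then show "t * (2 * M) \<le> \<bar>b \<bullet> \<nu>\<bar>" using M by (simp add: field_simps)
    qed
    have "\<bar>\<phi> (t *\<^sub>R \<nu>) - \<phi> 0 - b \<bullet> (t *\<^sub>R \<nu>)\<bar> \<le> M * (norm (t *\<^sub>R \<nu>))\<^sup>2"
      by (rule taylor) (use t \<nu> in simp)
    moreover have "\<phi> (t *\<^sub>R \<nu>) = \<phi> 0" using inv[of 0 t] by simp
    ultimately have "t * \<bar>b \<bullet> \<nu>\<bar> \<le> t * (M * t)" using t \<nu> by (simp add: abs_mult power2_eq_square mult_ac)
    then have "\<bar>b \<bullet> \<nu>\<bar> \<le> M * t" using t by simp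
    then have "2 * \<bar>b \<bullet> \<nu>\<bar> \<le> \<bar>b \<bullet> \<nu>\<bar>" using t by (simp add: mult_ac)
    then show False using nz by simp
  qed
  define w where "w = b - \<nu>"
  have "(norm w)\<^sup>2 = (norm b)\<^sup>2 + 1"
    using \<nu> b\<nu> by (simp add: w_def power2_norm_eq_inner inner_simps inner_commute) (simp add: dot_square_norm)
  then have "1\<^sup>2 \<le> (norm w)\<^sup>2" by simp
  then have w1: "1 \<le> norm w" by (rule power2_le_imp_le) simp
  define n where "n = (1 / norm w) *\<^sub>R w"
  have n: "norm n = 1" using w1 by (auto simp: n_def)
  have nn: "n \<bullet> n = 1" using n by (simp add: dot_square_norm)
  have wn: "w \<bullet> h = norm w * (n \<bullet> h)" for h using w1 by (auto simp: n_def)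
  have small: "M * (norm h)\<^sup>2 < \<bar>n \<bullet> h\<bar>" if "(norm h)\<^sup>2 < 2 * \<rho> * \<bar>n \<bullet> h\<bar>" for h
  proof -
    have "M * (norm h)\<^sup>2 < M * (2 * \<rho> * \<bar>n \<bullet> h\<bar>)" using that M by simp
    also have "\<dots> = (2 * M * \<rho>) * \<bar>n \<bullet> h\<bar>" by simp
    also have "\<dots> \<le> 1 * \<bar>n \<bullet> h\<bar>" using \<rho> by (intro mult_right_mono) auto
    finally show ?thesis by simp
  qed
  show ?thesis
  proof (intro exI[of _ n] conjI n)
    show "ball (p + \<rho> *\<^sub>R n) \<rho> \<inter> \<Omega> = {}"
    proof (rule ccontr)
      assume "ball (p + \<rho> *\<^sub>R n) \<rho> \<inter> \<Omega> \<noteq> {}"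
      then obtain x where x: "x \<in> ball (p + \<rho> *\<^sub>R n) \<rho>" "x \<in> \<Omega>" by blast
      define h where "h = x - p"
      have hn: "norm (h - \<rho> *\<^sub>R n) < \<rho>" using x(1) by (simp add: h_def dist_norm norm_minus_commute algebra_simps)
      then have "(norm (h - \<rho> *\<^sub>R n))\<^sup>2 < \<rho>\<^sup>2" using \<rho> by (intro power_strict_mono) auto
      moreover have "(norm (h - \<rho> *\<^sub>R n))\<^sup>2 = (norm h)\<^sup>2 - 2 * \<rho> * (n \<bullet> h) + \<rho>\<^sup>2"
        unfolding power2_norm_eq_inner using nn
        by (simp add: inner_diff_left inner_diff_right inner_commute algebra_simps power2_eq_square)
      ultimately have h2: "(norm h)\<^sup>2 < 2 * \<rho> * (n \<bullet> h)" by linarith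
      have "0 \<le> (norm h)\<^sup>2" by simp
      then have nh: "0 < n \<bullet> h" using h2 \<rho> by (smt (verit) mult_nonneg_nonpos)
      have "norm h < 2 * \<rho>" using hn norm_triangle_ineq[of "h - \<rho> *\<^sub>R n" "\<rho> *\<^sub>R n"] n \<rho> by simp
      then have hr: "h \<in> ball 0 r" using \<rho> by simp
      then have "x \<in> \<Omega> \<inter> ball p r" using x by (simp add: h_def dist_norm norm_minus_commute)
      then have "\<phi> h < h \<bullet> \<nu>" unfolding eq by (simp add: h_def)
      moreover have "b \<bullet> h - M * (norm h)\<^sup>2 \<le> \<phi> h" using taylor[OF hr] \<phi>0 by (simp add: abs_le_iff)
      moreover have "M * (norm h)\<^sup>2 < n \<bullet> h" using small[of h] h2 nh by simp
      moreover have "1 * (n \<bullet> h) \<le> norm w * (n \<bullet> h)" using w1 nh by (intro mult_right_mono) auto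
      moreover have "b \<bullet> h - h \<bullet> \<nu> = norm w * (n \<bullet> h)" unfolding wn[symmetric] by (simp add: w_def inner_diff_left inner_diff_right inner_commute)
      ultimately show False by linarith
    qed
    show "ball (p - \<rho> *\<^sub>R n) \<rho> \<subseteq> \<Omega>"
    proof
      fix x assume x: "x \<in> ball (p - \<rho> *\<^sub>R n) \<rho>"
      define h where "h = x - p"
      have hn: "norm (h + \<rho> *\<^sub>R n) < \<rho>" using x by (simp add: h_def dist_norm norm_minus_commute algebra_simps)
      then have "(norm (h + \<rho> *\<^sub>R n))\<^sup>2 < \<rho>\<^sup>2" using \<rho> by (intro power_strict_mono) auto
      moreover have "(norm (h + \<rho> *\<^sub>R n))\<^sup>2 = (norm h)\<^sup>2 + 2 * \<rho> * (n \<bullet> h) + \<rho>\<^sup>2"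
        unfolding power2_norm_eq_inner using nn
        by (simp add: inner_add_left inner_add_right inner_commute algebra_simps power2_eq_square)
      ultimately have h2: "(norm h)\<^sup>2 < - (2 * \<rho> * (n \<bullet> h))" by linarith
      have "0 \<le> (norm h)\<^sup>2" by simp
      then have nh: "n \<bullet> h < 0" using h2 \<rho> by (smt (verit) mult_nonneg_nonneg)
      have "norm h < 2 * \<rho>" using hn norm_triangle_ineq4[of "h + \<rho> *\<^sub>R n" "\<rho> *\<^sub>R n"] n \<rho> by simp
      then have hr: "h \<in> ball 0 r" using \<rho> by simp
      have "\<phi> h \<le> b \<bullet> h + M * (norm h)\<^sup>2" using taylor[OF hr] \<phi>0 by (simp add: abs_le_iff)
      moreover have "M * (norm h)\<^sup>2 < - (n \<bullet> h)" using small[of h] h2 nh by simp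
      moreover have "norm w * (n \<bullet> h) \<le> 1 * (n \<bullet> h)" using w1 nh by (intro mult_right_mono_neg) auto
      moreover have "b \<bullet> h - h \<bullet> \<nu> = norm w * (n \<bullet> h)" unfolding wn[symmetric] by (simp add: w_def inner_diff_left inner_diff_right inner_commute)
      ultimately have "\<phi> h < h \<bullet> \<nu>" by linarith
      moreover have "x \<in> ball p r" using hr by (simp add: h_def dist_norm norm_minus_commute)
      ultimately have "x \<in> \<Omega> \<inter> ball p r" unfolding eq by (simp add: h_def)
      then show "x \<in> \<Omega>" by blast
    qed
  qed
qed

section \<open>Continuity of the fractional Laplacian\<close>

text \<open>Where the bound fails it fails on a nonempty open set, which is not negligible.\<close>

lemma AE_le_imp_le:
  fixes f :: "'a::euclidean_space \<Rightarrow> real"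
  assumes op: "open U" and ae: "AE x in lebesgue_on U. f x \<le> b" and x: "x \<in> U" and cont: "isCont f x"
  shows "f x \<le> b"
proof (rule ccontr)
  assume "\<not> f x \<le> b"
  then have "eventually (\<lambda>y. b < f y) (nhds x)"
    using cont by (intro order_tendstoD(1)[of f "f x"]) (auto simp: continuous_at tendsto_at_iff_tendsto_nhds)
  moreover have "eventually (\<lambda>y. y \<in> U) (nhds x)" using op x by (rule eventually_nhds_in_open)
  ultimately have "eventually (\<lambda>y. b < f y \<and> y \<in> U) (nhds x)" by (rule eventually_conj)
  then obtain S where S: "open S" "x \<in> S" "\<And>y. y \<in> S \<Longrightarrow> b < f y \<and> y \<in> U"
    unfolding eventually_nhds by blast
  have "AE y in lebesgue. y \<in> U \<longrightarrow> f y \<le> b"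
    using ae op by (subst (asm) AE_restrict_space_iff) auto
  then obtain N where N: "{y \<in> space lebesgue. \<not> (y \<in> U \<longrightarrow> f y \<le> b)} \<subseteq> N" "emeasure lebesgue N = 0" "N \<in> sets lebesgue"
    by (rule AE_E)
  have "S \<subseteq> N" using N(1) S(3) by force
  moreover have "negligible N" using N(2,3) by (simp add: negligible_iff_null_sets null_setsI)
  ultimately have "negligible S" using negligible_subset by blast
  then show False using open_not_negligible[OF S(1)] S(2) by blast
qed

text \<open>Taylor's formula at \<open>z\<close> and \<open>- z\<close>: the gradient terms cancel.
  The larger ball contains all points that occur.\<close>

lemma second_diff_C11_bound:
  fixes u :: "real ^ 'n \<Rightarrow> real"
  assumes u: "u \<in> C11_loc U" and sub: "cball x0 (2 * \<delta>) \<subseteq> U"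
  shows "\<exists>A\<ge>0. \<forall>x\<in>cball x0 \<delta>. \<forall>z. norm z \<le> \<delta> \<longrightarrow> \<bar>second_diff u x z\<bar> \<le> A * (norm z)\<^sup>2"
proof -
  let ?K = "cball x0 (2 * \<delta>)"
  have "C11_norm ?K u < \<infinity>" using u sub by (auto simp: C11_loc_def)
  moreover have "holder_norm 1 ?K (gradient u) \<le> C11_norm ?K u" by (auto simp: C11_norm_def intro: add_increasing)
  ultimately have fin: "holder_norm 1 ?K (gradient u) < \<infinity>" by (rule le_less_trans[rotated])
  define A where "A = enn2real (holder_norm 1 ?K (gradient u))"
  have A: "0 \<le> A" "holder_norm 1 ?K (gradient u) \<le> ennreal A" using fin by (auto simp: A_def)
  have diff: "u differentiable (at y)" if "y \<in> ?K" for y using u sub that by (auto simp: C11_loc_def)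
  show ?thesis
  proof (intro exI[of _ "2 * A"] conjI ballI allI impI)
    show "0 \<le> 2 * A" using A by simp
    fix x z :: "real ^ 'n" assume x: "x \<in> cball x0 \<delta>" and z: "norm z \<le> \<delta>"
    have inK: "y \<in> ?K" if "y \<in> cball x (norm z)" for y
      using that x z dist_triangle[of x0 y x] by simp
    have xK: "x \<in> ?K" by (rule inK) simp
    have t: "\<bar>u (x + h) - u x - gradient u x \<bullet> h\<bar> \<le> A * (norm h)\<^sup>2" if "norm h = norm z" for h
      by (rule gradient_lipschitz_taylor)
        (use that diff inK xK A holder_norm_1_lipschitz[OF A(2,1)] in \<open>auto simp: dist_norm\<close>)
    show "\<bar>second_diff u x z\<bar> \<le> 2 * A * (norm z)\<^sup>2"
      using t[of z] t[of "- z"] unfolding second_diff_def by simp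
  qed
qed

text \<open>Short jumps are kept as second differences, dominated by the quadratic bound; long jumps
  are rewritten in the fixed variable \<open>y\<close>. In both parts \<open>x\<close> then varies
  under the integral sign, ready for dominated convergence.\<close>

lemma has_frac_laplacian_split:
  fixes u :: "real ^ 'n \<Rightarrow> real"
  assumes s: "0 < s" "s < 1" and um: "u \<in> borel_measurable lebesgue" and \<delta>: "0 < \<delta>"
    and bound: "\<And>z. norm z \<le> \<delta> \<Longrightarrow> \<bar>second_diff u x z\<bar> \<le> A * (norm z)\<^sup>2"
    and lap: "has_frac_laplacian s u x l"
  defines "c \<equiv> frac_laplacian_const CARD('n) s"
  shows "l = c / 2 * (\<integral>z. indicator (ball 0 \<delta>) z * (second_diff u x z * riesz_kernel s z) \<partial>lebesgue)
     + c * (u x * kernel_integral s (\<lambda>z::real^'n. indicator (- ball 0 \<delta>) z * norm z powr 0)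
     - (\<integral>y. indicator (- ball x \<delta>) y * (u y * riesz_kernel s (y - x)) \<partial>lebesgue))"
    and "integrable lebesgue (\<lambda>y. indicator (- ball x \<delta>) y * (u y * riesz_kernel s (y - x)))"
proof -
  define F where "F = (\<lambda>z. indicator (- ball 0 \<delta>) z * ((u x - u (x + z)) * riesz_kernel s z))"
  define E where "E = (\<lambda>z::real^'n. (indicator (- ball 0 \<delta>) z * norm z powr 0) * riesz_kernel s z)"
  define G where "G = (\<lambda>y. indicator (- ball x \<delta>) y * (u y * riesz_kernel s (y - x)))"
  have iF: "integrable lebesgue F" unfolding F_def by (rule has_frac_laplacian_integrable(1)[OF lap \<delta>])
  have iF': "integrable lebesgue (\<lambda>z. F (- z))" and vF': "(\<integral>z. F (- z) \<partial>lebesgue) = (\<integral>z. F z \<partial>lebesgue)"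
    using lebesgue_preserving_integral[OF lebesgue_preserving_uminus, of F] iF by auto
  have iE: "integrable lebesgue E" unfolding E_def by (rule integrable_riesz_kernel_compl_ball(1)) (use s \<delta> in auto)
  have GF: "G (x + z) = u x * E z - F z" for z
    by (auto simp: G_def F_def E_def indicator_def dist_norm algebra_simps)
  have Gx: "integrable lebesgue (\<lambda>z. G (x + z))"
    unfolding GF using iE iF by (intro Bochner_Integration.integrable_diff integrable_mult_right)
  have Gm: "G \<in> borel_measurable lebesgue"
  proof -
    have "(\<lambda>y. G (x + (- x + y))) \<in> borel_measurable lebesgue"
      by (rule lebesgue_preserving_measurable[OF lebesgue_preserving_plus, of "\<lambda>z. G (x + z)"]) (use Gx in auto)
    then show ?thesis by simp
  qed
  have iG: "integrable lebesgue G" and vG: "(\<integral>z. G (x + z) \<partial>lebesgue) = (\<integral>z. G z \<partial>lebesgue)"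
    using lebesgue_preserving_integral[OF lebesgue_preserving_plus[of x] Gm] Gx by auto
  show "integrable lebesgue (\<lambda>y. indicator (- ball x \<delta>) y * (u y * riesz_kernel s (y - x)))"
    using iG by (simp add: G_def)
  have "(\<integral>z. G z \<partial>lebesgue) = u x * (\<integral>z. E z \<partial>lebesgue) - (\<integral>z. F z \<partial>lebesgue)"
    unfolding vG[symmetric] GF using iE iF by simp
  then have vF: "(\<integral>z. F z \<partial>lebesgue) = u x * (\<integral>z. E z \<partial>lebesgue) - (\<integral>z. G z \<partial>lebesgue)" by simp
  define N where "N = (\<lambda>z. indicator (ball 0 \<delta>) z * second_diff u x z)"
  have sdm: "second_diff u x \<in> borel_measurable lebesgue"
  proof -
    have a: "(\<lambda>z. u (x + z)) \<in> borel_measurable lebesgue"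
      by (rule lebesgue_preserving_measurable[OF lebesgue_preserving_plus um])
    have "(\<lambda>z. u (x + (- z))) \<in> borel_measurable lebesgue"
      by (rule lebesgue_preserving_measurable[OF lebesgue_preserving_uminus a])
    with a show ?thesis unfolding second_diff_def by simp
  qed
  have iN: "kernel_integrable s N"
  proof (rule integrable_riesz_kernelI[OF \<delta>, where p=2 and q=0 and A=A and B=0])
    show "N \<in> borel_measurable lebesgue"
      unfolding N_def by (intro borel_measurable_times borel_measurable_indicator sdm) auto
    show "\<bar>N z\<bar> \<le> A * norm z powr 2" if "z \<noteq> 0" "norm z < \<delta>" for z
      using bound[of z] that by (simp add: N_def)
    show "\<bar>N z\<bar> \<le> 0 * norm z powr 0" if "\<delta> \<le> norm z" for z using that by (simp add: N_def)
  qed (use s in auto)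
  have sd: "second_diff u x z * riesz_kernel s z = N z * riesz_kernel s z + (F z + F (- z))" for z
    by (auto simp: N_def F_def second_diff_def indicator_def algebra_simps)
  have isd: "integrable lebesgue (\<lambda>z. second_diff u x z * riesz_kernel s z)"
    unfolding sd using iN iF iF' by (intro Bochner_Integration.integrable_add)
  have pv: "pv_limit s (second_diff u x) l" by (rule has_frac_laplacian_imp_pv_limit[OF lap])
  \<comment> \<open>The second difference is now absolutely integrable, so it serves as its own
    upper and lower bound.\<close>
  have "l = c / 2 * kernel_integral s (second_diff u x)"
  proof (rule antisym)
    show "l \<le> c / 2 * kernel_integral s (second_diff u x)"
      unfolding c_def by (rule pv_limit_upper[OF s pv isd]) simp
    show "c / 2 * kernel_integral s (second_diff u x) \<le> l"
      unfolding c_def by (rule pv_limit_lower[OF s pv isd]) simp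
  qed
  also have "kernel_integral s (second_diff u x) = kernel_integral s N + 2 * (\<integral>z. F z \<partial>lebesgue)"
    unfolding sd using iN iF iF' vF' by simp
  finally show "l = c / 2 * (\<integral>z. indicator (ball 0 \<delta>) z * (second_diff u x z * riesz_kernel s z) \<partial>lebesgue)
     + c * (u x * kernel_integral s (\<lambda>z::real^'n. indicator (- ball 0 \<delta>) z * norm z powr 0)
     - (\<integral>y. indicator (- ball x \<delta>) y * (u y * riesz_kernel s (y - x)) \<partial>lebesgue))"
    unfolding vF by (simp add: N_def E_def G_def algebra_simps)
qed

text \<open>The right-hand side is only bounded almost everywhere, whereas the touching arguments evaluate it at
  single points; its continuity closes the gap.\<close>
lemma frac_laplacian_continuous:
  fixes u :: "real ^ 'n \<Rightarrow> real"
  assumes s: "0 < s" "s < 1" and op: "open U" and u: "u \<in> C11_loc U" and um: "u \<in> borel_measurable lebesgue"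
    and lap: "\<And>x. x \<in> U \<Longrightarrow> has_frac_laplacian s u x (g x)" and x0: "x0 \<in> U"
  shows "isCont g x0"
proof -
  define c where "c = frac_laplacian_const CARD('n) s"
  obtain e where e: "0 < e" "cball x0 e \<subseteq> U" using op x0 open_contains_cball by blast
  define \<delta> where "\<delta> = e / 2"
  have \<delta>: "0 < \<delta>" "cball x0 (2 * \<delta>) \<subseteq> U" using e by (auto simp: \<delta>_def)
  obtain A where A: "0 \<le> A" "\<And>x z. x \<in> cball x0 \<delta> \<Longrightarrow> norm z \<le> \<delta> \<Longrightarrow> \<bar>second_diff u x z\<bar> \<le> A * (norm z)\<^sup>2"
    using second_diff_C11_bound[OF u \<delta>(2)] by blast
  have inU: "y \<in> U" if "dist x0 y \<le> 2 * \<delta>" for y using \<delta>(2) that by auto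
  have cu: "isCont u y" if "y \<in> U" for y
    using u that by (intro differentiable_imp_continuous_within) (auto simp: C11_loc_def)
  define N where "N x = (\<lambda>z. indicator (ball 0 \<delta>) z * (second_diff u x z * riesz_kernel s z))" for x
  define G where "G x = (\<lambda>y. indicator (- ball x \<delta>) y * (u y * riesz_kernel s (y - x)))" for x
  define E where "E = kernel_integral s (\<lambda>z::real^'n. indicator (- ball 0 \<delta>) z * norm z powr 0)"
  have split: "g x = c / 2 * (\<integral>z. N x z \<partial>lebesgue) + c * (u x * E - (\<integral>y. G x y \<partial>lebesgue))"
    and iG: "integrable lebesgue (G x)" if "x \<in> cball x0 \<delta>" for x
  proof -
    have "x \<in> U" using that \<delta>(1) by (intro inU) simp
    note sp = has_frac_laplacian_split[OF s um \<delta>(1) A(2)[OF that] lap[OF \<open>x \<in> U\<close>]]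
    show "g x = c / 2 * (\<integral>z. N x z \<partial>lebesgue) + c * (u x * E - (\<integral>y. G x y \<partial>lebesgue))"
      using sp(1) unfolding N_def G_def E_def c_def by blast
    show "integrable lebesgue (G x)" using sp(2) unfolding G_def by blast
  qed
  have sdm: "second_diff u x \<in> borel_measurable lebesgue" for x
  proof -
    have a: "(\<lambda>z. u (x + z)) \<in> borel_measurable lebesgue"
      by (rule lebesgue_preserving_measurable[OF lebesgue_preserving_plus um])
    have "(\<lambda>z. u (x + (- z))) \<in> borel_measurable lebesgue"
      by (rule lebesgue_preserving_measurable[OF lebesgue_preserving_uminus a])
    with a show ?thesis unfolding second_diff_def by simp
  qed
  have Nm: "N x \<in> borel_measurable lebesgue" for x
    unfolding N_def by (intro borel_measurable_times borel_measurable_indicator sdm riesz_kernel_measurable) auto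
  \<comment> \<open>Staying within \<open>\<delta> / 2\<close> of \<open>x0\<close> gives
    \<open>norm (y - x0) \<le> 2 * norm (y - Y k)\<close> outside
    \<open>ball (Y k) \<delta>\<close>, hence an integrable majorant for the far part.\<close>
  have seq: "(\<lambda>k. g (Y k)) \<longlonglongrightarrow> g x0" if Y: "Y \<longlonglongrightarrow> x0" and Yb: "\<And>k. Y k \<in> cball x0 (\<delta> / 2)" for Y
  proof -
    have Yd: "Y k \<in> cball x0 \<delta>" for k using Yb[of k] \<delta>(1) by simp
    have x0d: "x0 \<in> cball x0 \<delta>" using \<delta>(1) by simp
    have cY: "(\<lambda>k. u (Y k + z)) \<longlonglongrightarrow> u (x0 + z)" if "norm z < \<delta>" for z
    proof -
      have "isCont u (x0 + z)" by (rule cu, rule inU) (use that \<delta>(1) in \<open>simp add: dist_norm\<close>)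
      then show ?thesis using Y by (intro isCont_tendsto_compose[of "x0 + z" u] tendsto_intros)
    qed
    have lN: "(\<lambda>k. \<integral>z. N (Y k) z \<partial>lebesgue) \<longlonglongrightarrow> (\<integral>z. N x0 z \<partial>lebesgue)"
    proof (rule integral_dominated_convergence[where w="\<lambda>z. A * ((indicator (ball 0 \<delta>) z * norm z powr 2) * riesz_kernel s z)"])
      show "integrable lebesgue (\<lambda>z::real^'n. A * ((indicator (ball 0 \<delta>) z * norm z powr 2) * riesz_kernel s z))"
        by (intro integrable_mult_right integrable_riesz_kernel_ball(1)) (use s \<delta> in auto)
      show "AE z in lebesgue. norm (N (Y k) z) \<le> A * ((indicator (ball 0 \<delta>) z * norm z powr 2) * riesz_kernel s z)" for k
      proof (rule AE_I2)
        fix z :: "real ^ 'n"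
        show "norm (N (Y k) z) \<le> A * ((indicator (ball 0 \<delta>) z * norm z powr 2) * riesz_kernel s z)"
        proof (cases "norm z < \<delta> \<and> z \<noteq> 0")
          case True
          then have "\<bar>second_diff u (Y k) z\<bar> * riesz_kernel s z \<le> A * (norm z)\<^sup>2 * riesz_kernel s z"
            using A(2)[OF Yd, of z k] by (intro mult_right_mono) auto
          then show ?thesis using True by (simp add: N_def abs_mult)
        next
          case False
          then show ?thesis by (auto simp: N_def)
        qed
      qed
      show "AE z in lebesgue. (\<lambda>k. N (Y k) z) \<longlonglongrightarrow> N x0 z"
      proof (rule AE_I2)
        fix z :: "real ^ 'n"
        show "(\<lambda>k. N (Y k) z) \<longlonglongrightarrow> N x0 z"
        proof (cases "norm z < \<delta>")
          case True
          have "(\<lambda>k. second_diff u (Y k) z) \<longlonglongrightarrow> second_diff u x0 z"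
            unfolding second_diff_def using cY[of 0] cY[of z] cY[of "- z"] True \<delta>(1) by (intro tendsto_intros) auto
          then show ?thesis unfolding N_def by (intro tendsto_intros)
        qed (simp add: N_def)
      qed
    qed (rule Nm)+
    have lG: "(\<lambda>k. \<integral>y. G (Y k) y \<partial>lebesgue) \<longlonglongrightarrow> (\<integral>y. G x0 y \<partial>lebesgue)"
    proof (rule integral_dominated_convergence[where w="\<lambda>y. 2 powr (real CARD('n) + 2 * s) * \<bar>indicator (- ball x0 (\<delta> / 2)) y * (u y * riesz_kernel s (y - x0))\<bar>"])
      have b2: "norm z \<le> \<delta> / 2 \<Longrightarrow> \<bar>second_diff u x0 z\<bar> \<le> A * (norm z)\<^sup>2" for z
        by (rule A(2)[OF x0d]) (use \<delta>(1) in simp)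
      have "integrable lebesgue (\<lambda>y. indicator (- ball x0 (\<delta> / 2)) y * (u y * riesz_kernel s (y - x0)))"
        by (rule has_frac_laplacian_split(2)[OF s um _ b2 lap[OF x0]]) (use \<delta>(1) in auto)
      then show "integrable lebesgue (\<lambda>y. 2 powr (real CARD('n) + 2 * s) * \<bar>indicator (- ball x0 (\<delta> / 2)) y * (u y * riesz_kernel s (y - x0))\<bar>)"
        by (intro integrable_mult_right integrable_abs)
      show "AE y in lebesgue. norm (G (Y k) y) \<le> 2 powr (real CARD('n) + 2 * s) * \<bar>indicator (- ball x0 (\<delta> / 2)) y * (u y * riesz_kernel s (y - x0))\<bar>" for k
      proof (rule AE_I2)
        fix y :: "real ^ 'n"
        show "norm (G (Y k) y) \<le> 2 powr (real CARD('n) + 2 * s) * \<bar>indicator (- ball x0 (\<delta> / 2)) y * (u y * riesz_kernel s (y - x0))\<bar>"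
        proof (cases "y \<in> ball (Y k) \<delta>")
          case False
          have d1: "dist x0 y \<le> dist x0 (Y k) + dist (Y k) y" by (rule dist_triangle)
          have d2: "dist (Y k) y \<le> dist x0 (Y k) + dist x0 y" using dist_triangle[of "Y k" y x0] by (simp add: dist_commute)
          have n0: "\<delta> / 2 \<le> norm (y - x0)" "norm (y - x0) \<le> 2 * norm (y - Y k)" "0 < norm (y - x0)"
            using d1 d2 False Yb[of k] \<delta>(1) by (auto simp: dist_norm norm_minus_commute)
          have "riesz_kernel s (y - Y k) \<le> 2 powr (real CARD('n) + 2 * s) * riesz_kernel s (y - x0)"
          proof -
            have "norm (y - Y k) powr (- (real CARD('n) + 2 * s)) \<le> (norm (y - x0) / 2) powr (- (real CARD('n) + 2 * s))"
              using n0 s by (intro powr_mono2') auto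
            also have "\<dots> = 2 powr (real CARD('n) + 2 * s) * norm (y - x0) powr (- (real CARD('n) + 2 * s))"
              using powr_divide[of "norm (y - x0)" 2 "- (real CARD('n) + 2 * s)"]
              by (simp only: powr_minus norm_ge_zero) (simp add: field_simps)
            finally show ?thesis by (simp add: riesz_kernel_def)
          qed
          then have "\<bar>u y\<bar> * riesz_kernel s (y - Y k) \<le> \<bar>u y\<bar> * (2 powr (real CARD('n) + 2 * s) * riesz_kernel s (y - x0))"
            by (intro mult_left_mono) auto
          moreover have "indicat_real (- ball x0 (\<delta> / 2)) y = 1" using n0(1) by (simp add: dist_norm norm_minus_commute)
          ultimately show ?thesis using False by (simp add: G_def abs_mult mult_ac)
        qed (simp add: G_def)
      qed
      \<comment> \<open>Off this null sphere the indicators of the moving balls are eventually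
        constant.\<close>
      have "AE y in lebesgue. y \<notin> sphere x0 \<delta>"
        by (rule AE_not_in) (use negligible_sphere negligible_iff_null_sets in blast)
      then show "AE y in lebesgue. (\<lambda>k. G (Y k) y) \<longlonglongrightarrow> G x0 y"
      proof eventually_elim
        fix y :: "real ^ 'n" assume ns: "y \<notin> sphere x0 \<delta>"
        have dY: "(\<lambda>k. dist (Y k) y) \<longlonglongrightarrow> dist x0 y" by (intro tendsto_intros Y)
        show "(\<lambda>k. G (Y k) y) \<longlonglongrightarrow> G x0 y"
        proof (cases "dist x0 y < \<delta>")
          case True
          then have "eventually (\<lambda>k. dist (Y k) y < \<delta>) sequentially" by (rule order_tendstoD(2)[OF dY])
          then have "eventually (\<lambda>k. G (Y k) y = G x0 y) sequentially"
            by eventually_elim (use True in \<open>simp add: G_def\<close>)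
          then show ?thesis by (rule tendsto_eventually)
        next
          case False
          then have gt: "\<delta> < dist x0 y" using ns by auto
          have yx: "norm (y - x0) \<noteq> 0" using gt \<delta>(1) by auto
          have "(\<lambda>k. u y * riesz_kernel s (y - Y k)) \<longlonglongrightarrow> u y * riesz_kernel s (y - x0)"
            unfolding riesz_kernel_def using yx by (intro tendsto_intros Y) auto
          then have l: "(\<lambda>k. u y * riesz_kernel s (y - Y k)) \<longlonglongrightarrow> G x0 y" using gt by (simp add: G_def)
          have "eventually (\<lambda>k. \<delta> < dist (Y k) y) sequentially" by (rule order_tendstoD(1)[OF dY gt])
          then have "eventually (\<lambda>k. u y * riesz_kernel s (y - Y k) = G (Y k) y) sequentially"
            by eventually_elim (simp add: G_def)
          then show ?thesis using l by (rule Lim_transform_eventually[rotated])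
        qed
      qed
    qed (use iG[OF x0d] iG[OF Yd] in auto)
    have "(\<lambda>k. u (Y k)) \<longlonglongrightarrow> u x0" using cY[of 0] \<delta>(1) by simp
    then have "(\<lambda>k. c / 2 * (\<integral>z. N (Y k) z \<partial>lebesgue) + c * (u (Y k) * E - (\<integral>y. G (Y k) y \<partial>lebesgue)))
       \<longlonglongrightarrow> c / 2 * (\<integral>z. N x0 z \<partial>lebesgue) + c * (u x0 * E - (\<integral>y. G x0 y \<partial>lebesgue))"
      by (intro tendsto_intros lN lG)
    then show ?thesis by (simp add: split[OF Yd] split[OF x0d])
  qed
  show ?thesis
    unfolding continuous_at_sequentially
  proof (intro allI impI)
    fix X assume X: "X \<longlonglongrightarrow> x0"
    \<comment> \<open>Only finitely many terms of \<open>X\<close> can lie outside the small ball;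
      they are replaced by \<open>x0\<close>.\<close>
    define Y where "Y k = (if X k \<in> cball x0 (\<delta> / 2) then X k else x0)" for k
    have "eventually (\<lambda>k. dist (X k) x0 < \<delta> / 2) sequentially" by (rule tendstoD[OF X]) (use \<delta>(1) in simp)
    then have ev: "eventually (\<lambda>k. Y k = X k) sequentially"
      by eventually_elim (simp add: Y_def dist_commute)
    have "Y \<longlonglongrightarrow> x0"
      using X by (rule Lim_transform_eventually) (use ev in \<open>auto elim: eventually_mono\<close>)
    then have "(\<lambda>k. g (Y k)) \<longlonglongrightarrow> g x0" by (rule seq) (use \<delta>(1) in \<open>simp add: Y_def\<close>)
    then show "(g \<circ> X) \<longlonglongrightarrow> g x0"
      by (rule Lim_transform_eventually) (use ev in \<open>auto elim: eventually_mono\<close>)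
  qed
qed

section \<open>The regularity estimate\<close>

text \<open>With one number \<Lambda> bounding solution and right-hand side, normalisation makes the
  estimate linear in \<Lambda>, and the domain enters the constant through \<open>M\<close>
  only.\<close>

lemma regularity_estimate:
  assumes s: "0 < s" "s < 1" and M: "0 < M"
  shows "\<exists>K>0. \<forall>(\<Omega> :: (real ^ 'n) set) x0 u g \<Lambda>. 0 < \<Lambda> \<longrightarrow> open \<Omega> \<longrightarrow> x0 \<in> frontier \<Omega> \<longrightarrow>
    (\<forall>p\<in>frontier \<Omega> \<inter> ball x0 4. C11_graph_near \<Omega> p (1 / M) M) \<longrightarrow>
    (\<forall>x. 0 \<le> u x) \<longrightarrow> (\<forall>x\<in>ball x0 4 - \<Omega>. u x = 0) \<longrightarrow>
    bounded_solution s (\<Omega> \<inter> ball x0 4) g u \<Lambda> \<longrightarrow>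
    holder_norm s (\<Omega> \<inter> ball x0 (1/2)) u \<le> ennreal (K * \<Lambda>)"
proof -
  \<comment> \<open>The bound \<open>1 / (2 * M)\<close> yields both conditions for tangent balls;
    \<open>1 / 8\<close> is the radius limit of the barrier argument.\<close>
  define \<rho> where "\<rho> = min (1/8) (1 / (2 * M))"
  have \<rho>: "0 < \<rho>" "\<rho> \<le> 1 / 8" "2 * \<rho> \<le> 1 / M" "2 * M * \<rho> \<le> 1"
  proof -
    show "0 < \<rho>" using M by (simp add: \<rho>_def)
    show "\<rho> \<le> 1 / 8" unfolding \<rho>_def by (rule min.cobounded1)
    have "\<rho> \<le> 1 / (2 * M)" unfolding \<rho>_def by (rule min.cobounded2)
    then show "2 * \<rho> \<le> 1 / M" "2 * M * \<rho> \<le> 1" using M by (auto simp: field_simps)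
  qed
  \<comment> \<open>Half the radius of the interior tangent ball at \<open>x0\<close>: the smaller
    closed ball lies in \<Omega> and in \<open>ball x0 1\<close>.\<close>
  define \<kappa> where "\<kappa> = \<rho> / 2"
  have \<kappa>: "0 < \<kappa>" using \<rho> by (simp add: \<kappa>_def)
  obtain L where L: "0 < L" and hol: "\<And>(\<Omega> :: (real ^ 'n) set) x0 v x y. normalized_solution s \<rho> \<Omega> x0 v \<Longrightarrow>
    x \<in> ball x0 (1/2) \<Longrightarrow> y \<in> ball x0 (1/2) \<Longrightarrow> v x - v y \<le> L * dist x y powr s"
    using normalized_solution_holder[OF s \<rho>(1,2), where 'n='n] by blast
  obtain N where N: "1 \<le> N" and trunc: "\<And>(\<Omega> :: (real ^ 'n) set) x0 u g \<Lambda> z0 \<rho>. 0 < \<Lambda> \<Longrightarrow> open \<Omega> \<Longrightarrow> (\<forall>x. 0 \<le> u x) \<Longrightarrow>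
    (\<forall>x\<in>ball x0 4 - \<Omega>. u x = 0) \<Longrightarrow>
    bounded_solution s (\<Omega> \<inter> ball x0 4) g u \<Lambda> \<Longrightarrow>
    (\<forall>p\<in>frontier \<Omega> \<inter> ball x0 2. \<exists>z0. dist z0 p = \<rho> \<and> ball z0 \<rho> \<inter> \<Omega> = {}) \<Longrightarrow>
    cball z0 \<kappa> \<subseteq> \<Omega> \<inter> ball x0 1 \<Longrightarrow>
    normalized_solution s \<rho> \<Omega> x0 (\<lambda>y. (if y \<in> ball x0 3 then u y else 0) / (N * \<Lambda>))"
    using normalized_truncation[OF s \<kappa>, where 'n='n] by blast
  have LN: "0 < L * N" using L N by simp
  show ?thesis
  proof (intro exI[of _ "1 + L * N"] conjI allI impI)
    show "0 < 1 + L * N" using LN by simp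
    fix \<Omega> :: "(real ^ 'n) set" and x0 u g \<Lambda>
    assume \<Lambda>: "0 < \<Lambda>" and op: "open \<Omega>" and x0: "x0 \<in> frontier \<Omega>"
      and graph: "\<forall>p\<in>frontier \<Omega> \<inter> ball x0 4. C11_graph_near \<Omega> p (1 / M) M"
      and pos: "\<forall>x. 0 \<le> u x" and zero: "\<forall>x\<in>ball x0 4 - \<Omega>. u x = 0"
      and sol: "bounded_solution s (\<Omega> \<inter> ball x0 4) g u \<Lambda>"
    have tangent: "\<exists>n. norm n = 1 \<and> ball (p + \<rho> *\<^sub>R n) \<rho> \<inter> \<Omega> = {} \<and> ball (p - \<rho> *\<^sub>R n) \<rho> \<subseteq> \<Omega>"
      if "p \<in> frontier \<Omega>" "p \<in> ball x0 4" for p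
      using C11_graph_near_tangent_balls[OF op that(1) _ M \<rho>(1,3,4)] graph that by blast
    have ext: "\<forall>p\<in>frontier \<Omega> \<inter> ball x0 2. \<exists>z0. dist z0 p = \<rho> \<and> ball z0 \<rho> \<inter> \<Omega> = {}"
    proof
      fix p assume p: "p \<in> frontier \<Omega> \<inter> ball x0 2"
      then obtain n where n: "norm n = 1" "ball (p + \<rho> *\<^sub>R n) \<rho> \<inter> \<Omega> = {}" using tangent[of p] by auto
      then show "\<exists>z0. dist z0 p = \<rho> \<and> ball z0 \<rho> \<inter> \<Omega> = {}"
        using \<rho> by (intro exI[of _ "p + \<rho> *\<^sub>R n"]) (simp add: dist_norm)
    qed
    obtain n where n: "norm n = 1" "ball (x0 - \<rho> *\<^sub>R n) \<rho> \<subseteq> \<Omega>" using tangent[OF x0] by auto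
    have cb: "cball (x0 - \<rho> *\<^sub>R n) \<kappa> \<subseteq> \<Omega> \<inter> ball x0 1"
    proof
      fix y assume y: "y \<in> cball (x0 - \<rho> *\<^sub>R n) \<kappa>"
      then have "y \<in> ball (x0 - \<rho> *\<^sub>R n) \<rho>" using \<rho> by (simp add: \<kappa>_def)
      moreover have "dist x0 (x0 - \<rho> *\<^sub>R n) = \<rho>" using n \<rho> by (simp add: dist_norm)
      then have "dist x0 y < 1" using y \<rho> dist_triangle[of x0 y "x0 - \<rho> *\<^sub>R n"] by (simp add: \<kappa>_def)
      ultimately show "y \<in> \<Omega> \<inter> ball x0 1" using n by auto
    qed
    define v where "v y = (if y \<in> ball x0 3 then u y else 0) / (N * \<Lambda>)" for y
    have nv: "normalized_solution s \<rho> \<Omega> x0 v"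
      unfolding v_def[abs_def] by (rule trunc[OF \<Lambda> op pos zero sol ext cb])
    have N\<Lambda>: "0 < N * \<Lambda>" using N \<Lambda> by simp
    have uv: "u y = N * \<Lambda> * v y" if "y \<in> ball x0 (1/2)" for y
      using that N \<Lambda> by (simp add: v_def)
    have diff: "norm (u x - u y) / dist x y powr s \<le> L * N * \<Lambda>"
      if xy: "x \<in> ball x0 (1/2)" "y \<in> ball x0 (1/2)" "x \<noteq> y" for x y
    proof -
      have "\<bar>v x - v y\<bar> \<le> L * dist x y powr s"
        using hol[OF nv xy(1,2)] hol[OF nv xy(2,1)] by (simp add: dist_commute abs_le_iff)
      then have "N * \<Lambda> * \<bar>v x - v y\<bar> \<le> N * \<Lambda> * (L * dist x y powr s)"
        using N\<Lambda> by (intro mult_left_mono) auto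
      moreover have "norm (u x - u y) = N * \<Lambda> * \<bar>v x - v y\<bar>"
        using N \<Lambda> by (simp add: uv[OF xy(1)] uv[OF xy(2)] right_diff_distrib[symmetric] abs_mult)
      moreover have "0 < dist x y powr s" using xy(3) by simp
      ultimately show ?thesis by (simp add: pos_divide_le_eq mult_ac)
    qed
    have "sup_norm (\<Omega> \<inter> ball x0 (1/2)) u \<le> ennreal \<Lambda>"
      unfolding sup_norm_def
    proof (rule SUP_least)
      fix x assume "x \<in> \<Omega> \<inter> ball x0 (1/2)"
      then have "x \<in> \<Omega> \<inter> ball x0 4" by auto
      then show "ennreal (norm (u x)) \<le> ennreal \<Lambda>" using sol pos by (intro ennreal_leI) auto
    qed
    moreover have "holder_seminorm s (\<Omega> \<inter> ball x0 (1/2)) u \<le> ennreal (L * N * \<Lambda>)"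
      unfolding holder_seminorm_def by (rule SUP_least) (auto intro!: ennreal_leI diff simp del: mem_ball real_norm_def)
    ultimately have "holder_norm s (\<Omega> \<inter> ball x0 (1/2)) u \<le> ennreal \<Lambda> + ennreal (L * N * \<Lambda>)"
      unfolding holder_norm_def by (rule add_mono)
    also have "\<dots> = ennreal ((1 + L * N) * \<Lambda>)"
      using \<Lambda> L N by (subst ennreal_plus[symmetric]) (auto simp: algebra_simps)
    finally show "holder_norm s (\<Omega> \<inter> ball x0 (1/2)) u \<le> ennreal ((1 + L * N) * \<Lambda>)" .
  qed
qed

lemma Linf_norm_imp_pointwise:
  fixes f :: "'a::euclidean_space \<Rightarrow> real"
  assumes op: "open U" and cont: "\<And>x. x \<in> U \<Longrightarrow> isCont f x" and le: "Linf_norm U f \<le> ennreal b" and b: "0 \<le> b" and x: "x \<in> U"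
  shows "\<bar>f x\<bar> \<le> b"
proof (rule AE_le_imp_le[OF op _ x, where f="\<lambda>x. \<bar>f x\<bar>"])
  have "AE x in lebesgue_on U. ennreal \<bar>f x\<bar> \<le> Linf_norm U f"
    unfolding Linf_norm_def by (rule esssup_AE)
  then show "AE x in lebesgue_on U. \<bar>f x\<bar> \<le> b"
    by eventually_elim (use le b order_trans in \<open>force simp: ennreal_le_iff\<close>)
  show "isCont (\<lambda>x. \<bar>f x\<bar>) x" using cont[OF x] by (rule isCont_rabs)
qed

theorem theorem1p1:
  fixes s :: real
  assumes "0 < s" and "s < 1"
  shows "\<exists>C :: ennreal \<Rightarrow> real.
    \<forall>(\<Omega> :: (real ^ 'n) set) x0 g u.
      locally_C11_domain \<Omega> \<longrightarrow>
      x0 \<in> frontier \<Omega> \<longrightarrow>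
      g \<in> Linf (\<Omega> \<inter> ball x0 4) \<longrightarrow>
      u \<in> Linf (\<Omega> \<inter> ball x0 4) \<longrightarrow>
      classical_solution s (\<Omega> \<inter> ball x0 4) g u \<longrightarrow>
      (\<forall>x. 0 \<le> u x) \<longrightarrow>
      (\<forall>x \<in> ball x0 4 - \<Omega>. u x = 0) \<longrightarrow>
      u \<in> holder_space s (\<Omega> \<inter> ball x0 (1/2)) \<and>
      holder_norm s (\<Omega> \<inter> ball x0 (1/2)) u
        \<le> ennreal (C (C11_boundary_norm \<Omega> (ball x0 4))) *
           (Linf_norm (\<Omega> \<inter> ball x0 4) g + Linf_norm (\<Omega> \<inter> ball x0 4) u)"
proof -
  let ?P = "\<lambda>M K. 0 < K \<and> (\<forall>(\<Omega> :: (real ^ 'n) set) x0 u g \<Lambda>. 0 < \<Lambda> \<longrightarrow> open \<Omega> \<longrightarrow> x0 \<in> frontier \<Omega> \<longrightarrow>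
    (\<forall>p\<in>frontier \<Omega> \<inter> ball x0 4. C11_graph_near \<Omega> p (1 / M) M) \<longrightarrow>
    (\<forall>x. 0 \<le> u x) \<longrightarrow> (\<forall>x\<in>ball x0 4 - \<Omega>. u x = 0) \<longrightarrow>
    bounded_solution s (\<Omega> \<inter> ball x0 4) g u \<Lambda> \<longrightarrow>
    holder_norm s (\<Omega> \<inter> ball x0 (1/2)) u \<le> ennreal (K * \<Lambda>))"
  \<comment> \<open>The constant is selected as a function of \<open>M\<close> before domain and
    solution are fixed, so that \<open>C\<close> depends on the boundary norm alone.\<close>
  define K where "K M = (SOME K. ?P M K)" for M
  have K: "?P M (K M)" if "0 < M" for M
    unfolding K_def by (rule someI_ex[of "?P M"]) (rule regularity_estimate[OF assms that])
  define C where "C N = K (enn2real N + 1)" for N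
  show ?thesis
  proof (intro exI[of _ C] allI impI)
    fix \<Omega> :: "(real ^ 'n) set" and x0 g u
    assume dom: "locally_C11_domain \<Omega>" and x0: "x0 \<in> frontier \<Omega>"
      and gL: "g \<in> Linf (\<Omega> \<inter> ball x0 4)" and uL: "u \<in> Linf (\<Omega> \<inter> ball x0 4)"
      and sol: "classical_solution s (\<Omega> \<inter> ball x0 4) g u"
      and pos: "\<forall>x. 0 \<le> u x" and zero: "\<forall>x \<in> ball x0 4 - \<Omega>. u x = 0"
    let ?U = "\<Omega> \<inter> ball x0 4" and ?B = "C11_boundary_norm \<Omega> (ball x0 4)"
    have op: "open \<Omega>" using dom by (simp add: locally_C11_domain_def)
    then have opU: "open ?U" by auto
    have uC: "u \<in> C11_loc ?U" and u2: "u \<in> L2s_space s" and lap: "\<And>x. x \<in> ?U \<Longrightarrow> has_frac_laplacian s u x (g x)"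
      using sol by (auto simp: classical_solution_def)
    have um: "u \<in> borel_measurable lebesgue"
    proof -
      let ?w = "\<lambda>x::real^'n. 1 + norm x powr (real CARD('n) + 2 * s)"
      have "?w \<in> borel_measurable lborel" by measurable
      then have w: "?w \<in> borel_measurable lebesgue" by (rule measurable_completion)
      \<comment> \<open>Since \<open>u\<close> is nonnegative, multiplying the integrable quotient
        by the weight recovers \<open>u\<close> itself and with it measurability.\<close>
      have "(\<lambda>x. \<bar>u x\<bar> / ?w x) \<in> borel_measurable lebesgue"
        using u2 by (auto simp: L2s_space_def)
      then have "(\<lambda>x. \<bar>u x\<bar> / ?w x * ?w x) \<in> borel_measurable lebesgue" using w by (rule borel_measurable_times)
      moreover have "\<bar>u x\<bar> / ?w x * ?w x = u x" for x
        using pos powr_ge_zero[of "norm x" "real CARD('n) + 2 * s"] by (simp add: add_nonneg_eq_0_iff)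
      ultimately show ?thesis by simp
    qed
    have uc: "isCont u x" if "x \<in> ?U" for x
      using uC that by (intro differentiable_imp_continuous_within) (auto simp: C11_loc_def)
    have gc: "isCont g x" if "x \<in> ?U" for x
      by (rule frac_laplacian_continuous[OF assms opU uC um lap that])
    have fin: "Linf_norm ?U g < \<infinity>" "Linf_norm ?U u < \<infinity>" using gL uL by (auto simp: Linf_def)
    define S where "S = Linf_norm ?U g + Linf_norm ?U u"
    have Sfin: "S < \<infinity>" using fin by (simp add: S_def)
    define \<sigma> where "\<sigma> = enn2real S"
    have \<sigma>: "0 \<le> \<sigma>" "ennreal \<sigma> = S" using Sfin by (auto simp: \<sigma>_def)
    have Kpos: "0 < C ?B" using K[of "enn2real ?B + 1"] by (simp add: C_def add_nonneg_pos)
    have est: "holder_norm s (\<Omega> \<inter> ball x0 (1/2)) u \<le> ennreal (C ?B * \<Lambda>)" if \<Lambda>: "0 < \<Lambda>" "\<sigma> \<le> \<Lambda>" for \<Lambda>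
    proof -
      have "Linf_norm ?U g \<le> S" "Linf_norm ?U u \<le> S" by (auto simp: S_def intro: add_increasing add_increasing2)
      moreover have "S \<le> ennreal \<Lambda>" using \<Lambda> \<sigma>(2) ennreal_leI by metis
      ultimately have le: "Linf_norm ?U g \<le> ennreal \<Lambda>" "Linf_norm ?U u \<le> ennreal \<Lambda>" by auto
      have \<Lambda>0: "0 \<le> \<Lambda>" using \<Lambda> by simp
      have eqn: "bounded_solution s ?U g u \<Lambda>"
      proof
        fix x assume that: "x \<in> ?U"
        show "u x \<le> \<Lambda> \<and> isCont u x \<and> \<bar>g x\<bar> \<le> \<Lambda> \<and> has_frac_laplacian s u x (g x)"
          using Linf_norm_imp_pointwise[OF opU gc le(1) \<Lambda>0 that] Linf_norm_imp_pointwise[OF opU uc le(2) \<Lambda>0 that] uc[OF that] lap[OF that]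
          by auto
      qed
      have graph: "\<forall>p\<in>frontier \<Omega> \<inter> ball x0 4. C11_graph_near \<Omega> p (1 / (enn2real ?B + 1)) (enn2real ?B + 1)"
        by (intro ballI C11_boundary_norm_graph dom)
      have "0 < enn2real ?B + 1" by (simp add: add_nonneg_pos)
      note est = K[OF this, THEN conjunct2, THEN spec[of _ \<Omega>], THEN spec[of _ x0], THEN spec[of _ u], THEN spec[of _ g],
          THEN spec[of _ \<Lambda>]]
      show ?thesis
        unfolding C_def
        by (rule est[THEN mp, OF \<Lambda>(1), THEN mp, OF op, THEN mp, OF x0, THEN mp, OF graph, THEN mp, OF pos, THEN mp, OF zero, THEN mp, OF eqn])
    qed
    \<comment> \<open>\<sigma> may be \<open>0\<close>, while \<open>est\<close> covers positive
      \<Lambda>; it is applied with \<open>\<sigma> + e / C ?B\<close> for arbitrary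
      \<open>e > 0\<close>.\<close>
    have "holder_norm s (\<Omega> \<inter> ball x0 (1/2)) u \<le> ennreal (C ?B * \<sigma>)"
    proof (rule ennreal_le_epsilon)
      fix e :: real assume e: "0 < e"
      have "holder_norm s (\<Omega> \<inter> ball x0 (1/2)) u \<le> ennreal (C ?B * (\<sigma> + e / C ?B))"
        by (rule est) (use \<sigma> e Kpos in \<open>auto intro: add_nonneg_pos\<close>)
      also have "C ?B * (\<sigma> + e / C ?B) = C ?B * \<sigma> + e" using Kpos by (simp add: distrib_left)
      also have "ennreal (C ?B * \<sigma> + e) = ennreal (C ?B * \<sigma>) + ennreal e"
        using \<sigma> e Kpos by (intro ennreal_plus) auto
      finally show "holder_norm s (\<Omega> \<inter> ball x0 (1/2)) u \<le> ennreal (C ?B * \<sigma>) + ennreal e" .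
    qed
    also have "\<dots> = ennreal (C ?B) * S" using \<sigma> Kpos by (simp add: ennreal_mult)
    finally have main: "holder_norm s (\<Omega> \<inter> ball x0 (1/2)) u \<le> ennreal (C ?B) * S" .
    moreover have "ennreal (C ?B) * S < \<infinity>" using Sfin by (simp add: ennreal_mult_less_top)
    ultimately show "u \<in> holder_space s (\<Omega> \<inter> ball x0 (1/2)) \<and>
      holder_norm s (\<Omega> \<inter> ball x0 (1/2)) u \<le> ennreal (C ?B) * (Linf_norm ?U g + Linf_norm ?U u)"
      unfolding S_def holder_space_def by (auto intro: le_less_trans)
  qed
qed

end
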